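(* Let $d\ge 1$, let $\beta_1,\dots,\beta_d>1$, and let $\mathcal P=\{P_n\}_{n\ge 1}$ be a sequence of parallelepipeds contained in $[0,1)^d$. For each $n\in\mathbb N$ let $\gamma_1^{(n)},\dots,\gamma_d^{(n)}$ be the pairwise orthogonal vectors associated with $f^nP_n$ (as defined in the context), which satisfy $|\gamma_1^{(n)}|\ge\cdots\ge|\gamma_d^{(n)}|>0$, and let $s_n$ be the associated number (as defined in the context). Put $s^*:=\limsup_{n\to\infty}s_n$ and $$W(\mathcal P)=\{\mathbf x\in[0,1)^d:(T_{\beta_1}\times\cdots\times T_{\beta_d})^n(\mathbf x)\in P_n\text{ for infinitely many } n\}.$$ Then $$\dim_{\mathrm H}W(\mathcal P)=s^*.$$ Further, $W(\mathcal P)\in\mathscr G^{s^*}([0,1]^d)$.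
   Context: For $\beta>1$, $T_\beta:[0,1)\to[0,1)$ is $T_\beta x=\beta x-\lfloor\beta x\rfloor$. The product map acts coordinatewise. $\dim_{\mathrm H}$ is Hausdorff dimension. A parallelepiped in $\mathbb R^d$ is a translate of a set $\{x_1\alpha_1+\cdots+x_d\alpha_d:(x_1,\dots,x_d)\in[0,1]^d\}$ with $\alpha_1,\dots,\alpha_d\in\mathbb R^d$ linearly independent column vectors. Let $\alpha_1^{(n)},\dots,\alpha_d^{(n)}$ be the vectors determining $P_n$ up to translation, and let $f=\mathrm{diag}(\beta_1^{-1},\dots,\beta_d^{-1})$, so that $f^nP_n$ is determined by $a_j:=f^n\alpha_j^{(n)}$, $1\le j\le d$. The vectors $\gamma_k=\gamma_k^{(n)}$: with $(\cdot,\cdot)$ the Euclidean inner product and $|\cdot|$ the Euclidean norm, perform Gram–Schmidt on $a_1,\dots,a_d$ in the following greedy order. Let $i_1$ be an index with $|a_{i_1}|=\max_{1\le l\le d}|a_l|$ and put $\gamma_1=a_{i_1}$. For $1<k\le d$, choose $i_k\notin\{i_1,\dots,i_{k-1}\}$ with $$\Big|a_{i_k}-\sum_{j=1}^{k-1}\frac{(a_{i_k},\gamma_j)}{(\gamma_j,\gamma_j)}\gamma_j\Big|=\max_{l\ne i_1,\dots,i_{k-1}}\Big|a_l-\sum_{j=1}^{k-1}\frac{(a_l,\gamma_j)}{(\gamma_j,\gamma_j)}\gamma_j\Big|,$$ and put $\gamma_k=a_{i_k}-\sum_{j=1}^{k-1}\frac{(a_{i_k},\gamma_j)}{(\gamma_j,\gamma_j)}\gamma_j$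 (ties broken arbitrarily). The numbers $s_n$: let $\mathcal A_n=\{\beta_1^{-n},\dots,\beta_d^{-n},|\gamma_1^{(n)}|,\dots,|\gamma_d^{(n)}|\}$ and, for $\tau\in\mathcal A_n$, $\mathcal K_{n,1}(\tau)=\{1\le i\le d:\beta_i^{-n}\le\tau\}$, $\mathcal K_{n,2}(\tau)=\{1\le i\le d:|\gamma_i^{(n)}|\ge\tau\}$. Then $$s_n:=\min_{\tau\in\mathcal A_n}\bigg\{\sum_{i\in\mathcal K_{n,1}(\tau)}1+\sum_{i\notin\mathcal K_{n,1}(\tau)}\frac{-n\log\beta_i}{\log\tau}+\sum_{i\in\mathcal K_{n,2}(\tau)}\bigg(1-\frac{\log|\gamma_i^{(n)}|}{\log\tau}\bigg)\bigg\}.$$ (For all sufficiently large $n$ every element of $\mathcal A_n$ lies in $(0,1)$; only large $n$ matter for the $\limsup$.) Falconer's large intersection class: for $0\le s\le d$, $\mathscr G^s([0,1]^d)$ is the class of $G_\delta$-sets $F\subset[0,1]^d$ such that $\mathcal M^t_\infty(F\cap D)=\mathcal M^t_\infty(D)$ for every $0<t<s$ and every dyadic cube $D\subset[0,1]^d$, where $\mathcal M^t_\infty(A)=\inf\{\sum_i|D_i|^t: A\subset\bigcup_iD_i,\ D_i\text{ dyadic cubes}\}$ and $|D_i|$ is the side length of $D_i$. It has the property that any countable intersection of bi-Lipschitz images of sets in $\mathscr G^s([0,1]^d)$ has Hausdorff dimension at least $s$; in particular every set in the class has Hausdorff dimension at least $s$.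
   Formalization: The clause W(P)∈G^{s*} fails in general since W(P) need not be G_δ (d=1, β=3, P_n=[1/2,3/4]); it is proved whenever W(P) is G_δ, and in every case W(P) is shown to contain a member of G^{s*}([0,1]^d). *)

theory Defs
  imports "HOL-Analysis.Analysis"
begin

text \<open>The gauge \<open>|U|\<^sup>s\<close> of a bounded set, with \<open>|{}|\<^sup>s = 0\<close> and \<open>|U|\<^sup>0 = 1\<close> for nonempty \<open>U\<close>;
  plain \<open>powr\<close> would give \<open>0 powr 0 = 0\<close> for singletons.\<close>

definition diam_gauge :: "real \<Rightarrow> 'a::metric_space set \<Rightarrow> ennreal" where
  "diam_gauge s U = (if U = {} then 0 else if s = 0 then 1 else ennreal (diameter U powr s))"

text \<open>Boundedness of the covering sets is explicit because \<open>diameter\<close> is a junk value on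
  unbounded sets.\<close>

definition hausdorff_pre_measure :: "real \<Rightarrow> real \<Rightarrow> 'a::metric_space set \<Rightarrow> ennreal" where
  "hausdorff_pre_measure s \<delta> A =
     Inf {\<Sum>i. diam_gauge s (U i) | U :: nat \<Rightarrow> 'a set.
            A \<subseteq> (\<Union>i. U i) \<and> (\<forall>i. bounded (U i) \<and> diameter (U i) \<le> \<delta>)}"

definition hausdorff_measure :: "real \<Rightarrow> 'a::metric_space set \<Rightarrow> ennreal" where
  "hausdorff_measure s A = (SUP \<delta>\<in>{0<..}. hausdorff_pre_measure s \<delta> A)"

definition hausdorff_dim :: "'a::metric_space set \<Rightarrow> ereal" where
  "hausdorff_dim A = Inf {ereal s | s. 0 \<le> s \<and> hausdorff_measure s A = 0}"

definition unit_cube :: "(real ^ 'd) set" where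
  "unit_cube = {x. \<forall>i. 0 \<le> x $ i \<and> x $ i \<le> 1}"

definition half_open_unit_cube :: "(real ^ 'd) set" where
  "half_open_unit_cube = {x. \<forall>i. 0 \<le> x $ i \<and> x $ i < 1}"

definition dyadic_side :: "int \<Rightarrow> real" where
  "dyadic_side m = 2 powi (- m)"

text \<open>Dyadic cubes are half-open, as in Falconer's net measures: any two of them are nested
  or disjoint.\<close>

definition dyadic_cube :: "int \<Rightarrow> int ^ 'd \<Rightarrow> (real ^ 'd) set" where
  "dyadic_cube m k =
     {x. \<forall>i. of_int (k $ i) * dyadic_side m \<le> x $ i \<and> x $ i < (of_int (k $ i) + 1) * dyadic_side m}"

text \<open>A family of dyadic cubes is given by its set of indices (level, position); it is
  automatically countable.\<close>

definition dyadic_content :: "real \<Rightarrow> (real ^ 'd) set \<Rightarrow> ennreal" where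
  "dyadic_content t A =
     Inf {\<Sum>\<^sub>\<infinity>(m, k)\<in>I. ennreal (dyadic_side m powr t) | I :: (int \<times> (int ^ 'd)) set.
            A \<subseteq> (\<Union>(m, k)\<in>I. dyadic_cube m k)}"

definition large_intersection_class :: "ereal \<Rightarrow> (real ^ 'd) set set" where
  "large_intersection_class s =
     {F. F \<subseteq> unit_cube \<and> gdelta F \<and>
         (\<forall>t m k. 0 < t \<longrightarrow> ereal t < s \<longrightarrow> dyadic_cube m k \<subseteq> unit_cube \<longrightarrow>
            dyadic_content t (F \<inter> dyadic_cube m k) = dyadic_content t (dyadic_cube m k))}"

definition beta_map :: "real \<Rightarrow> real \<Rightarrow> real" where
  "beta_map b x = b * x - of_int \<lfloor>b * x\<rfloor>"

definition beta_prod :: "real ^ 'd \<Rightarrow> real ^ 'd \<Rightarrow> real ^ 'd" where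
  "beta_prod \<beta> x = (\<chi> i. beta_map (\<beta> $ i) (x $ i))"

text \<open>If the \<open>P n\<close> are closed, \<open>W_set \<beta> P\<close> is a limsup of sets that are not open and need not be
  a \<open>G\<^sub>\<delta>\<close> set: for \<open>d = 1\<close>, \<open>\<beta> = 3\<close> and \<open>P n = [1/2, 3/4]\<close> it meets the Cantor set of points with
  ternary digits in \<open>{0, 1}\<close> in a countable dense subset, which is impossible for a \<open>G\<^sub>\<delta>\<close> set by Baire.\<close>

definition W_set :: "real ^ 'd \<Rightarrow> (nat \<Rightarrow> (real ^ 'd) set) \<Rightarrow> (real ^ 'd) set" where
  "W_set \<beta> P = {x \<in> half_open_unit_cube. \<exists>\<^sub>\<infinity>n. (beta_prod \<beta> ^^ n) x \<in> P n}"

definition parallelepiped_with_edges :: "('d \<Rightarrow> real ^ 'd) \<Rightarrow> (real ^ 'd) set \<Rightarrow> bool" where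
  "parallelepiped_with_edges \<alpha> P \<longleftrightarrow>
     inj \<alpha> \<and> independent (range \<alpha>) \<and>
     (\<exists>p. P = {p + (\<Sum>j\<in>UNIV. c j *\<^sub>R \<alpha> j) | c. \<forall>j. 0 \<le> c j \<and> c j \<le> 1})"

text \<open>The linear map \<open>f = diag(1/\<beta>\<^sub>1, \<dots>, 1/\<beta>\<^sub>d)\<close>.\<close>

definition contraction :: "real ^ 'd \<Rightarrow> real ^ 'd \<Rightarrow> real ^ 'd" where
  "contraction \<beta> v = (\<chi> i. inverse (\<beta> $ i) * v $ i)"

definition gs_residual :: "(nat \<Rightarrow> 'a::real_inner) \<Rightarrow> nat \<Rightarrow> 'a \<Rightarrow> 'a" where
  "gs_residual \<gamma> k v = v - (\<Sum>j\<in>{1..<k}. ((v \<bullet> \<gamma> j) / (\<gamma> j \<bullet> \<gamma> j)) *\<^sub>R \<gamma> j)"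

text \<open>\<open>\<gamma> 1, \<dots>, \<gamma> d\<close> is a possible outcome of the greedy procedure run on the vectors \<open>a j\<close>, where
  \<open>\<sigma> k\<close> is the index chosen at step \<open>k\<close>. It is a relation because ties may be broken arbitrarily.\<close>

definition greedy_gram_schmidt :: "('d \<Rightarrow> real ^ 'd) \<Rightarrow> (nat \<Rightarrow> real ^ 'd) \<Rightarrow> bool" where
  "greedy_gram_schmidt a \<gamma> \<longleftrightarrow>
     (\<exists>\<sigma> :: nat \<Rightarrow> 'd. \<forall>k\<in>{1..CARD('d)}.
        \<sigma> k \<notin> \<sigma> ` {1..<k} \<and>
        (\<forall>l. l \<notin> \<sigma> ` {1..<k} \<longrightarrow>
           norm (gs_residual \<gamma> k (a l)) \<le> norm (gs_residual \<gamma> k (a (\<sigma> k)))) \<and>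
        \<gamma> k = gs_residual \<gamma> k (a (\<sigma> k)))"

definition scales :: "real ^ 'd \<Rightarrow> nat \<Rightarrow> (nat \<Rightarrow> real ^ 'd) \<Rightarrow> real set" where
  "scales \<beta> n \<gamma> = range (\<lambda>i. inverse (\<beta> $ i) ^ n) \<union> (\<lambda>k. norm (\<gamma> k)) ` {1..CARD('d)}"

definition K1 :: "real ^ 'd \<Rightarrow> nat \<Rightarrow> real \<Rightarrow> 'd set" where
  "K1 \<beta> n \<tau> = {i. inverse (\<beta> $ i) ^ n \<le> \<tau>}"

definition K2 :: "(nat \<Rightarrow> real ^ 'd) \<Rightarrow> real \<Rightarrow> nat set" where
  "K2 \<gamma> \<tau> = {k \<in> {1..CARD('d)}. norm (\<gamma> k) \<ge> \<tau>}"

definition scale_value :: "real ^ 'd \<Rightarrow> nat \<Rightarrow> (nat \<Rightarrow> real ^ 'd) \<Rightarrow> real \<Rightarrow> real" where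
  "scale_value \<beta> n \<gamma> \<tau> =
     (\<Sum>i\<in>K1 \<beta> n \<tau>. 1)
     + (\<Sum>i\<in>- K1 \<beta> n \<tau>. (- real n * ln (\<beta> $ i)) / ln \<tau>)
     + (\<Sum>k\<in>K2 \<gamma> \<tau>. 1 - ln (norm (\<gamma> k)) / ln \<tau>)"

definition s_num :: "real ^ 'd \<Rightarrow> nat \<Rightarrow> (nat \<Rightarrow> real ^ 'd) \<Rightarrow> real" where
  "s_num \<beta> n \<gamma> = Min (scale_value \<beta> n \<gamma> ` scales \<beta> n \<gamma>)"

definition s_star :: "real ^ 'd \<Rightarrow> (nat \<Rightarrow> nat \<Rightarrow> real ^ 'd) \<Rightarrow> ereal" where
  "s_star \<beta> \<gamma> = limsup (\<lambda>n. ereal (s_num \<beta> n (\<gamma> n)))"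

end

theory Submission
  imports Defs
begin

text \<open>Upper bound: the points hitting \<open>P n\<close> at time \<open>n\<close> lie in translates of the contracted
  parallelepiped by left end points of cylinders. At a scale \<open>\<tau>\<close>, end points in directions with short
  cylinders may be rounded to multiples of \<open>\<tau>\<close>, and each translate is covered by cells aligned with the
  \<open>\<gamma>\<close>'s; the optimal \<open>\<tau>\<close> leads to about \<open>\<tau> ^ (- s\<^sub>n)\<close> cells of size \<open>\<tau>\<close>.

  Lower bound: a positive proportion of the cylinders in any cube is full, and greediness of the
  Gram-Schmidt process makes the contracted parallelepiped contain an orthogonal box with sides
  comparable to the \<open>\<gamma>\<close>'s. Spreading mass evenly over these boxes, a cube of side \<open>r\<close> receives at most a
  constant times \<open>\<Prod>\<^sub>i max r (\<beta>\<^sub>i ^ (- n)) * \<Prod>\<^sub>k min 1 (r / |\<gamma>\<^sub>k|)\<close>, a function of \<open>r\<close> that is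
  piecewise affine in logarithmic coordinates, with the scales as nodes. So for \<open>t < s\<^sub>n\<close> the union
  of the boxes fills every cube up to a constant in net content of exponent \<open>t\<close>. As \<open>t < d\<close>, the
  constant can be improved to 1 by comparison with Lebesgue measure, and a nested-cubes argument in
  the style of Baire passes from the open sets to their limsup set.\<close>


section \<open>Cylinders of beta-transformations\<close>

text \<open>In the upper bound, a \<open>t'\<close> strictly between the limsup and \<open>t\<close>
  leaves a factor geometric in \<open>n\<close>, which beats the polynomial loss made in counting
  end points. In the lower bound, \<open>t' > t\<close> pays for restricting the mass to a fixed
  cube, while \<open>t < d\<close> pays, on a finer dyadic level, for the constant losses: non-full
  cylinders, and boxes smaller than the parallelepipeds.

  The lower bound works inside \<open>W_set\<close>, which need not be a G-delta set when the
  \<open>P n\<close> are closed: the subset is built from open boxes placed on full cylinders. On a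
  cylinder that is not full the iterate misses part of the unit cube, possibly all of
  \<open>P n\<close>. The limsup provides infinitely many good orders and no more, so the
  \<open>k\<close>th open set collects all orders from \<open>k\<close> on; for a given cube a
  single good order beyond \<open>k\<close> suffices.\<close>

lemma beta_map_ge_0: "0 \<le> beta_map b x" and beta_map_less_1: "beta_map b x < 1"
  unfolding beta_map_def by linarith+

lemma beta_map_funpow_range:
  assumes "0 \<le> x" "x < 1"
  shows "0 \<le> (beta_map b ^^ n) x" "(beta_map b ^^ n) x < 1"
  using assms by (cases n; simp add: beta_map_ge_0 beta_map_less_1)+

text \<open>The zeros of the \<open>n\<close>th iterate are the left end points of the cylinders of order \<open>n\<close>, and a
  cylinder is full if the iterate maps it onto \<open>[0, 1)\<close>.\<close>

definition left_ends :: "real \<Rightarrow> nat \<Rightarrow> real set" where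
  "left_ends b n = {l. 0 \<le> l \<and> l < 1 \<and> (beta_map b ^^ n) l = 0}"

text \<open>The iterate has slope \<open>b ^ n\<close> on a cylinder, so going back from
  \<open>x\<close> by its value divided by \<open>b ^ n\<close> leads to the point where it
  vanishes.\<close>

definition cyl_start :: "real \<Rightarrow> nat \<Rightarrow> real \<Rightarrow> real" where
  "cyl_start b n x = x - (beta_map b ^^ n) x / b ^ n"

definition full_ends :: "real \<Rightarrow> nat \<Rightarrow> real set" where
  "full_ends b n = {l \<in> left_ends b n. \<forall>y. l \<le> y \<and> y < l + 1 / b ^ n \<longrightarrow>
      y < 1 \<and> (beta_map b ^^ n) y = b ^ n * (y - l)}"

text \<open>By induction: between the new start and \<open>x\<close> the next digit is the same as
  at \<open>x\<close>, so one more step is affine too. Points to the right of \<open>x\<close> are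
  left out because the cylinder may be cut off there.\<close>

lemma cyl_start_affine:
  assumes b: "1 < b" and x: "0 \<le> x" "x < 1"
  shows "0 \<le> cyl_start b n x \<and> cyl_start b n x \<le> x \<and>
    (\<forall>y. cyl_start b n x \<le> y \<and> y \<le> x \<longrightarrow> (beta_map b ^^ n) y = b ^ n * (y - cyl_start b n x))"
proof (induction n)
  case 0
  then show ?case using x by (simp add: cyl_start_def)
next
  case (Suc n)
  define l where "l = cyl_start b n x"
  define z where "z = (beta_map b ^^ n) x"
  define d where "d = \<lfloor>b * z\<rfloor>"
  have bp: "b ^ n > 0" using b by simp
  have IH: "0 \<le> l" "l \<le> x"
    "\<And>y. l \<le> y \<Longrightarrow> y \<le> x \<Longrightarrow> (beta_map b ^^ n) y = b ^ n * (y - l)"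
    using Suc by (auto simp: l_def)
  have z: "0 \<le> z" "z < 1" using beta_map_funpow_range[OF x] by (auto simp: z_def)
  have zl: "z = b ^ n * (x - l)" using IH(2) IH(3)[of x] by (simp add: z_def)
  have d0: "0 \<le> d" using z b by (simp add: d_def)
  have T: "(beta_map b ^^ Suc n) x = b * z - of_int d"
    by (simp add: z_def d_def beta_map_def)
  have l': "cyl_start b (Suc n) x = l + of_int d / b ^ Suc n"
    unfolding cyl_start_def T using b zl by (simp add: field_simps flip: distrib_left)
  have dz: "of_int d \<le> b * z" "b * z < of_int d + 1" by (auto simp: d_def)
  have le: "cyl_start b (Suc n) x \<le> x"
    unfolding cyl_start_def using beta_map_funpow_range(1)[OF x, where b = b and n = "Suc n"] b
    by (simp del: funpow.simps power_Suc)
  have "(beta_map b ^^ Suc n) y = b ^ Suc n * (y - cyl_start b (Suc n) x)"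
    if y: "cyl_start b (Suc n) x \<le> y" "y \<le> x" for y
  proof -
    have ly: "l \<le> y" using y(1) l' d0 b
      by (smt (verit) divide_nonneg_pos of_int_0_le_iff zero_less_power)
    have Ty: "(beta_map b ^^ n) y = b ^ n * (y - l)" using IH(3) ly y by auto
    have "b ^ n * (y - l) \<le> z" unfolding zl using y bp by simp
    then have up: "b * (b ^ n * (y - l)) < of_int d + 1"
      using dz(2) b by (smt (verit, best) mult_left_mono)
    have lo: "of_int d \<le> b * (b ^ n * (y - l))"
      using y(1) bp b unfolding l' by (simp add: field_simps)
    have "\<lfloor>b * (b ^ n * (y - l))\<rfloor> = d" using up lo by linarith
    then have "(beta_map b ^^ Suc n) y = b * (b ^ n * (y - l)) - of_int d"
      by (simp add: beta_map_def Ty)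
    moreover have "b ^ Suc n * (y - cyl_start b (Suc n) x) = b * (b ^ n * (y - l)) - of_int d"
      using bp b unfolding l' by (simp add: right_diff_distrib distrib_left)
    ultimately show ?thesis by simp
  qed
  moreover have "0 \<le> cyl_start b (Suc n) x" using IH(1) d0 b l' by simp
  ultimately show ?case using le by blast
qed

lemmas cyl_start_ge_0 = cyl_start_affine[THEN conjunct1]
lemmas cyl_start_le = cyl_start_affine[THEN conjunct2, THEN conjunct1]
lemma beta_map_funpow_affine:
  assumes "1 < b" "0 \<le> x" "x < 1" "cyl_start b n x \<le> y" "y \<le> x"
  shows "(beta_map b ^^ n) y = b ^ n * (y - cyl_start b n x)"
  using cyl_start_affine[OF assms(1-3)] assms(4,5) by blast

lemma cyl_start_in_left_ends:
  assumes "1 < b" "0 \<le> x" "x < 1"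
  shows "cyl_start b n x \<in> left_ends b n"
  using beta_map_funpow_affine[OF assms order.refl cyl_start_le[OF assms]]
    cyl_start_ge_0[OF assms, of n] cyl_start_le[OF assms, of n] assms
  by (simp add: left_ends_def)

lemma cyl_start_gap:
  assumes "1 < b" "0 \<le> x" "x < 1"
  shows "x < cyl_start b n x + 1 / b ^ n"
  using beta_map_funpow_range(2)[OF assms(2,3), where b = b and n = n] assms(1)
  by (simp add: cyl_start_def divide_strict_right_mono)

lemma full_ends_subset: "full_ends b n \<subseteq> left_ends b n"
  by (auto simp: full_ends_def)

lemma no_left_end_between:
  assumes b: "1 < b" and x: "0 \<le> x" "x < 1" and l: "l \<in> left_ends b n" "l \<le> x"
  shows "l \<le> cyl_start b n x"
proof (rule ccontr)
  assume c: "\<not> l \<le> cyl_start b n x"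
  then have "(beta_map b ^^ n) l = b ^ n * (l - cyl_start b n x)"
    using beta_map_funpow_affine[OF b x] l by auto
  then show False using l b c by (auto simp: left_ends_def)
qed

lemma full_ends_separated:
  assumes b: "1 < b" and l: "l \<in> full_ends b n" and k: "k \<in> left_ends b n" and "l < k"
  shows "l + 1 / b ^ n \<le> k"
proof (rule ccontr)
  assume "\<not> ?thesis"
  then have "(beta_map b ^^ n) k = b ^ n * (k - l)"
    using l \<open>l < k\<close> by (auto simp: full_ends_def)
  then show False using k b \<open>l < k\<close> by (auto simp: left_ends_def)
qed

section \<open>Counting full and non-full cylinders in an interval\<close>

lemma card_separated:
  fixes A :: "real set"
  assumes "0 < e" and A: "A \<subseteq> {a..<c}" and ac: "a \<le> c"
    and sep: "\<And>x y. x \<in> A \<Longrightarrow> y \<in> A \<Longrightarrow> x < y \<Longrightarrow> x + e \<le> y"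
  shows "finite A \<and> real (card A) \<le> (c - a) / e + 1"
proof -
  \<comment> \<open>The number of the block of length \<open>e\<close> in which a point lies; by
    separation no block holds two points.\<close>
  define h where "h = (\<lambda>x. \<lfloor>(x - a) / e\<rfloor>)"
  have lt: "h x < h y" if "x \<in> A" "y \<in> A" "x < y" for x y
  proof -
    have "((x - a) + e) / e \<le> (y - a) / e" using sep[OF that] \<open>0 < e\<close> by (intro divide_right_mono) auto
    then have "(x - a) / e + 1 \<le> (y - a) / e" using \<open>0 < e\<close> by (simp add: add_divide_distrib)
    then show ?thesis unfolding h_def by linarith
  qed
  then have inj: "inj_on h A" by (metis inj_onI less_irrefl linorder_cases)
  have sub: "h ` A \<subseteq> {0..\<lfloor>(c - a) / e\<rfloor>}"
  proof
    fix v assume "v \<in> h ` A"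
    then obtain x where x: "x \<in> A" "v = h x" by auto
    then have "a \<le> x" "x < c" using A by auto
    then have "0 \<le> (x - a) / e" "(x - a) / e \<le> (c - a) / e"
      using \<open>0 < e\<close> by (auto simp: divide_right_mono)
    then show "v \<in> {0..\<lfloor>(c - a) / e\<rfloor>}" using x by (auto simp: h_def floor_mono)
  qed
  have fin: "finite A" using finite_subset[OF sub] inj finite_imageD by blast
  have "card A = card (h ` A)" using card_image[OF inj] by simp
  also have "\<dots> \<le> card {0..\<lfloor>(c - a) / e\<rfloor>}" using sub by (intro card_mono) auto
  finally have "card A \<le> nat (\<lfloor>(c - a) / e\<rfloor> + 1)" by simp
  moreover have "0 \<le> (c - a) / e" using ac \<open>0 < e\<close> by simp
  ultimately have "real (card A) \<le> (c - a) / e + 1" by linarith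
  then show ?thesis using fin by simp
qed

lemma full_ends_card_upper:
  assumes b: "1 < b" and "a \<le> c"
  shows "finite (full_ends b n \<inter> {a..<c}) \<and>
    real (card (full_ends b n \<inter> {a..<c})) \<le> (c - a) * b ^ n + 1"
  using card_separated[of "1 / b ^ n" "full_ends b n \<inter> {a..<c}" a c] b \<open>a \<le> c\<close>
    full_ends_separated[OF b] full_ends_subset[of b n] by auto

text \<open>The child with digit 0 of a full cylinder is full and keeps the left end point. Hence
  the counts of full ends grow with the order, which lets the last few orders be bounded by the last
  one.\<close>

lemma full_ends_Suc:
  assumes b: "1 < b"
  shows "full_ends b n \<subseteq> full_ends b (Suc n)"
proof
  fix l assume l: "l \<in> full_ends b n"
  have l0: "0 \<le> l" "l < 1" "(beta_map b ^^ n) l = 0"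
    using l by (auto simp: full_ends_def left_ends_def)
  have "y < 1 \<and> (beta_map b ^^ Suc n) y = b ^ Suc n * (y - l)"
    if y: "l \<le> y" "y < l + 1 / b ^ Suc n" for y
  proof -
    have "1 / b ^ Suc n \<le> 1 / b ^ n" using b by (intro divide_left_mono) auto
    then have "y < l + 1 / b ^ n" using y by linarith
    then have Ty: "(beta_map b ^^ n) y = b ^ n * (y - l)" and "y < 1"
      using l y by (auto simp: full_ends_def)
    have "b * (b ^ n * (y - l)) < 1" "0 \<le> b * (b ^ n * (y - l))"
      using y b by (auto simp: field_simps)
    then have "\<lfloor>b * (b ^ n * (y - l))\<rfloor> = 0" by linarith
    then show ?thesis using Ty \<open>y < 1\<close> by (simp add: beta_map_def)
  qed
  moreover have "l \<in> left_ends b (Suc n)" using l0 by (simp add: left_ends_def beta_map_def)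
  ultimately show "l \<in> full_ends b (Suc n)" by (auto simp: full_ends_def)
qed

text \<open>Of the cylinders of order \<open>n + 1\<close> with a common parent of order \<open>n\<close>, only the last one can
  fail to be full.\<close>

lemma sibling_full:
  assumes b: "1 < b" and k: "k \<in> left_ends b (Suc n)" and k': "k' \<in> left_ends b (Suc n)"
    and "k < k'" and same: "cyl_start b n k = cyl_start b n k'"
  shows "k \<in> full_ends b (Suc n)"
proof -
  define l where "l = cyl_start b n k'"
  have x': "0 \<le> k'" "k' < 1" and x: "0 \<le> k" "k < 1" using k k' by (auto simp: left_ends_def)
  have aff: "(beta_map b ^^ n) y = b ^ n * (y - l)" if "l \<le> y" "y \<le> k'" for y
    using beta_map_funpow_affine[OF b x'] that by (simp add: l_def)
  have lk: "l \<le> k" using cyl_start_le[OF b x, of n] same by (simp add: l_def)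
  \<comment> \<open>Both end points are zeros of the next iterate and lie in the same parent, so
    their rescaled offsets from its start are integers. Two different integers differ by at least 1,
    which leaves room for the whole of the left cylinder.\<close>
  have int: "\<exists>d::int. b ^ Suc n * (y - l) = of_int d" if "y \<in> left_ends b (Suc n)" "l \<le> y" "y \<le> k'" for y
    using that aff[of y] by (auto simp: left_ends_def beta_map_def mult.assoc intro!: exI[of _ "\<lfloor>b * (b ^ n * (y - l))\<rfloor>"])
  obtain d d' :: int where d: "b ^ Suc n * (k - l) = of_int d" and d': "b ^ Suc n * (k' - l) = of_int d'"
    using int[OF k] int[OF k'] lk \<open>k < k'\<close> by auto
  have bp: "0 < b ^ Suc n" using b by (simp del: power_Suc)
  have "(of_int d :: real) < of_int d'" unfolding d[symmetric] d'[symmetric]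
    using \<open>k < k'\<close> bp by (intro mult_strict_left_mono) auto
  then have "d + 1 \<le> d'" by simp
  then have "of_int d + 1 \<le> (of_int d' :: real)" by (metis of_int_1 of_int_add of_int_le_iff)
  then have "b ^ Suc n * (k' - k) \<ge> 1" using d d' by (simp add: algebra_simps)
  then have "1 / b ^ Suc n \<le> k' - k" using bp by (simp add: pos_divide_le_eq mult.commute del: power_Suc)
  then have gap: "k + 1 / b ^ Suc n \<le> k'" by linarith
  have "y < 1 \<and> (beta_map b ^^ Suc n) y = b ^ Suc n * (y - k)"
    if y: "k \<le> y" "y < k + 1 / b ^ Suc n" for y
  proof -
    have Ty: "(beta_map b ^^ n) y = b ^ n * (y - l)" using aff y gap lk by auto
    have "y - k < 1 / b ^ Suc n" using y by linarith
    then have "b ^ Suc n * (y - k) < 1" using bp by (simp add: pos_less_divide_eq mult.commute del: power_Suc)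
    moreover have "0 \<le> b ^ Suc n * (y - k)" using y bp by simp
    moreover have e: "b * (b ^ n * (y - l)) = b ^ Suc n * (y - k) + of_int d"
      using d by (simp add: algebra_simps)
    ultimately have "\<lfloor>b * (b ^ n * (y - l))\<rfloor> = d" by linarith
    then show ?thesis using Ty e y gap x' by (simp add: beta_map_def)
  qed
  then show ?thesis using k by (auto simp: full_ends_def)
qed

lemma left_ends_0: "left_ends b 0 = {0}" by (auto simp: left_ends_def)

text \<open>By \<open>sibling_full\<close> a parent has at most one non-full child, so it suffices
  to count parents; the additional 1 is for a parent that starts before \<open>a\<close>.\<close>

lemma nonfull_card:
  assumes b: "1 < b" and ac: "0 \<le> a" "a \<le> c" and fin: "finite (left_ends b n \<inter> {a..<c})"
  defines "N \<equiv> (left_ends b (Suc n) - full_ends b (Suc n)) \<inter> {a..<c}"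
  shows "finite N \<and> card N \<le> card (left_ends b n \<inter> {a..<c}) + 1"
proof -
  define S where "S = {l \<in> cyl_start b n ` N. l < a}"
  have N: "k \<in> left_ends b (Suc n)" "0 \<le> k" "k < 1" "a \<le> k" "k < c" if "k \<in> N" for k
    using that by (auto simp: N_def left_ends_def)
  have inj: "inj_on (cyl_start b n) N"
  proof (rule inj_onI)
    fix k k' assume kk: "k \<in> N" "k' \<in> N" "cyl_start b n k = cyl_start b n k'"
    have "\<not> k < k'" using sibling_full[OF b N(1)[OF kk(1)] N(1)[OF kk(2)]] kk by (auto simp: N_def)
    moreover have "\<not> k' < k" using sibling_full[OF b N(1)[OF kk(2)] N(1)[OF kk(1)]] kk
      by (auto simp: N_def)
    ultimately show "k = k'" by linarith
  qed
  \<comment> \<open>Starts in \<open>S\<close> lie below \<open>a\<close>, hence to the left of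
    every point of \<open>N\<close>. By \<open>no_left_end_between\<close> none of them exceeds
    another, so \<open>S\<close> has at most one element.\<close>
  have S1: "l \<le> l'" if ll: "l \<in> S" "l' \<in> S" for l l'
  proof -
    obtain k k' where "k \<in> N" "l = cyl_start b n k" "k' \<in> N" "l' = cyl_start b n k'"
      using ll by (auto simp: S_def)
    moreover have "l < a" using ll by (simp add: S_def)
    ultimately show ?thesis
      using no_left_end_between[OF b, of k' l n] N cyl_start_in_left_ends[OF b, of k n]
      by (metis order.trans less_imp_le)
  qed
  have S: "S \<subseteq> {SOME l. l \<in> S}"
    using S1 by (metis antisym insertI1 someI subsetI)
  have sub: "cyl_start b n ` N \<subseteq> (left_ends b n \<inter> {a..<c}) \<union> S"
  proof
    fix l assume "l \<in> cyl_start b n ` N"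
    then obtain k where k: "k \<in> N" "l = cyl_start b n k" by auto
    then have "l \<in> left_ends b n" "l \<le> k" using cyl_start_in_left_ends[OF b] cyl_start_le[OF b] N by auto
    then show "l \<in> (left_ends b n \<inter> {a..<c}) \<union> S"
      using k N(5)[OF k(1)] by (auto simp: S_def)
  qed
  have finS: "finite S" "card S \<le> 1"
    using finite_subset[OF S] card_mono[OF _ S] by auto
  have finU: "finite ((left_ends b n \<inter> {a..<c}) \<union> S)" using fin finS by simp
  have "finite N" using finite_imageD[OF finite_subset[OF sub finU] inj] .
  moreover have "card N = card (cyl_start b n ` N)" using card_image[OF inj] by simp
  moreover have "\<dots> \<le> card ((left_ends b n \<inter> {a..<c}) \<union> S)" using card_mono[OF finU sub] .
  moreover have "\<dots> \<le> card (left_ends b n \<inter> {a..<c}) + 1"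
    using card_Un_le[of "left_ends b n \<inter> {a..<c}" S] finS by linarith
  ultimately show ?thesis by simp
qed

text \<open>Split each order into full and non-full ends and bound the latter by the order before;
  the only cylinder of order 0 is full. As full ends are easy to count from above, this serves for
  both directions.\<close>

lemma left_ends_card_le_sum:
  assumes b: "1 < b" and ac: "0 \<le> a" "a \<le> c"
  shows "finite (left_ends b n \<inter> {a..<c}) \<and>
    card (left_ends b n \<inter> {a..<c}) \<le> (\<Sum>k\<le>n. card (full_ends b k \<inter> {a..<c})) + n"
proof (induction n)
  case 0
  have "left_ends b 0 \<subseteq> full_ends b 0"
    by (auto simp: left_ends_0 full_ends_def)
  then have "left_ends b 0 \<inter> {a..<c} = full_ends b 0 \<inter> {a..<c}" using full_ends_subset by blast
  moreover have "finite (left_ends b 0 \<inter> {a..<c})" by (simp add: left_ends_0)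
  ultimately show ?case by simp
next
  case (Suc n)
  let ?N = "(left_ends b (Suc n) - full_ends b (Suc n)) \<inter> {a..<c}"
  let ?F = "full_ends b (Suc n) \<inter> {a..<c}"
  have N: "finite ?N" "card ?N \<le> card (left_ends b n \<inter> {a..<c}) + 1"
    using nonfull_card[OF b ac] Suc by auto
  have F: "finite ?F" using full_ends_card_upper[OF b ac(2)] by simp
  have e: "left_ends b (Suc n) \<inter> {a..<c} = ?N \<union> ?F" using full_ends_subset[of b "Suc n"] by auto
  have "card (left_ends b (Suc n) \<inter> {a..<c}) \<le> card ?N + card ?F"
    unfolding e by (rule card_Un_le)
  moreover have "finite (left_ends b (Suc n) \<inter> {a..<c})" unfolding e using N F by simp
  ultimately show ?case using N Suc by simp
qed

lemma full_ends_mono: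
  assumes "1 < b" "k \<le> n"
  shows "full_ends b k \<subseteq> full_ends b n"
  using lift_Suc_mono_le[of "full_ends b" k n] full_ends_Suc assms by blast

text \<open>Each of the \<open>n + 1\<close> terms is bounded by the largest. The resulting
  polynomial factor is absorbed in \<open>summable_poly_times_geometric\<close>.\<close>

lemma left_ends_card_upper:
  assumes b: "1 < b"
  shows "finite (left_ends b n)" "real (card (left_ends b n)) \<le> 3 * real (n + 1) * b ^ n"
proof -
  have e: "left_ends b n = left_ends b n \<inter> {0..<1}" by (auto simp: left_ends_def)
  have c: "finite (left_ends b n)"
    "card (left_ends b n) \<le> (\<Sum>k\<le>n. card (full_ends b k \<inter> {0..<1})) + n"
    using left_ends_card_le_sum[OF b, of 0 1 n] e by auto
  show "finite (left_ends b n)" by fact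
  have "real (card (left_ends b n)) \<le> (\<Sum>k\<le>n. real (card (full_ends b k \<inter> {0..<1}))) + n"
    using c(2) by (metis (mono_tags, lifting) of_nat_add of_nat_le_iff of_nat_sum sum.cong)
  also have "\<dots> \<le> (\<Sum>k\<le>n. 2 * b ^ n) + real (n + 1) * b ^ n"
  proof (intro add_mono sum_mono)
    fix k assume "k \<in> {..n}"
    then have "b ^ k \<le> b ^ n" "1 \<le> b ^ n" using b by (auto intro: power_increasing)
    then show "real (card (full_ends b k \<inter> {0..<1})) \<le> 2 * b ^ n"
      using full_ends_card_upper[OF b, of 0 1 k] by simp
  next
    have "real (n + 1) * 1 \<le> real (n + 1) * b ^ n" using b by (intro mult_left_mono) auto
    moreover have "real n \<le> real (n + 1) * 1" by simp
    ultimately show "real n \<le> real (n + 1) * b ^ n" by (rule order.trans[rotated])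
  qed
  also have "\<dots> = 3 * real (n + 1) * b ^ n" by (simp add: algebra_simps)
  finally show "real (card (left_ends b n)) \<le> 3 * real (n + 1) * b ^ n" .
qed

lemma left_ends_card_lower:
  assumes b: "1 < b" and ac: "0 \<le> a" "a \<le> c" "c \<le> 1"
  shows "(c - a) * b ^ n \<le> real (card (left_ends b n \<inter> {a..<c})) + 1"
proof -
  let ?L = "left_ends b n \<inter> {a..<c}"
  have fin: "finite (insert a ?L)" using left_ends_card_upper(1)[OF b] by simp
  \<comment> \<open>A cylinder that starts before \<open>a\<close> is replaced by the interval of
    length \<open>1 / b ^ n\<close> at \<open>a\<close>, which still covers its part in
    \<open>{a..<c}\<close>; hence the point \<open>a\<close> and the additional 1.\<close>
  have "{a..<c} \<subseteq> (\<Union>l\<in>insert a ?L. {l..<l + 1 / b ^ n})"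
  proof
    fix x assume x: "x \<in> {a..<c}"
    then have x01: "0 \<le> x" "x < 1" using ac by auto
    let ?l = "cyl_start b n x"
    have l: "?l \<in> left_ends b n" "?l \<le> x" "x < ?l + 1 / b ^ n"
      using cyl_start_in_left_ends[OF b x01] cyl_start_le[OF b x01] cyl_start_gap[OF b x01] by auto
    show "x \<in> (\<Union>l\<in>insert a ?L. {l..<l + 1 / b ^ n})"
    proof (cases "?l < a")
      case True
      then show ?thesis using x l by auto
    next
      case False
      then have "?l \<in> ?L" using x l by auto
      then show ?thesis using l by auto
    qed
  qed
  then have "emeasure lborel {a..<c} \<le> emeasure lborel (\<Union>l\<in>insert a ?L. {l..<l + 1 / b ^ n})"
    using fin by (intro emeasure_mono sets.finite_UN) auto
  also have "\<dots> \<le> (\<Sum>l\<in>insert a ?L. emeasure lborel {l..<l + 1 / b ^ n})"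
    using fin by (intro emeasure_subadditive_finite) auto
  also have "\<dots> = of_nat (card (insert a ?L)) * ennreal (1 / b ^ n)"
    using b by simp
  also have "\<dots> = ennreal (real (card (insert a ?L)) * (1 / b ^ n))"
    using b by (subst ennreal_mult') (simp_all add: ennreal_of_nat_eq_real_of_nat del: card_insert_disjoint)
  finally have "ennreal (c - a) \<le> ennreal (real (card (insert a ?L)) * (1 / b ^ n))"
    using ac by simp
  then have "c - a \<le> real (card (insert a ?L)) * (1 / b ^ n)"
    using b by (subst (asm) ennreal_le_iff) auto
  then have "(c - a) * b ^ n \<le> real (card (insert a ?L))" using b by (simp add: field_simps)
  also have "\<dots> \<le> real (card ?L) + 1" using fin by (simp add: card_insert_if)
  finally show ?thesis .
qed

lemma eventually_linear_le_exp:
  assumes "1 < (b::real)" "0 < e"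
  shows "eventually (\<lambda>n. real n * p + q \<le> e * b ^ n) sequentially"
proof -
  have "(\<lambda>n. (p * (real n / b ^ n) + q * (1 / b ^ n))) \<longlonglongrightarrow> p * 0 + q * 0"
    using assms(1) by (intro tendsto_intros lim_n_over_pown)
      (auto simp: inverse_eq_divide[symmetric] intro!: LIMSEQ_inverse_realpow_zero)
  then have "eventually (\<lambda>n. p * (real n / b ^ n) + q * (1 / b ^ n) < e) sequentially"
    using assms(2) by (intro order_tendstoD) auto
  then show ?thesis
  proof eventually_elim
    case (elim n)
    have "(p * (real n / b ^ n) + q * (1 / b ^ n)) * b ^ n = real n * p + q"
      using assms(1) by (simp add: field_simps)
    moreover have "(p * (real n / b ^ n) + q * (1 / b ^ n)) * b ^ n \<le> e * b ^ n"
      using elim assms(1) by (intro mult_right_mono) auto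
    ultimately show ?case by simp
  qed
qed

text \<open>All orders up to \<open>n\<close> together have about \<open>(c - a) * b ^ n\<close>
  full ends at least. Orders below \<open>n - M\<close> account for at most half of this, by the
  geometric decay of their counts, and each of the remaining \<open>M + 1\<close> orders has at most
  as many full ends as order \<open>n\<close>.\<close>

lemma full_ends_card_lower:
  assumes b: "1 < b"
  shows "\<exists>e>0. \<forall>a c. 0 \<le> a \<longrightarrow> a < c \<longrightarrow> c \<le> 1 \<longrightarrow>
      eventually (\<lambda>n. e * (c - a) * b ^ n \<le>
        real (card {l \<in> full_ends b n. a < l \<and> l + 1 / b ^ n < c})) sequentially"
proof -
  have "(\<lambda>m. (1 / b) ^ m * (b / (b - 1))) \<longlonglongrightarrow> 0 * (b / (b - 1))"
    using b by (intro tendsto_intros LIMSEQ_power_zero) auto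
  then have "eventually (\<lambda>m. (1 / b) ^ m * (b / (b - 1)) < 1 / 2) sequentially"
    by (intro order_tendstoD) auto
  then obtain M where M: "(1 / b) ^ M * (b / (b - 1)) < 1 / 2"
    by (auto simp: eventually_sequentially)
  \<comment> \<open>One factor 2 is lost to the orders below \<open>n - M\<close>, another to the
    error terms linear in \<open>n\<close>, and \<open>M + 1\<close> to the orders that
    remain.\<close>
  define e where "e = 1 / (4 * real (M + 1))"
  have e: "e > 0" by (simp add: e_def)
  moreover have "eventually (\<lambda>n. e * (c - a) * b ^ n \<le>
        real (card {l \<in> full_ends b n. a < l \<and> l + 1 / b ^ n < c})) sequentially"
    if ac: "0 \<le> a" "a < c" "c \<le> 1" for a c
  proof -
    let ?F = "\<lambda>n. full_ends b n \<inter> {a..<c}"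
    have finF: "finite (?F n)" for n using full_ends_card_upper[OF b] ac by simp
    have main: "(c - a) * b ^ n / 2 \<le> real (M + 1) * real (card (?F n)) + 2 * real n + 2" if "M \<le> n" for n
    proof -
      have "(c - a) * b ^ n \<le> real (card (left_ends b n \<inter> {a..<c})) + 1"
        using left_ends_card_lower[OF b] ac by simp
      also have "\<dots> \<le> (\<Sum>k\<le>n. real (card (?F k))) + real n + 1"
        using left_ends_card_le_sum[OF b ac(1), of c n] ac(2)
        by (metis (mono_tags, lifting) add_right_mono less_imp_le of_nat_add of_nat_le_iff of_nat_sum sum.cong)
      also have "(\<Sum>k\<le>n. real (card (?F k))) =
          (\<Sum>k\<in>{..<n - M}. real (card (?F k))) + (\<Sum>k\<in>{n - M..n}. real (card (?F k)))"
        by (subst sum.union_disjoint[symmetric]) (auto intro!: sum.cong)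
      also have "(\<Sum>k\<in>{n - M..n}. real (card (?F k))) \<le> (\<Sum>k\<in>{n - M..n}. real (card (?F n)))"
        using full_ends_mono[OF b] by (intro sum_mono of_nat_mono card_mono finF) auto
      also have "\<dots> = real (M + 1) * real (card (?F n))" using that by simp
      also have "(\<Sum>k\<in>{..<n - M}. real (card (?F k))) \<le> (\<Sum>k\<in>{..<n - M}. (c - a) * b ^ k + 1)"
        using full_ends_card_upper[OF b] ac by (intro sum_mono) auto
      also have "\<dots> = (c - a) * ((b ^ (n - M) - 1) / (b - 1)) + real (n - M)"
        using b by (simp add: sum.distrib sum_distrib_left[symmetric] geometric_sum)
      also have "(c - a) * ((b ^ (n - M) - 1) / (b - 1)) \<le> (c - a) * (b ^ n / 2)"
      proof (intro mult_left_mono)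
        have eq: "b ^ (n - M) = b ^ n * (1 / b) ^ M"
          using b that by (simp add: power_diff power_one_over)
        have "b ^ (n - M) / (b - 1) \<le> b ^ (n - M) * (b / (b - 1))"
          using b by (simp add: divide_simps)
        also have "\<dots> = b ^ n * ((1 / b) ^ M * (b / (b - 1)))" unfolding eq by (rule mult.assoc)
        also have "\<dots> \<le> b ^ n * (1 / 2)" using M b by (intro mult_left_mono) auto
        finally have "b ^ (n - M) / (b - 1) \<le> b ^ n / 2" by simp
        moreover have "(b ^ (n - M) - 1) / (b - 1) \<le> b ^ (n - M) / (b - 1)"
          using b by (intro divide_right_mono) auto
        ultimately show "(b ^ (n - M) - 1) / (b - 1) \<le> b ^ n / 2" by linarith
      qed (use ac in auto)
      finally have "(c - a) * b ^ n \<le> real (n - M) + (c - a) * (b ^ n / 2) +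
        real (M + 1) * real (card (?F n)) + real n + 1" by linarith
      moreover have "real (n - M) \<le> real n" by simp
      moreover have "(c - a) * (b ^ n / 2) = (c - a) * b ^ n / 2" by simp
      ultimately show ?thesis by linarith
    qed
    \<comment> \<open>Keeping the cylinders away from both ends of the interval costs at most 3 of
      them: one starting at \<open>a\<close> and two starting within a cylinder length of
      \<open>c\<close>.\<close>
    have lose: "real (card (?F n)) \<le>
        real (card {l \<in> full_ends b n. a < l \<and> l + 1 / b ^ n < c}) + 3" for n
    proof -
      let ?I = "{l \<in> full_ends b n. a < l \<and> l + 1 / b ^ n < c}"
      define c' where "c' = max a (c - 1 / b ^ n)"
      have bp: "0 < b ^ n" using b by simp
      have c': "a \<le> c'" "c' \<le> c" using ac b by (auto simp: c'_def)
      have sub: "?F n \<subseteq> ?I \<union> ({a} \<union> full_ends b n \<inter> {c'..<c})" by (auto simp: c'_def)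
      have "?I \<subseteq> ?F n"
      proof
        fix l assume l: "l \<in> ?I"
        have "0 < 1 / b ^ n" using bp by simp
        then have "l < c" using l by (simp only: mem_Collect_eq) linarith
        then show "l \<in> ?F n" using l by simp
      qed
      then have fI: "finite ?I" using finF finite_subset by blast
      have fc: "finite (full_ends b n \<inter> {c'..<c})"
        "real (card (full_ends b n \<inter> {c'..<c})) \<le> (c - c') * b ^ n + 1"
        using full_ends_card_upper[OF b c'(2), of n] by auto
      have "(c - c') * b ^ n \<le> (1 / b ^ n) * b ^ n"
        using bp by (intro mult_right_mono) (auto simp: c'_def)
      then have "(c - c') * b ^ n \<le> 1" using b by simp
      then have "real (card (full_ends b n \<inter> {c'..<c})) \<le> 2" using fc by linarith
      moreover have "card (?F n) \<le> card (?I \<union> ({a} \<union> full_ends b n \<inter> {c'..<c}))"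
        using sub fI fc by (intro card_mono) auto
      moreover have "\<dots> \<le> card ?I + card ({a} \<union> full_ends b n \<inter> {c'..<c})" by (rule card_Un_le)
      moreover have "card ({a} \<union> full_ends b n \<inter> {c'..<c}) \<le> 1 + card (full_ends b n \<inter> {c'..<c})"
        using card_Un_le[of "{a}"] by simp
      ultimately show ?thesis by linarith
    qed
    have "eventually (\<lambda>n. real n * 2 + (real (M + 1) * 3 + 2) \<le> ((c - a) / 4) * b ^ n) sequentially"
      using ac by (intro eventually_linear_le_exp b) auto
    then show ?thesis using eventually_ge_at_top[of M]
    proof eventually_elim
      case (elim n)
      let ?I = "{l \<in> full_ends b n. a < l \<and> l + 1 / b ^ n < c}"
      have "real (M + 1) * real (card (?F n)) \<le> real (M + 1) * (real (card ?I) + 3)"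
        using lose by (intro mult_left_mono) auto
      then have "(c - a) * b ^ n / 4 \<le> real (M + 1) * real (card ?I)"
        using main[OF elim(2)] elim(1) by (simp add: algebra_simps)
      then show ?case unfolding e_def by (simp add: divide_simps mult.commute del: of_nat_Suc)
    qed
  qed
  ultimately show ?thesis by blast
qed

section \<open>Dyadic net contents\<close>

abbreviation cube :: "int \<times> (int ^ 'd) \<Rightarrow> (real ^ 'd) set" where
  "cube q \<equiv> dyadic_cube (fst q) (snd q)"

abbreviation side :: "int \<times> (int ^ 'd) \<Rightarrow> real" where
  "side q \<equiv> dyadic_side (fst q)"

definition cube_index :: "int \<Rightarrow> real ^ 'd \<Rightarrow> int ^ 'd" where
  "cube_index m x = (\<chi> i. \<lfloor>x $ i / dyadic_side m\<rfloor>)"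

lemma dyadic_side_pos [simp]: "0 < dyadic_side m"
  by (simp add: dyadic_side_def)

lemma dyadic_side_nonneg [simp]: "0 \<le> dyadic_side m"
  by (simp add: dyadic_side_def)

lemma dyadic_side_nonzero [simp]: "dyadic_side m \<noteq> 0"
  by (simp add: dyadic_side_def)

lemma dyadic_side_add: "dyadic_side m = 2 ^ j * dyadic_side (m + int j)"
proof -
  have "(2::real) powi (int j + - (m + int j)) = 2 powi int j * 2 powi (- (m + int j))"
    by (rule power_int_add) simp
  then show ?thesis by (simp add: dyadic_side_def)
qed

lemma in_dyadic_cube_iff: "x \<in> dyadic_cube m k \<longleftrightarrow> k = cube_index m x"
proof -
  have "(of_int (k $ i) * dyadic_side m \<le> x $ i \<and> x $ i < (of_int (k $ i) + 1) * dyadic_side m) \<longleftrightarrow>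
      k $ i = \<lfloor>x $ i / dyadic_side m\<rfloor>" for i
    by (metis dyadic_side_pos floor_eq_iff pos_divide_less_eq pos_le_divide_eq)
  then show ?thesis by (auto simp: dyadic_cube_def cube_index_def vec_eq_iff)
qed

text \<open>The source of the nesting of dyadic cubes: points with the same index on one level have
  the same index on every coarser level.\<close>

lemma cube_index_coarser:
  "cube_index m x = (\<chi> i. cube_index (m + int j) x $ i div 2 ^ j)"
proof -
  have "\<lfloor>y / dyadic_side m\<rfloor> = \<lfloor>y / dyadic_side (m + int j)\<rfloor> div 2 ^ j" for y :: real
    using floor_divide_real_eq_div[of "2 ^ j" "y / dyadic_side (m + int j)"]
    by (simp add: dyadic_side_add[of m j] mult.commute)
  then show ?thesis by (simp add: cube_index_def vec_eq_iff)
qed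

lemma cube_nested:
  assumes "m' \<le> m" "x \<in> dyadic_cube m k" "x \<in> dyadic_cube m' k'"
  shows "dyadic_cube m k \<subseteq> dyadic_cube m' k'"
proof
  fix y assume y: "y \<in> dyadic_cube m k"
  obtain j where j: "m = m' + int j" using assms(1) zle_iff_zadd by blast
  have "cube_index m x = cube_index m y" using y assms(2) by (simp add: in_dyadic_cube_iff)
  then have "cube_index m' x = cube_index m' y"
    using cube_index_coarser[of m' _ j] j by metis
  then show "y \<in> dyadic_cube m' k'" using assms(3) by (simp add: in_dyadic_cube_iff)
qed

lemma cube_nested':
  assumes "x \<in> cube q" "x \<in> cube r"
  shows "cube q \<subseteq> cube r \<or> cube r \<subseteq> cube q"
  using cube_nested[OF _ assms] cube_nested[OF _ assms(2,1)] by (metis linear)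

lemma in_cube_index: "x \<in> dyadic_cube m (cube_index m x)"
  by (simp add: in_dyadic_cube_iff)

lemma dyadic_cube_nonempty: "dyadic_cube m k \<noteq> {}"
proof -
  have "(\<chi> i. of_int (k $ i) * dyadic_side m) \<in> dyadic_cube m k"
    by (simp add: dyadic_cube_def algebra_simps)
  then show ?thesis by auto
qed

lemma dyadic_cube_subset_cbox:
  "dyadic_cube m k \<subseteq> cbox (\<chi> i. of_int (k $ i) * dyadic_side m) (\<chi> i. (of_int (k $ i) + 1) * dyadic_side m)"
  by (simp add: dyadic_cube_def mem_box_cart subset_iff less_imp_le)

lemma box_subset_dyadic_cube:
  "box (\<chi> i. of_int (k $ i) * dyadic_side m) (\<chi> i. (of_int (k $ i) + 1) * dyadic_side m) \<subseteq> dyadic_cube m k"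
  by (auto simp: dyadic_cube_def mem_box_cart intro: less_imp_le)

lemma interior_dyadic_cube:
  "interior (dyadic_cube m k) =
    {x. \<forall>i. of_int (k $ i) * dyadic_side m < x $ i \<and> x $ i < (of_int (k $ i) + 1) * dyadic_side m}"
proof -
  let ?B = "box (\<chi> i. of_int (k $ i) * dyadic_side m) (\<chi> i. (of_int (k $ i) + 1) * dyadic_side m)"
  have "?B \<subseteq> interior (dyadic_cube m k)"
    by (intro interior_maximal box_subset_dyadic_cube open_box)
  moreover have "interior (dyadic_cube m k) \<subseteq> ?B"
    using interior_mono[OF dyadic_cube_subset_cbox] by (simp only: interior_cbox)
  ultimately have "interior (dyadic_cube m k) = ?B" by (rule antisym[rotated])
  then show ?thesis by (simp only: set_eq_iff mem_box_cart mem_Collect_eq vec_lambda_beta) simp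
qed

lemma closure_dyadic_cube:
  "closure (dyadic_cube m k) \<subseteq> cbox (\<chi> i. of_int (k $ i) * dyadic_side m) (\<chi> i. (of_int (k $ i) + 1) * dyadic_side m)"
  by (intro closure_minimal dyadic_cube_subset_cbox closed_cbox)

lemma compact_closure_dyadic_cube: "compact (closure (dyadic_cube m k))"
  using bounded_subset[OF bounded_cbox dyadic_cube_subset_cbox] by (simp add: compact_closure)

lemma dist_closure_dyadic_cube:
  fixes x y :: "real ^ 'd"
  assumes "x \<in> closure (dyadic_cube m k)" "y \<in> closure (dyadic_cube m k)"
  shows "dist x y \<le> real CARD('d) * dyadic_side m"
proof -
  have "x \<in> cbox (\<chi> i. of_int (k $ i) * dyadic_side m) (\<chi> i. (of_int (k $ i) + 1) * dyadic_side m)"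
    "y \<in> cbox (\<chi> i. of_int (k $ i) * dyadic_side m) (\<chi> i. (of_int (k $ i) + 1) * dyadic_side m)"
    using closure_dyadic_cube assms by blast+
  then have "\<bar>(x - y) $ i\<bar> \<le> dyadic_side m" for i
    by (auto simp: mem_box_cart abs_le_iff algebra_simps) (smt (verit))+
  then have "(\<Sum>i\<in>UNIV. \<bar>(x - y) $ i\<bar>) \<le> (\<Sum>i\<in>(UNIV :: 'd set). dyadic_side m)"
    by (intro sum_mono)
  then show ?thesis using norm_le_l1_cart[of "x - y"] by (simp add: dist_norm)
qed

lemma sets_dyadic_cube [measurable]: "dyadic_cube m k \<in> sets borel"
proof -
  have "dyadic_cube m k = (\<Inter>i. {x. of_int (k $ i) * dyadic_side m \<le> x $ i} \<inter>
      {x. x $ i < (of_int (k $ i) + 1) * dyadic_side m})"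
    by (auto simp: dyadic_cube_def)
  also have "\<dots> \<in> sets borel"
    by (intro sets.countable_INT'' sets.Int borel_closed borel_open
        closed_halfspace_component_ge_cart open_halfspace_component_lt_cart) auto
  finally show ?thesis .
qed

lemma emeasure_cbox_cart:
  fixes a b :: "real ^ 'd"
  assumes "\<And>i. a $ i \<le> b $ i"
  shows "emeasure lborel (cbox a b) = ennreal (\<Prod>i\<in>UNIV. b $ i - a $ i)"
proof -
  have "cbox a b \<noteq> {}" using assms by (simp add: interval_ne_empty_cart)
  then show ?thesis using content_cbox_cart[of a b] emeasure_lborel_cbox_finite[of a b]
    by (subst emeasure_eq_ennreal_measure) auto
qed

lemma emeasure_box_cart:
  fixes a b :: "real ^ 'd"
  assumes "\<And>i. a $ i \<le> b $ i"
  shows "emeasure lborel (box a b) = ennreal (\<Prod>i\<in>UNIV. b $ i - a $ i)"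
  using emeasure_cbox_cart[OF assms] by (simp add: emeasure_lborel_box_eq emeasure_lborel_cbox_eq)

lemma emeasure_dyadic_cube:
  "emeasure lborel (dyadic_cube m (k :: int ^ 'd)) = ennreal (dyadic_side m powr real CARD('d))"
proof -
  let ?a = "\<chi> i. of_int (k $ i) * dyadic_side m" and ?b = "\<chi> i. (of_int (k $ i) + 1) * dyadic_side m"
  have le: "?a $ i \<le> ?b $ i" for i by (simp add: algebra_simps)
  have "?b $ i - ?a $ i = dyadic_side m" for i by (simp add: algebra_simps)
  then have p: "(\<Prod>i\<in>(UNIV :: 'd set). ?b $ i - ?a $ i) = dyadic_side m powr real CARD('d)"
    by (simp add: powr_realpow)
  show ?thesis unfolding p[symmetric]
  proof (rule antisym)
    show "emeasure lborel (dyadic_cube m k) \<le> ennreal (\<Prod>i\<in>UNIV. ?b $ i - ?a $ i)"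
      unfolding emeasure_cbox_cart[OF le, symmetric] by (intro emeasure_mono dyadic_cube_subset_cbox) auto
    show "ennreal (\<Prod>i\<in>UNIV. ?b $ i - ?a $ i) \<le> emeasure lborel (dyadic_cube m k)"
      unfolding emeasure_box_cart[OF le, symmetric] by (intro emeasure_mono box_subset_dyadic_cube) auto
  qed
qed

lemma cube_subset_imp_side_le:
  fixes q r :: "int \<times> (int ^ 'd)"
  assumes "cube q \<subseteq> cube r"
  shows "side q \<le> side r"
proof -
  have "emeasure lborel (cube q) \<le> emeasure lborel (cube r)"
    using assms by (intro emeasure_mono) auto
  then have "side q powr real CARD('d) \<le> side r powr real CARD('d)"
    by (simp add: emeasure_dyadic_cube ennreal_le_iff)
  then show ?thesis by (simp add: powr_realpow power_mono_iff)
qed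

text \<open>As a measure on the index set, the sum in \<open>dyadic_content\<close> obeys
  monotonicity, subadditivity and disjoint additivity for arbitrary families, all of which the
  exchange arguments below use.\<close>

definition net_measure :: "real \<Rightarrow> (int \<times> (int ^ 'd)) measure" where
  "net_measure t = density (count_space UNIV) (\<lambda>q. ennreal (side q powr t))"

abbreviation net_weight :: "real \<Rightarrow> (int \<times> (int ^ 'd)) set \<Rightarrow> ennreal" where
  "net_weight t I \<equiv> emeasure (net_measure t) I"

lemma sets_net_measure [simp]: "I \<in> sets (net_measure t)"
  by (simp add: net_measure_def)

lemma net_weight_eq_nn_integral:
  "net_weight t I = (\<integral>\<^sup>+q. ennreal (side q powr t) \<partial>count_space I)"
  unfolding net_measure_def
  by (subst emeasure_density) (auto simp: nn_integral_count_space_indicator)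

lemma net_weight_finite:
  "finite I \<Longrightarrow> net_weight t I = (\<Sum>q\<in>I. ennreal (side q powr t))"
  by (simp add: net_weight_eq_nn_integral nn_integral_count_space_finite)

lemma net_weight_eq_infsum:
  fixes I :: "(int \<times> (int ^ 'd)) set"
  shows "net_weight t I = (\<Sum>\<^sub>\<infinity>(m, k)\<in>I. ennreal (dyadic_side m powr t))"
proof -
  let ?f = "\<lambda>q :: int \<times> (int ^ 'd). ennreal (side q powr t)"
  have "(\<Sum>\<^sub>\<infinity>(m, k)\<in>I. ennreal (dyadic_side m powr t)) = infsum ?f I"
    by (intro infsum_cong) auto
  also have "\<dots> = (SUP F\<in>{F. finite F \<and> F \<subseteq> I}. sum ?f F)"
    by (intro infsumI nonneg_has_sum_complete) auto
  also have "\<dots> = net_weight t I"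
  proof (rule antisym)
    show "(SUP F\<in>{F. finite F \<and> F \<subseteq> I}. sum ?f F) \<le> net_weight t I"
    proof (rule SUP_least)
      fix F assume "F \<in> {F. finite F \<and> F \<subseteq> I}"
      then have "sum ?f F = net_weight t F" "F \<subseteq> I"
        by (simp_all add: net_weight_finite)
      then show "sum ?f F \<le> net_weight t I" by (simp add: emeasure_mono)
    qed
    \<comment> \<open>An exhaustion of \<open>I\<close> by finite sets, so that continuity from
      below compares the measure with the supremum over finite subfamilies.\<close>
    define J where "J = (\<lambda>n. {q \<in> I. to_nat q \<le> n})"
    have fin: "finite (J n)" for n
      by (rule finite_subset[of _ "from_nat ` {..n}"]) (auto simp: J_def intro!: image_eqI[of _ _ "to_nat _"])
    have "(SUP n. net_weight t (J n)) = net_weight t (\<Union>n. J n)"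
      by (intro SUP_emeasure_incseq) (auto simp: J_def incseq_def)
    moreover have "(\<Union>n. J n) = I" by (auto simp: J_def)
    moreover have "(SUP n. net_weight t (J n)) \<le> (SUP F\<in>{F. finite F \<and> F \<subseteq> I}. sum ?f F)"
      using fin by (intro SUP_mono) (auto simp: net_weight_finite J_def intro!: bexI[of _ "J _"])
    ultimately show "net_weight t I \<le> (SUP F\<in>{F. finite F \<and> F \<subseteq> I}. sum ?f F)" by simp
  qed
  finally show ?thesis by simp
qed

lemma dyadic_content_eq:
  "dyadic_content t A = Inf {net_weight t I | I. A \<subseteq> \<Union> (cube ` I)}"
  unfolding dyadic_content_def net_weight_eq_infsum
  by (intro arg_cong[where f = Inf] Collect_cong ex_cong) (auto simp: case_prod_unfold)

lemma dyadic_content_le: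
  "A \<subseteq> \<Union> (cube ` I) \<Longrightarrow> dyadic_content t A \<le> net_weight t I"
  unfolding dyadic_content_eq by (intro Inf_lower) auto

lemma dyadic_content_geI:
  "(\<And>I. A \<subseteq> \<Union> (cube ` I) \<Longrightarrow> c \<le> net_weight t I) \<Longrightarrow> c \<le> dyadic_content t A"
  unfolding dyadic_content_eq by (intro Inf_greatest) auto

lemma dyadic_content_mono: "A \<subseteq> B \<Longrightarrow> dyadic_content t A \<le> dyadic_content t B"
  by (intro dyadic_content_geI dyadic_content_le) auto

lemma net_weight_singleton: "net_weight t {q} = ennreal (side q powr t)"
  by (simp add: net_weight_finite)

lemma net_weight_ge: "q \<in> I \<Longrightarrow> ennreal (side q powr t) \<le> net_weight t I"
  using emeasure_mono[of "{q}" I "net_measure t"] by (simp add: net_weight_singleton)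

lemma net_measure_disjoint_cubes:
  assumes ne: "\<And>q r x. q \<in> M \<Longrightarrow> r \<in> M \<Longrightarrow> x \<in> cube q \<Longrightarrow> x \<in> cube r \<Longrightarrow> q = r"
  shows "(\<integral>\<^sup>+q. net_weight t {r \<in> I. cube r \<subseteq> cube q} \<partial>count_space M) =
    net_weight t (\<Union>q\<in>M. {r \<in> I. cube r \<subseteq> cube q})"
proof -
  have "disjoint_family_on (\<lambda>q. {r \<in> I. cube r \<subseteq> cube q}) M"
    unfolding disjoint_family_on_def
  proof (intro ballI impI)
    fix q q' assume q: "q \<in> M" "q' \<in> M" "q \<noteq> q'"
    have False if "cube r \<subseteq> cube q" "cube r \<subseteq> cube q'" for r :: "int \<times> (int ^ 'a)"
      using dyadic_cube_nonempty[of "fst r" "snd r"] ne[OF q(1,2)] q(3) that by blast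
    then show "{r \<in> I. cube r \<subseteq> cube q} \<inter> {r \<in> I. cube r \<subseteq> cube q'} = {}" by blast
  qed
  then show ?thesis by (subst emeasure_UN_countable) auto
qed

section \<open>Net content of countable intersections of open sets\<close>

text \<open>The invariant of the descent in \<open>dyadic_content_Inter_open\<close>: a point common
  to good cubes of arbitrarily fine levels escapes every member of \<open>I\<close>.\<close>

definition good_cube :: "real \<Rightarrow> (int \<times> (int ^ 'd)) set \<Rightarrow> int \<times> (int ^ 'd) \<Rightarrow> bool" where
  "good_cube t I q \<longleftrightarrow> net_weight t {r \<in> I. cube r \<subseteq> cube q} < ennreal (side q powr t) \<and>
     (\<forall>r\<in>I. \<not> cube q \<subseteq> cube r)"

lemma ex_small_cube:
  assumes "open U" "x \<in> (U :: (real ^ 'd) set)"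
  shows "\<exists>j. closure (dyadic_cube (m + int j) (cube_index (m + int j) x)) \<subseteq> U"
proof -
  obtain e where e: "e > 0" "ball x e \<subseteq> U" using assms open_contains_ball by blast
  define C where "C = real CARD('d) * dyadic_side m"
  obtain j where j: "C / e < 2 ^ j" using real_arch_pow[of 2 "C / e"] by auto
  have "dist x y < e" if "y \<in> closure (dyadic_cube (m + int j) (cube_index (m + int j) x))" for y
  proof -
    have "dist x y \<le> real CARD('d) * dyadic_side (m + int j)"
      using closure_subset in_cube_index that by (intro dist_closure_dyadic_cube) auto
    also have "\<dots> = C / 2 ^ j" unfolding C_def using dyadic_side_add[of m j] by simp
    also have "\<dots> < e" using j e by (simp add: field_simps)
    finally show ?thesis .
  qed
  then show ?thesis using e by (intro exI[of _ j]) (auto simp: subset_iff)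
qed

text \<open>An exchange argument. Decompose the open set \<open>U\<close> into maximal dyadic cubes.
  If none were good, each one not swallowed by a member of \<open>I\<close> would be outweighed by
  the members of \<open>I\<close> inside it. Replacing those members by that cube would then give a
  cover of \<open>U\<close> no heavier than the part of \<open>I\<close> inside \<open>q\<close>,
  which is lighter than the content of \<open>U\<close>.\<close>

lemma good_cube_refine:
  fixes q :: "int \<times> (int ^ 'd)"
  assumes good: "good_cube t I q" and V: "open V"
    and cont: "ennreal (side q powr t) \<le> dyadic_content t (V \<inter> interior (cube q))"
  shows "\<exists>p. good_cube t I p \<and> closure (cube p) \<subseteq> V \<inter> cube q \<and> fst q < fst p"
proof (rule ccontr)
  assume bad: "\<not> ?thesis"
  define U where "U = V \<inter> interior (cube q)"
  have U: "open U" "U \<subseteq> V" "U \<subseteq> cube q" using V interior_subset by (auto simp: U_def)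
  \<comment> \<open>The coarsest level finer than that of \<open>q\<close> at which the cube around
    \<open>x\<close> has its closure in \<open>U\<close>: a decomposition of Whitney type.\<close>
  define lev where "lev x = fst q + 1 + int (LEAST j. closure (dyadic_cube (fst q + 1 + int j)
      (cube_index (fst q + 1 + int j) x)) \<subseteq> U)" for x
  define Q where "Q x = (lev x, cube_index (lev x) x)" for x
  have Q: "closure (cube (Q x)) \<subseteq> U" "fst q < fst (Q x)" if "x \<in> U" for x
    using LeastI_ex[OF ex_small_cube[OF U(1) that, of "fst q + 1"]] by (auto simp: Q_def lev_def)
  have xQ: "x \<in> cube (Q x)" for x by (simp add: Q_def in_cube_index)
  \<comment> \<open>If two maximal cubes meet, the coarser one contains the base point of the other
    and is admissible for it; minimality of the level makes them equal.\<close>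
  have Qeq: "Q x = Q y" if "x \<in> U" "y \<in> U" "fst (Q x) \<le> fst (Q y)" "z \<in> cube (Q x)" "z \<in> cube (Q y)" for x y z
  proof -
    have "y \<in> cube (Q x)" using cube_nested[OF that(3) that(5,4)] xQ by blast
    then have s: "snd (Q x) = cube_index (fst (Q x)) y" by (simp add: in_dyadic_cube_iff)
    obtain j where j: "fst (Q x) = fst q + 1 + int j" by (auto simp: Q_def lev_def)
    have "closure (dyadic_cube (fst q + 1 + int j) (cube_index (fst q + 1 + int j) y)) \<subseteq> U"
      using Q(1)[OF that(1)] s j by simp
    then have "fst (Q y) \<le> fst (Q x)" unfolding j by (simp add: Q_def lev_def Least_le)
    then have "fst (Q x) = fst (Q y)" using that(3) by simp
    then show ?thesis using s by (simp add: Q_def prod_eq_iff)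
  qed
  \<comment> \<open>\<open>M\<close> holds the maximal cubes that no member of \<open>I\<close>
    swallows, \<open>J\<close> the members of \<open>I\<close> inside \<open>q\<close> that lie in
    no cube of \<open>M\<close>. The exchanged cover is \<open>J \<union> M\<close>.\<close>
  define M where "M = {p \<in> Q ` U. \<forall>r\<in>I. \<not> cube p \<subseteq> cube r}"
  define J where "J = {r \<in> I. cube r \<subseteq> cube q \<and> (\<forall>p\<in>M. \<not> cube r \<subseteq> cube p)}"
  have disj: "p = p'" if "p \<in> M" "p' \<in> M" "z \<in> cube p" "z \<in> cube p'" for p p' z
    using that Qeq by (auto simp: M_def) (metis linear)
  have cover: "U \<subseteq> \<Union> (cube ` (J \<union> M))"
  proof
    fix x assume x: "x \<in> U"
    show "x \<in> \<Union> (cube ` (J \<union> M))"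
    proof (cases "Q x \<in> M")
      case True
      then show ?thesis using xQ by blast
    next
      case False
      then obtain r where r: "r \<in> I" "cube (Q x) \<subseteq> cube r" using x by (auto simp: M_def)
      then have "x \<in> cube r" "x \<in> cube q" using xQ x U by auto
      moreover have "\<not> cube q \<subseteq> cube r" using good r by (auto simp: good_cube_def)
      ultimately have "cube r \<subseteq> cube q" using cube_nested' by blast
      then have "r \<in> J \<or> (\<exists>p\<in>M. cube r \<subseteq> cube p)" using r by (simp add: J_def) blast
      then show ?thesis using \<open>x \<in> cube r\<close> by blast
    qed
  qed
  have "(\<integral>\<^sup>+p. ennreal (side p powr t) \<partial>count_space M) \<le>
      (\<integral>\<^sup>+p. net_weight t {r \<in> I. cube r \<subseteq> cube p} \<partial>count_space M)"
  proof (intro nn_integral_mono)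
    fix p assume "p \<in> space (count_space M)"
    then have p: "p \<in> M" by simp
    then obtain x where "x \<in> U" "p = Q x" by (auto simp: M_def)
    then have "closure (cube p) \<subseteq> V \<inter> cube q" "fst q < fst p" using Q[of x] U(2,3) by auto
    then have "\<not> good_cube t I p" using bad by blast
    then show "ennreal (side p powr t) \<le> net_weight t {r \<in> I. cube r \<subseteq> cube p}"
      using p by (auto simp: good_cube_def M_def not_less)
  qed
  also have "\<dots> = net_weight t (\<Union>p\<in>M. {r \<in> I. cube r \<subseteq> cube p})"
    using disj by (rule net_measure_disjoint_cubes)
  finally have M: "net_weight t M \<le> net_weight t (\<Union>p\<in>M. {r \<in> I. cube r \<subseteq> cube p})"
    by (simp add: net_weight_eq_nn_integral)
  have "ennreal (side q powr t) \<le> net_weight t (J \<union> M)"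
    using cont dyadic_content_le[OF cover] by (auto simp: U_def intro: order.trans)
  also have "\<dots> \<le> net_weight t J + net_weight t M"
    by (intro emeasure_subadditive) auto
  also have "\<dots> \<le> net_weight t J + net_weight t (\<Union>p\<in>M. {r \<in> I. cube r \<subseteq> cube p})"
    using M by (intro add_left_mono)
  also have "\<dots> = net_weight t (J \<union> (\<Union>p\<in>M. {r \<in> I. cube r \<subseteq> cube p}))"
    by (intro plus_emeasure) (auto simp: J_def)
  also have "\<dots> \<le> net_weight t {r \<in> I. cube r \<subseteq> cube q}"
  proof (intro emeasure_mono)
    have "cube p \<subseteq> cube q" if "p \<in> M" for p
      using that Q(1) U(3) closure_subset by (fastforce simp: M_def)
    then show "J \<union> (\<Union>p\<in>M. {r \<in> I. cube r \<subseteq> cube p}) \<subseteq> {r \<in> I. cube r \<subseteq> cube q}"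
      by (auto simp: J_def)
  qed simp
  also have "\<dots> < ennreal (side q powr t)" using good by (simp add: good_cube_def)
  finally show False by simp
qed

text \<open>A cover lighter than \<open>q\<close> makes \<open>q\<close> good. Refining once for
  each \<open>V n\<close> yields nested compact closures, hence a point in all \<open>V n\<close>
  and so in some member \<open>r\<close> of the cover. Levels increase, so some good cube lies
  inside \<open>r\<close>, a contradiction. The hypothesis speaks of interiors because the
  refinement decomposes an open set.\<close>

lemma dyadic_content_Inter_open:
  fixes V :: "nat \<Rightarrow> (real ^ 'd) set"
  assumes V: "\<And>k. open (V k)"
    and cont: "\<And>k p. cube p \<subseteq> cube q \<Longrightarrow> ennreal (side p powr t) \<le> dyadic_content t (V k \<inter> interior (cube p))"
    and t: "0 < t"
  shows "ennreal (side q powr t) \<le> dyadic_content t ((\<Inter>k. V k) \<inter> cube q)"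
proof (rule ccontr)
  assume "\<not> ?thesis"
  then obtain I where I: "(\<Inter>k. V k) \<inter> cube q \<subseteq> \<Union> (cube ` I)"
    "net_weight t I < ennreal (side q powr t)"
    unfolding not_le dyadic_content_eq Inf_less_iff by auto
  have good: "good_cube t I q"
    unfolding good_cube_def
  proof (intro conjI ballI notI)
    have "net_weight t {r \<in> I. cube r \<subseteq> cube q} \<le> net_weight t I"
      by (intro emeasure_mono) auto
    then show "net_weight t {r \<in> I. cube r \<subseteq> cube q} < ennreal (side q powr t)"
      using I(2) by simp
    fix r assume r: "r \<in> I" "cube q \<subseteq> cube r"
    then have "side q powr t \<le> side r powr t"
      using cube_subset_imp_side_le t by (intro powr_mono2) auto
    then have "ennreal (side q powr t) \<le> ennreal (side r powr t)" by (rule ennreal_leI)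
    also have "\<dots> \<le> net_weight t I" by (rule net_weight_ge[OF r(1)])
    finally show False using I(2) by simp
  qed
  have "\<exists>Q. \<forall>n. (good_cube t I (Q n) \<and> cube (Q n) \<subseteq> cube q) \<and>
      (closure (cube (Q (Suc n))) \<subseteq> V n \<inter> cube (Q n) \<and> fst (Q n) < fst (Q (Suc n)))"
  proof (rule dependent_nat_choice)
    show "\<exists>p. good_cube t I p \<and> cube p \<subseteq> cube q" using good by blast
    fix p n assume p: "good_cube t I p \<and> cube p \<subseteq> cube q"
    then obtain r where r: "good_cube t I r" "closure (cube r) \<subseteq> V n \<inter> cube p" "fst p < fst r"
      using good_cube_refine[OF _ V cont] by blast
    moreover have "cube r \<subseteq> cube q" using r(2) p closure_subset by blast
    ultimately show "\<exists>r. (good_cube t I r \<and> cube r \<subseteq> cube q) \<and>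
        (closure (cube r) \<subseteq> V n \<inter> cube p \<and> fst p < fst r)" by blast
  qed
  then obtain Q where Q: "\<And>n. good_cube t I (Q n)" "\<And>n. cube (Q n) \<subseteq> cube q"
    "\<And>n. closure (cube (Q (Suc n))) \<subseteq> V n \<inter> cube (Q n)" "\<And>n. fst (Q n) < fst (Q (Suc n))"
    by metis
  have "closure (cube (Q (Suc n))) \<subseteq> closure (cube (Q n))" for n
    using Q(3)[of n] closure_subset by blast
  then have dec: "closure (cube (Q n)) \<subseteq> closure (cube (Q m))" if "m \<le> n" for m n
    using lift_Suc_antimono_le[of "\<lambda>n. closure (cube (Q n))"] that by blast
  have "\<Inter> (range (\<lambda>n. closure (cube (Q n)))) \<noteq> {}"
  proof (rule compact_nest)
    show "closure (cube (Q n)) \<noteq> {}" for n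
      using dyadic_cube_nonempty[of "fst (Q n)" "snd (Q n)"] by simp
  qed (use compact_closure_dyadic_cube dec in auto)
  then obtain x where x: "\<And>n. x \<in> closure (cube (Q n))" by blast
  then have xV: "x \<in> V n" "x \<in> cube (Q n)" for n using Q(3)[of n] by blast+
  then obtain r where r: "r \<in> I" "x \<in> cube r" using I(1) Q(2) by blast
  \<comment> \<open>The levels grow without bound, so from some step on the cubes are finer than
    \<open>r\<close>.\<close>
  have "fst (Q 0) + int n \<le> fst (Q n)" for n
  proof (induction n)
    case (Suc n)
    then show ?case using Q(4)[of n] by simp
  qed simp
  from this[of "nat (fst r - fst (Q 0))"] obtain n where "fst r \<le> fst (Q n)" by (smt (verit) nat_0_le)
  then have "cube (Q n) \<subseteq> cube r" using cube_nested xV(2) r(2) by blast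
  then show False using Q(1)[of n] r(1) by (auto simp: good_cube_def)
qed

section \<open>Net content compared with Lebesgue measure\<close>

lemma emeasure_le_nn_integral_cover:
  assumes cover: "A \<subseteq> \<Union> (B ` J)" and J: "countable J" and A [measurable]: "A \<in> sets M"
    and B [measurable]: "\<And>i. i \<in> J \<Longrightarrow> B i \<in> sets M"
  shows "emeasure M A \<le> (\<integral>\<^sup>+i. emeasure M (A \<inter> B i) \<partial>count_space J)"
proof -
  have "indicator A x \<le> (\<integral>\<^sup>+i. indicator (A \<inter> B i) x \<partial>count_space J :: ennreal)" for x
  proof (cases "x \<in> A")
    case True
    then obtain i where i: "i \<in> J" "x \<in> B i" using cover by blast
    then have "indicator (A \<inter> B i) x \<le> (\<integral>\<^sup>+i. indicator (A \<inter> B i) x \<partial>count_space J :: ennreal)"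
      by (intro nn_integral_ge_point)
    then show ?thesis using True i by simp
  qed simp
  then have "(\<integral>\<^sup>+x. indicator A x \<partial>M) \<le> (\<integral>\<^sup>+x. (\<integral>\<^sup>+i. indicator (A \<inter> B i) x \<partial>count_space J) \<partial>M)"
    by (intro nn_integral_mono)
  also have "\<dots> = (\<integral>\<^sup>+i. (\<integral>\<^sup>+x. indicator (A \<inter> B i) x \<partial>M) \<partial>count_space J)"
    using J by (intro nn_integral_count_space_nn_integral) auto
  also have "\<dots> = (\<integral>\<^sup>+i. emeasure M (A \<inter> B i) \<partial>count_space J)"
    by (intro nn_integral_cong) auto
  finally show ?thesis by simp
qed

lemma emeasure_cover_le_net_measure:
  assumes "cube q \<subseteq> \<Union> (cube ` (J :: (int \<times> (int ^ 'd)) set))"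
  shows "ennreal (side q powr real CARD('d)) \<le> net_weight (real CARD('d)) J"
proof -
  have "emeasure lborel (cube q) \<le> (\<integral>\<^sup>+r. emeasure lborel (cube q \<inter> cube r) \<partial>count_space J)"
    using assms by (intro emeasure_le_nn_integral_cover) auto
  also have "\<dots> \<le> (\<integral>\<^sup>+r. emeasure lborel (cube r) \<partial>count_space J)"
    by (intro nn_integral_mono emeasure_mono) auto
  finally show ?thesis by (simp add: emeasure_dyadic_cube net_weight_eq_nn_integral)
qed

text \<open>A proportion \<open>c\<close> on all cubes of a sufficiently fine level \<open>m\<close>
  gives proportion 1 on \<open>q\<close>. Given a cover of the set, replace all its members below
  level \<open>m\<close> by cubes of level \<open>m\<close>, so as to cover \<open>q\<close> itself,
  and compare volumes. In passing from exponent \<open>d\<close> to \<open>t\<close>, a cube of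
  level \<open>m\<close> gains \<open>dyadic_side m powr (d - t)\<close> where
  \<open>side q powr (d - t)\<close> is allowed, and this quotient makes up for
  \<open>c\<close>.\<close>

lemma dyadic_content_of_small_cubes:
  fixes q :: "int \<times> (int ^ 'd)"
  assumes t: "0 < t" "t \<le> real CARD('d)" and c: "0 \<le> c"
    and m: "fst q \<le> m" "dyadic_side m powr (real CARD('d) - t) \<le> c * side q powr (real CARD('d) - t)"
    and small: "\<And>k. dyadic_cube m k \<subseteq> cube q \<Longrightarrow>
      ennreal (c * dyadic_side m powr t) \<le> dyadic_content t (A \<inter> dyadic_cube m k)"
  shows "ennreal (side q powr t) \<le> dyadic_content t (A \<inter> cube q)"
proof (rule dyadic_content_geI)
  fix I assume I: "A \<inter> cube q \<subseteq> \<Union> (cube ` I)"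
  let ?d = "real CARD('d)"
  show "ennreal (side q powr t) \<le> net_weight t I"
  proof (cases "\<exists>r\<in>I. cube q \<subseteq> cube r")
    case True
    then obtain r where r: "r \<in> I" "cube q \<subseteq> cube r" by blast
    then have "side q powr t \<le> side r powr t"
      using cube_subset_imp_side_le t by (intro powr_mono2) auto
    then have "ennreal (side q powr t) \<le> ennreal (side r powr t)" by (rule ennreal_leI)
    also have "\<dots> \<le> net_weight t I" by (rule net_weight_ge[OF r(1)])
    finally show ?thesis .
  next
    case False
    \<comment> \<open>\<open>M\<close> holds the cubes of level \<open>m\<close> not yet covered by
      one member of \<open>I\<close>, \<open>J\<close> the members that are at least as large as
      such a cube.\<close>
    define M where "M = {p. fst p = m \<and> cube p \<subseteq> cube q \<and> \<not> (\<exists>r\<in>I. cube p \<subseteq> cube r)}"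
    define J where "J = {r \<in> I. cube r \<subseteq> cube q \<and> (\<exists>k. dyadic_cube m k \<subseteq> cube r)}"
    let ?K = "\<Union>p\<in>M. {r \<in> I. cube r \<subseteq> cube p}"
    have Meq: "p = p'" if "fst p = m" "fst p' = m" "x \<in> cube p" "x \<in> cube p'" for p p' and x :: "real ^ 'd"
      using that by (metis in_dyadic_cube_iff prod_eq_iff)
    have cover: "cube q \<subseteq> \<Union> (cube ` (J \<union> M))"
    proof
      fix x assume x: "x \<in> cube q"
      define p where "p = (m, cube_index m x)"
      have xp: "x \<in> cube p" by (simp add: p_def in_cube_index)
      have pq: "cube p \<subseteq> cube q" using cube_nested m(1) x xp by (metis fst_conv p_def snd_conv)
      show "x \<in> \<Union> (cube ` (J \<union> M))"
      proof (cases "p \<in> M")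
        case True
        then show ?thesis using xp by blast
      next
        case nM: False
        then obtain r where r: "r \<in> I" "cube p \<subseteq> cube r" using pq by (auto simp: M_def p_def)
        then have "cube r \<subseteq> cube q" using cube_nested'[of x q r] False x xp by blast
        then have "r \<in> J" using r by (auto simp: J_def p_def)
        then show ?thesis using r xp by blast
      qed
    qed
    let ?s = "side q powr (?d - t)"
    have "ennreal (side q powr ?d) \<le> net_weight ?d (J \<union> M)"
      by (rule emeasure_cover_le_net_measure[OF cover])
    also have "\<dots> \<le> net_weight ?d J + net_weight ?d M"
      by (intro emeasure_subadditive) auto
    also have "net_weight ?d J \<le> ennreal ?s * net_weight t J"
      unfolding net_weight_eq_nn_integral
    proof (subst nn_integral_cmult[symmetric], simp, intro nn_integral_mono)
      fix r assume "r \<in> space (count_space J)"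
      then have "side r \<le> side q" by (intro cube_subset_imp_side_le) (auto simp: J_def)
      then have "side r powr (?d - t) * side r powr t \<le> ?s * side r powr t"
        using t by (intro mult_right_mono powr_mono2) auto
      then show "ennreal (side r powr ?d) \<le> ennreal ?s * ennreal (side r powr t)"
        by (simp add: ennreal_mult[symmetric] powr_add[symmetric] ennreal_leI)
    qed
    also have "net_weight ?d M \<le> ennreal ?s * net_weight t ?K"
    proof -
      have "net_weight ?d M \<le>
          (\<integral>\<^sup>+p. ennreal ?s * net_weight t {r \<in> I. cube r \<subseteq> cube p} \<partial>count_space M)"
        unfolding net_weight_eq_nn_integral[of ?d]
      proof (intro nn_integral_mono)
        fix p assume "p \<in> space (count_space M)"
        then have p: "fst p = m" "cube p \<subseteq> cube q" "\<not> (\<exists>r\<in>I. cube p \<subseteq> cube r)" by (auto simp: M_def)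
        have "A \<inter> cube p \<subseteq> \<Union> (cube ` {r \<in> I. cube r \<subseteq> cube p})"
        proof
          fix x assume x: "x \<in> A \<inter> cube p"
          then obtain r where r: "r \<in> I" "x \<in> cube r" using I p by blast
          then have "cube r \<subseteq> cube p" using cube_nested'[of x p r] x p by blast
          then show "x \<in> \<Union> (cube ` {r \<in> I. cube r \<subseteq> cube p})" using r by blast
        qed
        then have "ennreal (c * dyadic_side m powr t) \<le> net_weight t {r \<in> I. cube r \<subseteq> cube p}"
          using small[of "snd p"] p dyadic_content_le order.trans by blast
        then have "ennreal ?s * ennreal (c * dyadic_side m powr t) \<le>
            ennreal ?s * net_weight t {r \<in> I. cube r \<subseteq> cube p}"
          by (intro mult_left_mono) auto
        moreover have "ennreal (side p powr ?d) \<le> ennreal ?s * ennreal (c * dyadic_side m powr t)"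
        proof -
          have "dyadic_side m powr (?d - t) * dyadic_side m powr t \<le> (c * ?s) * dyadic_side m powr t"
            using m by (intro mult_right_mono) auto
          then have "dyadic_side m powr ?d \<le> ?s * (c * dyadic_side m powr t)"
            by (simp add: powr_add[symmetric] mult.commute mult.left_commute)
          then show ?thesis using p c by (simp add: ennreal_mult[symmetric] ennreal_leI)
        qed
        ultimately show "ennreal (side p powr ?d) \<le>
            ennreal ?s * net_weight t {r \<in> I. cube r \<subseteq> cube p}" by (rule order.trans[rotated])
      qed
      also have "\<dots> = ennreal ?s * net_weight t ?K"
        by (subst nn_integral_cmult, simp, subst net_measure_disjoint_cubes)
          (use Meq in \<open>auto simp: M_def\<close>)
      finally show ?thesis .
    qed
    also have "ennreal ?s * net_weight t J + ennreal ?s * net_weight t ?K =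
        ennreal ?s * net_weight t (J \<union> ?K)"
    proof -
      \<comment> \<open>A member counted twice would contain a cube of level \<open>m\<close> and
        lie in a cube of \<open>M\<close> of the same level; the two would coincide, making the
        latter covered by \<open>I\<close>.\<close>
      have "J \<inter> ?K = {}"
      proof (rule ccontr)
        assume "J \<inter> ?K \<noteq> {}"
        then obtain r p k where rp: "r \<in> I" "dyadic_cube m k \<subseteq> cube r" "p \<in> M" "cube r \<subseteq> cube p"
          by (auto simp: J_def)
        obtain x where "x \<in> dyadic_cube m k" using dyadic_cube_nonempty by blast
        then have "p = (m, k)" using Meq[of p "(m, k)" x] rp by (auto simp: M_def)
        then show False using rp by (auto simp: M_def)
      qed
      then show ?thesis by (subst distrib_left[symmetric], subst plus_emeasure) auto
    qed
    also have "\<dots> \<le> ennreal ?s * net_weight t I"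
      by (intro mult_left_mono emeasure_mono) (auto simp: J_def)
    finally have "ennreal (side q powr (t - ?d)) * ennreal (side q powr ?d) \<le>
        ennreal (side q powr (t - ?d)) * (ennreal ?s * net_weight t I)"
      by (intro mult_left_mono) auto
    moreover have "ennreal (side q powr (t - ?d)) * ennreal (side q powr ?d) = ennreal (side q powr t)"
      by (simp add: ennreal_mult[symmetric] powr_add[symmetric])
    moreover have "ennreal (side q powr (t - ?d)) * (ennreal ?s * net_weight t I) =
        net_weight t I"
      by (simp add: mult.assoc[symmetric] ennreal_mult[symmetric] powr_add[symmetric])
    ultimately show ?thesis by simp
  qed
qed

section \<open>The scale profile\<close>

text \<open>Up to constants, \<open>scale_profile\<close> is the largest normalised Lebesgue measure that a cube of
  side \<open>r\<close> can receive from the union of the pieces of order \<open>n\<close>.\<close>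

definition scale_profile :: "('a \<Rightarrow> real) \<Rightarrow> 'a set \<Rightarrow> ('b \<Rightarrow> real) \<Rightarrow> 'b set \<Rightarrow> real \<Rightarrow> real" where
  "scale_profile b A g B r = (\<Prod>i\<in>A. max r (b i)) * (\<Prod>k\<in>B. min 1 (r / g k))"

lemma prod_if_power: "finite A \<Longrightarrow> (\<Prod>i\<in>A. if P i then (c::real) else 1) = c ^ card {i \<in> A. P i}"
  by (simp add: prod.If_cases Int_def)

text \<open>With no scale separating \<open>r\<close> from \<open>y\<close>, every factor is either
  constant or proportional to the variable. The number of factors of the second kind is the local
  exponent.\<close>

lemma scale_profile_between:
  assumes fin: "finite A" "finite B" and g: "\<And>k. k \<in> B \<Longrightarrow> 0 < g k" and r: "0 < r" and y: "0 < y"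
    and sep: "\<And>s. s \<in> b ` A \<union> g ` B \<Longrightarrow> s \<le> r \<and> s \<le> y \<or> r < s \<and> y \<le> s"
  shows "scale_profile b A g B r = scale_profile b A g B y *
    (r / y) ^ (card {i \<in> A. b i \<le> r} + card {k \<in> B. r < g k})"
proof -
  have "(\<Prod>i\<in>A. max r (b i)) = (\<Prod>i\<in>A. max y (b i) * (if b i \<le> r then r / y else 1))"
    using sep y by (intro prod.cong refl) (force simp: max_def)
  moreover have "(\<Prod>k\<in>B. min 1 (r / g k)) = (\<Prod>k\<in>B. min 1 (y / g k) * (if r < g k then r / y else 1))"
  proof (intro prod.cong refl)
    fix k assume k: "k \<in> B"
    then have "g k \<le> r \<and> g k \<le> y \<or> r < g k \<and> y \<le> g k" using sep by blast
    then show "min 1 (r / g k) = min 1 (y / g k) * (if r < g k then r / y else 1)"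
      using g[OF k] y by (auto simp: min_def field_simps)
  qed
  ultimately show ?thesis
    using fin by (simp add: scale_profile_def prod.distrib prod_if_power power_add)
qed

lemma scale_profile_nonneg:
  assumes "\<And>k. k \<in> B \<Longrightarrow> 0 < g k" "0 < r"
  shows "0 \<le> scale_profile b A g B r"
proof -
  have "0 \<le> min 1 (r / g k)" if "k \<in> B" for k using assms that by (simp add: less_imp_le)
  then show ?thesis unfolding scale_profile_def using assms(2)
    by (intro mult_nonneg_nonneg prod_nonneg) auto
qed

text \<open>In logarithmic coordinates the profile is piecewise affine with nodes in the set of scales.\<close>

lemma scale_profile_le_powr:
  assumes fin: "finite A" "finite B" and pos: "\<And>s. s \<in> b ` A \<union> g ` B \<Longrightarrow> 0 < s"
    and t: "t \<le> real (card B)"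
    and nodes: "\<And>s. s \<in> b ` A \<union> g ` B \<Longrightarrow> scale_profile b A g B s \<le> s powr t"
    and r: "0 < r" "r \<le> s0" "s0 \<in> b ` A \<union> g ` B"
  shows "scale_profile b A g B r \<le> r powr t"
proof -
  define S where "S = b ` A \<union> g ` B"
  define p where "p = card {i \<in> A. b i \<le> r} + card {k \<in> B. r < g k}"
  have finS: "finite S" using fin by (simp add: S_def)
  have gp: "0 < g k" if "k \<in> B" for k using pos that by blast
  have *: "scale_profile b A g B r \<le> r powr t"
    if y: "y \<in> S" and sep: "\<And>s. s \<in> S \<Longrightarrow> s \<le> r \<and> s \<le> y \<or> r < s \<and> y \<le> s"
      and le: "(r / y) powr real p \<le> (r / y) powr t" for y
  proof -
    have yp: "0 < y" using y pos by (simp add: S_def)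
    have "scale_profile b A g B r = scale_profile b A g B y * (r / y) ^ p"
      unfolding p_def using sep by (intro scale_profile_between fin gp r(1) yp) (auto simp: S_def)
    also have "\<dots> \<le> y powr t * (r / y) powr t"
    proof (intro mult_mono)
      show "scale_profile b A g B y \<le> y powr t" using nodes y by (simp add: S_def)
      show "(r / y) ^ p \<le> (r / y) powr t" using le r(1) yp by (simp add: powr_realpow)
    qed (use r(1) yp in auto)
    also have "\<dots> = r powr t" using yp r(1) by (simp add: powr_mult[symmetric])
    finally show ?thesis .
  qed
  show ?thesis
  proof (cases "t \<le> real p")
    case True
    \<comment> \<open>The local exponent is at least \<open>t\<close>: compare with the next scale
      above \<open>r\<close>, where \<open>r / y \<le> 1\<close>. In the other case the next scale
      below does the same with \<open>r / y \<ge> 1\<close>.\<close>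
    define y where "y = Min {s \<in> S. r \<le> s}"
    have ne: "{s \<in> S. r \<le> s} \<noteq> {}" using r by (auto simp: S_def)
    have y: "y \<in> S" "r \<le> y" using Min_in[OF _ ne] finS by (auto simp: y_def)
    have ymin: "y \<le> s" if "s \<in> S" "r \<le> s" for s using finS that by (simp add: y_def)
    show ?thesis
    proof (rule *[OF y(1)])
      show "s \<le> r \<and> s \<le> y \<or> r < s \<and> y \<le> s" if "s \<in> S" for s
        using ymin[OF that] y(2) by (cases "s \<le> r") auto
      show "(r / y) powr real p \<le> (r / y) powr t"
        using True y(2) r(1) by (intro powr_mono') auto
    qed
  next
    case False
    define y where "y = Max {s \<in> S. s \<le> r}"
    \<comment> \<open>Below all scales the local exponent is at least \<open>card B \<ge> t\<close>,
      so that region belongs to the first case.\<close>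
    have ne: "{s \<in> S. s \<le> r} \<noteq> {}"
    proof
      assume e: "{s \<in> S. s \<le> r} = {}"
      then have "{k \<in> B. r < g k} = B" by (force simp: S_def)
      then have "card B \<le> p" by (simp add: p_def)
      then show False using t False by simp
    qed
    have y: "y \<in> S" "y \<le> r" using Max_in[OF _ ne] finS by (auto simp: y_def)
    have ymax: "s \<le> y" if "s \<in> S" "s \<le> r" for s using finS that by (simp add: y_def)
    have yp: "0 < y" using y pos by (simp add: S_def)
    show ?thesis
    proof (rule *[OF y(1)])
      show "s \<le> r \<and> s \<le> y \<or> r < s \<and> y \<le> s" if "s \<in> S" for s
        using ymax[OF that] y(2) by (cases "s \<le> r") auto
      show "(r / y) powr real p \<le> (r / y) powr t"
        using False y(2) yp by (intro powr_mono) auto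
    qed
  qed
qed

text \<open>\<open>R\<close> will be the side of the cube that carries the mass. Up to the largest
  scale, the factor \<open>R powr (card B - t)\<close> is paid by the gap between \<open>t'\<close>
  and \<open>t\<close>, all scales being at most \<open>e\<close>; beyond it the profile is just
  \<open>r ^ card A\<close>.\<close>

lemma scale_profile_le:
  assumes fin: "finite A" "finite B" and pos: "\<And>s. s \<in> b ` A \<union> g ` B \<Longrightarrow> 0 < s"
    and t: "t < t'" "t' \<le> real (card B)" "card A = card B"
    and nodes: "\<And>s. s \<in> b ` A \<union> g ` B \<Longrightarrow> scale_profile b A g B s \<le> s powr t'"
    and small: "\<And>s. s \<in> b ` A \<union> g ` B \<Longrightarrow> s \<le> e" "e powr (t' - t) \<le> R powr (real (card B) - t)"
    and r: "0 < r" "r \<le> R"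
  shows "scale_profile b A g B r \<le> r powr t * R powr (real (card B) - t)"
proof (cases "\<exists>s\<in>b ` A \<union> g ` B. r \<le> s")
  case True
  then obtain s where s: "s \<in> b ` A \<union> g ` B" "r \<le> s" by blast
  have "scale_profile b A g B r \<le> r powr t'"
    by (rule scale_profile_le_powr[OF fin pos t(2) nodes r(1) s(2,1)])
  also have "\<dots> = r powr t * r powr (t' - t)" by (simp add: powr_add[symmetric])
  also have "\<dots> \<le> r powr t * e powr (t' - t)"
    using r s small(1)[OF s(1)] t by (intro mult_left_mono powr_mono2) auto
  also have "\<dots> \<le> r powr t * R powr (real (card B) - t)"
    using small by (intro mult_left_mono) auto
  finally show ?thesis .
next
  case False
  then have "b i \<le> r" if "i \<in> A" for i using that by (metis UnI1 image_eqI linear)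
  moreover have "min 1 (r / g k) = 1" if "k \<in> B" for k
  proof -
    have "g k \<in> b ` A \<union> g ` B" using that by blast
    then have "\<not> r \<le> g k" "0 < g k" using False pos by blast+
    then show ?thesis by (simp add: min_def le_divide_eq)
  qed
  ultimately have "scale_profile b A g B r = r ^ card A"
    by (simp add: scale_profile_def max_absorb1)
  also have "\<dots> = r powr t * r powr (real (card B) - t)"
    using r t by (simp add: powr_add[symmetric] powr_realpow)
  also have "\<dots> \<le> r powr t * R powr (real (card B) - t)"
    using r t by (intro mult_left_mono powr_mono2) auto
  finally show ?thesis .
qed

section \<open>The profile and the numbers s_n\<close>

abbreviation profile :: "real ^ 'd \<Rightarrow> nat \<Rightarrow> (nat \<Rightarrow> real ^ 'd) \<Rightarrow> real \<Rightarrow> real" where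
  "profile \<beta> n \<gamma> \<equiv> scale_profile (\<lambda>i. inverse (\<beta> $ i) ^ n) UNIV (\<lambda>k. norm (\<gamma> k)) {1..CARD('d)}"

text \<open>The origin of the sum defining s_n: it is the logarithm of the profile to base \<tau>.
  The indices missing from \<open>K2\<close> belong to factors equal to 1.\<close>

lemma profile_eq_powr_scale_value:
  fixes \<beta> :: "real ^ 'd"
  assumes \<beta>: "\<And>i. 1 < \<beta> $ i" and \<gamma>: "\<And>k. k \<in> {1..CARD('d)} \<Longrightarrow> 0 < norm (\<gamma> k)"
    and \<tau>: "0 < \<tau>" "\<tau> < 1"
  shows "profile \<beta> n \<gamma> \<tau> = \<tau> powr scale_value \<beta> n \<gamma> \<tau>"
proof -
  have ln: "\<tau> powr (ln c / ln \<tau>) = c" if "0 < c" for c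
    using \<tau> that by (simp add: powr_def)
  have bp: "0 < \<beta> $ i" for i using \<beta>[of i] by simp
  have 1: "\<tau> powr (\<Sum>i\<in>K1 \<beta> n \<tau>. 1) = (\<Prod>i\<in>K1 \<beta> n \<tau>. max \<tau> (inverse (\<beta> $ i) ^ n))"
  proof -
    have "\<tau> powr (\<Sum>i\<in>K1 \<beta> n \<tau>. 1) = (\<Prod>i\<in>K1 \<beta> n \<tau>. \<tau> powr 1)"
      using \<tau> by (intro powr_sum) auto
    also have "\<dots> = (\<Prod>i\<in>K1 \<beta> n \<tau>. max \<tau> (inverse (\<beta> $ i) ^ n))"
      using \<tau> by (intro prod.cong refl) (simp add: K1_def max_absorb1)
    finally show ?thesis .
  qed
  have 2: "\<tau> powr (\<Sum>i\<in>- K1 \<beta> n \<tau>. (- real n * ln (\<beta> $ i)) / ln \<tau>) =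
      (\<Prod>i\<in>- K1 \<beta> n \<tau>. max \<tau> (inverse (\<beta> $ i) ^ n))"
  proof -
    have p: "\<tau> powr ((- real n * ln (\<beta> $ i)) / ln \<tau>) = inverse (\<beta> $ i) ^ n" for i
    proof -
      have "ln (inverse (\<beta> $ i) ^ n) = - real n * ln (\<beta> $ i)"
        using bp[of i] ln_realpow[of "inverse (\<beta> $ i)" n] ln_inverse[of "\<beta> $ i"] by simp
      then show ?thesis using ln[of "inverse (\<beta> $ i) ^ n"] bp[of i] by (metis positive_imp_inverse_positive zero_less_power)
    qed
    have "\<tau> powr (\<Sum>i\<in>- K1 \<beta> n \<tau>. (- real n * ln (\<beta> $ i)) / ln \<tau>) =
        (\<Prod>i\<in>- K1 \<beta> n \<tau>. \<tau> powr ((- real n * ln (\<beta> $ i)) / ln \<tau>))"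
      using \<tau> by (intro powr_sum) auto
    also have "\<dots> = (\<Prod>i\<in>- K1 \<beta> n \<tau>. max \<tau> (inverse (\<beta> $ i) ^ n))"
      unfolding p using \<tau> by (intro prod.cong refl) (simp add: K1_def max_absorb2)
    finally show ?thesis .
  qed
  have "(\<Prod>i\<in>UNIV. max \<tau> (inverse (\<beta> $ i) ^ n)) =
      (\<Prod>i\<in>K1 \<beta> n \<tau>. max \<tau> (inverse (\<beta> $ i) ^ n)) * (\<Prod>i\<in>- K1 \<beta> n \<tau>. max \<tau> (inverse (\<beta> $ i) ^ n))"
    using prod.union_disjoint[of "K1 \<beta> n \<tau>" "- K1 \<beta> n \<tau>"] by simp
  moreover have "\<tau> powr (\<Sum>k\<in>K2 \<gamma> \<tau>. 1 - ln (norm (\<gamma> k)) / ln \<tau>) =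
      (\<Prod>k\<in>{1..CARD('d)}. min 1 (\<tau> / norm (\<gamma> k)))"
  proof -
    have "\<tau> powr (\<Sum>k\<in>K2 \<gamma> \<tau>. 1 - ln (norm (\<gamma> k)) / ln \<tau>) =
        (\<Prod>k\<in>K2 \<gamma> \<tau>. \<tau> powr (1 - ln (norm (\<gamma> k)) / ln \<tau>))"
      using \<tau> by (intro powr_sum) (auto simp: K2_def)
    also have "\<dots> = (\<Prod>k\<in>K2 \<gamma> \<tau>. min 1 (\<tau> / norm (\<gamma> k)))"
    proof (intro prod.cong refl)
      fix k assume k: "k \<in> K2 \<gamma> \<tau>"
      then have "0 < norm (\<gamma> k)" "\<tau> \<le> norm (\<gamma> k)" using \<gamma> by (auto simp: K2_def)
      then show "\<tau> powr (1 - ln (norm (\<gamma> k)) / ln \<tau>) = min 1 (\<tau> / norm (\<gamma> k))"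
        using \<tau> ln[of "norm (\<gamma> k)"] by (simp add: powr_diff min_def le_divide_eq)
    qed
    also have "\<dots> = (\<Prod>k\<in>{1..CARD('d)}. min 1 (\<tau> / norm (\<gamma> k)))"
    proof (intro prod.mono_neutral_left ballI)
      fix k assume "k \<in> {1..CARD('d)} - K2 \<gamma> \<tau>"
      then show "min 1 (\<tau> / norm (\<gamma> k)) = 1" using \<gamma> by (auto simp: K2_def min_def le_divide_eq)
    qed (auto simp: K2_def)
    finally show ?thesis .
  qed
  ultimately show ?thesis
    unfolding scale_profile_def scale_value_def powr_add 1 2 by simp
qed

lemma finite_scales: "finite (scales \<beta> n \<gamma>)"
  by (simp add: scales_def)

lemma scales_nonempty: "scales \<beta> n \<gamma> \<noteq> {}"
  by (simp add: scales_def)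

lemma s_num_le: "\<tau> \<in> scales \<beta> n \<gamma> \<Longrightarrow> s_num \<beta> n \<gamma> \<le> scale_value \<beta> n \<gamma> \<tau>"
  unfolding s_num_def by (intro Min_le) (auto simp: finite_scales)

lemma s_num_attained:
  obtains \<tau> where "\<tau> \<in> scales \<beta> n \<gamma>" "s_num \<beta> n \<gamma> = scale_value \<beta> n \<gamma> \<tau>"
proof -
  have "s_num \<beta> n \<gamma> \<in> scale_value \<beta> n \<gamma> ` scales \<beta> n \<gamma>"
    unfolding s_num_def by (intro Min_in finite_imageI finite_scales) (simp add: scales_nonempty)
  then show thesis using that by blast
qed

text \<open>Take \<tau> to be the largest scale: every direction contributes 1 to the first sum, and
  \<open>K2\<close> contains nothing but vectors of norm \<tau>, which contribute 0.\<close>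

lemma s_num_le_CARD:
  fixes \<beta> :: "real ^ 'd"
  assumes pos: "\<And>s. s \<in> scales \<beta> n \<gamma> \<Longrightarrow> 0 < s \<and> s < 1"
  shows "s_num \<beta> n \<gamma> \<le> real CARD('d)"
proof -
  define \<tau> where "\<tau> = Max (scales \<beta> n \<gamma>)"
  have \<tau>: "\<tau> \<in> scales \<beta> n \<gamma>" unfolding \<tau>_def by (intro Max_in finite_scales scales_nonempty)
  have max: "s \<le> \<tau>" if "s \<in> scales \<beta> n \<gamma>" for s unfolding \<tau>_def by (intro Max_ge finite_scales that)
  have "K1 \<beta> n \<tau> = UNIV" using max by (auto simp: K1_def scales_def)
  moreover have "(\<Sum>k\<in>K2 \<gamma> \<tau>. 1 - ln (norm (\<gamma> k)) / ln \<tau>) = 0"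
  proof (intro sum.neutral ballI)
    fix k assume "k \<in> K2 \<gamma> \<tau>"
    then have "norm (\<gamma> k) = \<tau>" using max[of "norm (\<gamma> k)"] by (auto simp: K2_def scales_def)
    then show "1 - ln (norm (\<gamma> k)) / ln \<tau> = 0" using pos[OF \<tau>] by simp
  qed
  ultimately have "scale_value \<beta> n \<gamma> \<tau> = real CARD('d)" by (simp add: scale_value_def)
  then show ?thesis using s_num_le[OF \<tau>] by simp
qed

lemma s_num_nonneg:
  fixes \<beta> :: "real ^ 'd"
  assumes \<beta>: "\<And>i. 1 < \<beta> $ i" and pos: "\<And>s. s \<in> scales \<beta> n \<gamma> \<Longrightarrow> 0 < s \<and> s < 1"
  shows "0 \<le> s_num \<beta> n \<gamma>"
proof -
  obtain \<tau> where \<tau>: "\<tau> \<in> scales \<beta> n \<gamma>" "s_num \<beta> n \<gamma> = scale_value \<beta> n \<gamma> \<tau>"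
    by (rule s_num_attained)
  have lnt: "ln \<tau> < 0" using pos[OF \<tau>(1)] by simp
  have "0 \<le> (- real n * ln (\<beta> $ i)) / ln \<tau>" for i
    using lnt \<beta>[of i] by (intro divide_nonpos_nonpos) auto
  moreover have "0 \<le> 1 - ln (norm (\<gamma> k)) / ln \<tau>" if k: "k \<in> K2 \<gamma> \<tau>" for k
  proof -
    have "0 < \<tau>" "\<tau> \<le> norm (\<gamma> k)" using k pos[OF \<tau>(1)] by (auto simp: K2_def)
    then have "ln \<tau> \<le> ln (norm (\<gamma> k))" by (intro ln_mono) auto
    then show ?thesis using lnt by (simp add: divide_le_eq)
  qed
  ultimately show ?thesis unfolding \<tau>(2) scale_value_def
    by (intro add_nonneg_nonneg sum_nonneg) auto
qed

section \<open>Greedy Gram-Schmidt orthogonalisation\<close>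

lemma gs_residual_orth:
  assumes k: "1 \<le> j" "j < k" and nz: "\<gamma> j \<noteq> 0"
    and orth: "\<And>i. i \<in> {1..<k} \<Longrightarrow> i \<noteq> j \<Longrightarrow> \<gamma> i \<bullet> \<gamma> j = 0"
  shows "gs_residual \<gamma> k v \<bullet> \<gamma> j = 0"
proof -
  have "(\<Sum>i\<in>{1..<k}. (v \<bullet> \<gamma> i / (\<gamma> i \<bullet> \<gamma> i)) * (\<gamma> i \<bullet> \<gamma> j)) =
      (\<Sum>i\<in>{1..<k}. if i = j then v \<bullet> \<gamma> j else 0)"
    using orth nz by (intro sum.cong) auto
  also have "\<dots> = v \<bullet> \<gamma> j" using k by simp
  finally show ?thesis
    by (simp add: gs_residual_def inner_diff_left inner_sum_left)
qed

text \<open>The bound on \<open>u\<close> is where greediness enters. At the step that produces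
  \<open>\<gamma> (\<kappa> j)\<close>, a later vector \<open>a i\<close> was still available, so
  its residual is no longer than \<open>\<gamma> (\<kappa> j)\<close>; earlier projections do not
  change the inner product with \<open>\<gamma> (\<kappa> j)\<close>, and Cauchy-Schwarz bounds the
  coefficient by 1. The map \<kappa> sends an edge to the step at which it is chosen.\<close>

lemma greedy_gram_schmidt_decomp:
  fixes a :: "'d \<Rightarrow> real ^ 'd" and \<gamma> :: "nat \<Rightarrow> real ^ 'd"
  assumes G: "greedy_gram_schmidt a \<gamma>" and inja: "inj a" and ind: "independent (range a)"
  obtains \<kappa> :: "'d \<Rightarrow> nat" and u :: "'d \<Rightarrow> 'd \<Rightarrow> real" where
    "bij_betw \<kappa> UNIV {1..CARD('d)}"
    "\<And>i j. i \<noteq> j \<Longrightarrow> \<gamma> (\<kappa> i) \<bullet> \<gamma> (\<kappa> j) = 0"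
    "\<And>i. \<gamma> (\<kappa> i) \<noteq> 0"
    "\<And>i. norm (\<gamma> (\<kappa> i)) \<le> norm (a i)"
    "\<And>i. a i = (\<Sum>j\<in>UNIV. u j i *\<^sub>R \<gamma> (\<kappa> j))"
    "\<And>i j. \<bar>u i j\<bar> \<le> 1" "\<And>i. u i i = 1" "\<And>i j. \<kappa> j < \<kappa> i \<Longrightarrow> u i j = 0"
proof -
  let ?d = "CARD('d)"
  obtain \<sigma> :: "nat \<Rightarrow> 'd" where \<sigma>:
    "\<And>k. k \<in> {1..?d} \<Longrightarrow> \<sigma> k \<notin> \<sigma> ` {1..<k}"
    "\<And>k l. k \<in> {1..?d} \<Longrightarrow> l \<notin> \<sigma> ` {1..<k} \<Longrightarrow>
           norm (gs_residual \<gamma> k (a l)) \<le> norm (gs_residual \<gamma> k (a (\<sigma> k)))"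
    "\<And>k. k \<in> {1..?d} \<Longrightarrow> \<gamma> k = gs_residual \<gamma> k (a (\<sigma> k))"
    using G unfolding greedy_gram_schmidt_def by blast
  have inj\<sigma>: "inj_on \<sigma> {1..?d}"
  proof (rule inj_onI)
    fix k l assume "k \<in> {1..?d}" "l \<in> {1..?d}" "\<sigma> k = \<sigma> l"
    then show "k = l" using \<sigma>(1)[of k] \<sigma>(1)[of l]
      by (metis atLeastAtMost_iff atLeastLessThan_iff image_eqI linorder_neqE_nat)
  qed
  have im: "\<sigma> ` {1..?d} = UNIV"
    using card_image[OF inj\<sigma>] by (intro card_subset_eq) auto
  have bij\<sigma>: "bij_betw \<sigma> {1..?d} UNIV" using inj\<sigma> im by (simp add: bij_betw_def)
  have span\<gamma>: "\<gamma> k \<in> span (a ` \<sigma> ` {1..k})" if "k \<in> {1..?d}" for k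
    using that
  proof (induction k rule: less_induct)
    case (less k)
    have "\<gamma> k = a (\<sigma> k) - (\<Sum>j\<in>{1..<k}. ((a (\<sigma> k) \<bullet> \<gamma> j) / (\<gamma> j \<bullet> \<gamma> j)) *\<^sub>R \<gamma> j)"
      using \<sigma>(3)[OF less(2)] unfolding gs_residual_def by simp
    also have "\<dots> \<in> span (a ` \<sigma> ` {1..k})"
    proof (intro span_diff span_sum span_scale)
      show "a (\<sigma> k) \<in> span (a ` \<sigma> ` {1..k})" using less(2) by (intro span_base) auto
      fix j assume j: "j \<in> {1..<k}"
      have "\<gamma> j \<in> span (a ` \<sigma> ` {1..j})" using less j by auto
      also have "\<dots> \<subseteq> span (a ` \<sigma> ` {1..k})" using j by (intro span_mono image_mono) auto
      finally show "\<gamma> j \<in> span (a ` \<sigma> ` {1..k})" .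
    qed
    finally show ?case .
  qed
  \<comment> \<open>A vanishing residual would put \<open>a (\<sigma> k)\<close> into the span of
    the edges chosen before, against independence.\<close>
  have nz: "\<gamma> k \<noteq> 0" if k: "k \<in> {1..?d}" for k
  proof
    assume "\<gamma> k = 0"
    then have "a (\<sigma> k) = (\<Sum>j\<in>{1..<k}. ((a (\<sigma> k) \<bullet> \<gamma> j) / (\<gamma> j \<bullet> \<gamma> j)) *\<^sub>R \<gamma> j)"
      using \<sigma>(3)[OF k] unfolding gs_residual_def by simp
    also have "\<dots> \<in> span (range a - {a (\<sigma> k)})"
    proof (intro span_sum span_scale)
      fix j assume j: "j \<in> {1..<k}"
      then have "\<gamma> j \<in> span (a ` \<sigma> ` {1..j})" using k span\<gamma> by auto
      also have "\<dots> \<subseteq> span (range a - {a (\<sigma> k)})"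
      proof (intro span_mono subsetI)
        fix v assume "v \<in> a ` \<sigma> ` {1..j}"
        then obtain i where "i \<in> {1..j}" "v = a (\<sigma> i)" by auto
        moreover from this have "\<sigma> i \<noteq> \<sigma> k" using \<sigma>(1)[OF k] j
          by (metis atLeastAtMost_iff atLeastLessThan_iff image_eqI order.strict_trans1)
        ultimately show "v \<in> range a - {a (\<sigma> k)}" using inja by (auto dest: injD)
      qed
      finally show "\<gamma> j \<in> span (range a - {a (\<sigma> k)})" .
    qed
    finally show False using ind unfolding dependent_def by blast
  qed
  have orth: "\<forall>j\<in>{1..<k}. \<gamma> k \<bullet> \<gamma> j = 0" if "k \<in> {1..?d}" for k
    using that
  proof (induction k rule: less_induct)
    case (less k)
    show ?case
    proof
      fix j assume j: "j \<in> {1..<k}"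
      have "gs_residual \<gamma> k (a (\<sigma> k)) \<bullet> \<gamma> j = 0"
      proof (rule gs_residual_orth)
        fix i assume "i \<in> {1..<k}" "i \<noteq> j"
        then show "\<gamma> i \<bullet> \<gamma> j = 0"
          using less(1)[of i] less(1)[of j] less(2) j
          by (cases "i < j") (auto simp: inner_commute)
      qed (use j nz less(2) in auto)
      then show "\<gamma> k \<bullet> \<gamma> j = 0" using \<sigma>(3)[OF less(2)] by simp
    qed
  qed
  have orth2: "\<gamma> k \<bullet> \<gamma> j = 0" if "k \<in> {1..?d}" "j \<in> {1..?d}" "j \<noteq> k" for j k
    using orth[of k] orth[of j] that by (cases "j < k") (auto simp: inner_commute)
  define \<kappa> where "\<kappa> = the_inv_into {1..?d} \<sigma>"
  have bij: "bij_betw \<kappa> UNIV {1..?d}" unfolding \<kappa>_def by (rule bij_betw_the_inv_into[OF bij\<sigma>])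
  have \<kappa>: "\<kappa> i \<in> {1..?d}" "\<sigma> (\<kappa> i) = i" for i
    using bij_betwE[OF bij] f_the_inv_into_f_bij_betw[OF bij\<sigma>, of i] by (auto simp: \<kappa>_def)
  have inj\<kappa>: "\<kappa> i \<noteq> \<kappa> j" if "i \<noteq> j" for i j using \<kappa>(2) that by metis
  \<comment> \<open>The Gram-Schmidt coefficients, triangular in the order of choice.\<close>
  define u where "u = (\<lambda>j i. if j = i then 1 else if \<kappa> j < \<kappa> i then (a i \<bullet> \<gamma> (\<kappa> j)) / (\<gamma> (\<kappa> j) \<bullet> \<gamma> (\<kappa> j)) else 0)"
  have dec: "a i = (\<Sum>j\<in>UNIV. u j i *\<^sub>R \<gamma> (\<kappa> j))" for i
  proof -
    have "(\<Sum>j\<in>UNIV. u j i *\<^sub>R \<gamma> (\<kappa> j)) = \<gamma> (\<kappa> i) + (\<Sum>j\<in>UNIV - {i}. u j i *\<^sub>R \<gamma> (\<kappa> j))"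
      by (subst sum.remove[of _ i]) (auto simp: u_def)
    also have "(\<Sum>j\<in>UNIV - {i}. u j i *\<^sub>R \<gamma> (\<kappa> j)) = (\<Sum>j\<in>{j. \<kappa> j < \<kappa> i}. u j i *\<^sub>R \<gamma> (\<kappa> j))"
      by (intro sum.mono_neutral_right) (auto simp: u_def)
    also have "\<dots> = (\<Sum>j\<in>{j. \<kappa> j < \<kappa> i}. ((a i \<bullet> \<gamma> (\<kappa> j)) / (\<gamma> (\<kappa> j) \<bullet> \<gamma> (\<kappa> j))) *\<^sub>R \<gamma> (\<kappa> j))"
      by (intro sum.cong) (auto simp: u_def)
    also have "\<dots> = (\<Sum>k\<in>\<kappa> ` {j. \<kappa> j < \<kappa> i}. ((a i \<bullet> \<gamma> k) / (\<gamma> k \<bullet> \<gamma> k)) *\<^sub>R \<gamma> k)"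
      by (subst sum.reindex) (auto intro!: inj_onI dest: inj\<kappa>)
    also have "\<kappa> ` {j. \<kappa> j < \<kappa> i} = {1..<\<kappa> i}"
    proof -
      have "k \<in> \<kappa> ` {j. \<kappa> j < \<kappa> i}" if "k \<in> {1..<\<kappa> i}" for k
      proof -
        have "k \<in> {1..?d}" using that \<kappa>(1)[of i] by auto
        then have "\<kappa> (\<sigma> k) = k" unfolding \<kappa>_def using inj\<sigma> by (simp add: the_inv_into_f_f)
        then show ?thesis using that by (metis (mono_tags) atLeastLessThan_iff image_eqI mem_Collect_eq)
      qed
      then show ?thesis using \<kappa>(1) by fastforce
    qed
    finally show ?thesis using \<sigma>(3)[OF \<kappa>(1)[of i]] \<kappa>(2)[of i] by (simp add: gs_residual_def)
  qed
  have u1: "\<bar>u j i\<bar> \<le> 1" for i j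
  proof (cases "j \<noteq> i \<and> \<kappa> j < \<kappa> i")
    case True
    let ?g = "\<gamma> (\<kappa> j)" and ?r = "gs_residual \<gamma> (\<kappa> j) (a i)"
    have "i \<notin> \<sigma> ` {1..<\<kappa> j}"
    proof
      assume "i \<in> \<sigma> ` {1..<\<kappa> j}"
      then obtain k where "k \<in> {1..<\<kappa> j}" "\<sigma> k = i" by auto
      moreover from this have "k \<in> {1..?d}" using \<kappa>(1)[of j] by auto
      ultimately have "k = \<kappa> i" using \<kappa>[of i] inj\<sigma> by (metis inj_onD)
      then show False using \<open>k \<in> {1..<\<kappa> j}\<close> True by auto
    qed
    then have le: "norm ?r \<le> norm ?g"
      using \<sigma>(2)[OF \<kappa>(1)[of j], of i] \<sigma>(3)[OF \<kappa>(1)[of j]] by simp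
    have "(\<Sum>k\<in>{1..<\<kappa> j}. ((a i \<bullet> \<gamma> k) / (\<gamma> k \<bullet> \<gamma> k)) *\<^sub>R \<gamma> k) \<bullet> ?g = 0"
      unfolding inner_sum_left using orth2 \<kappa>(1)[of j] by (intro sum.neutral) auto
    then have "a i \<bullet> ?g = ?r \<bullet> ?g" by (simp add: gs_residual_def inner_diff_left)
    then have "\<bar>a i \<bullet> ?g\<bar> \<le> norm ?r * norm ?g" using Cauchy_Schwarz_ineq2 by metis
    also have "\<dots> \<le> norm ?g * norm ?g" using le by (intro mult_right_mono) auto
    also have "\<dots> = ?g \<bullet> ?g" by (simp add: dot_square_norm power2_eq_square)
    finally have "\<bar>a i \<bullet> ?g\<bar> / (?g \<bullet> ?g) \<le> 1"
      by (simp add: divide_le_eq)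
    then show ?thesis using True by (simp add: u_def abs_divide)
  qed (auto simp: u_def)
  have nrm: "norm (\<gamma> (\<kappa> i)) \<le> norm (a i)" for i
  proof -
    let ?g = "\<gamma> (\<kappa> i)"
    have "a i \<bullet> ?g = (\<Sum>j\<in>UNIV. u j i * (\<gamma> (\<kappa> j) \<bullet> ?g))"
      by (subst dec) (simp add: inner_sum_left)
    also have "\<dots> = (\<Sum>j\<in>UNIV. if j = i then ?g \<bullet> ?g else 0)"
      using orth2 \<kappa>(1) inj\<kappa> by (intro sum.cong) (auto simp: u_def)
    also have "\<dots> = norm ?g * norm ?g" by (simp add: dot_square_norm power2_eq_square)
    finally have "norm ?g * norm ?g \<le> norm (a i) * norm ?g" using norm_cauchy_schwarz by metis
    then show ?thesis using nz[OF \<kappa>(1)[of i]] by simp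
  qed
  have u0: "u i j = 0" if "\<kappa> j < \<kappa> i" for i j using that by (auto simp: u_def)
  have uii: "u i i = 1" for i by (simp add: u_def)
  show thesis
    using that[of \<kappa> u] bij dec u1 nrm nz \<kappa>(1) orth2 inj\<kappa> u0 uii by auto
qed

section \<open>Orthogonal boxes in parallelepipeds\<close>

abbreviation combine :: "('d \<Rightarrow> real ^ 'd) \<Rightarrow> real ^ 'd \<Rightarrow> real ^ 'd" where
  "combine a x \<equiv> (\<Sum>i\<in>UNIV. x $ i *\<^sub>R a i)"

lemma linear_combine: "linear (combine a)"
  by (intro linearI) (simp_all add: scaleR_left_distrib sum.distrib scaleR_sum_right)

lemma orthogonal_inner_combine:
  fixes g :: "'d \<Rightarrow> real ^ 'd"
  assumes orth: "\<And>i j. i \<noteq> j \<Longrightarrow> g i \<bullet> g j = 0"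
  shows "combine g y \<bullet> g i = y $ i * (norm (g i))\<^sup>2"
proof -
  have "combine g y \<bullet> g i = (\<Sum>j\<in>UNIV. y $ j * (g j \<bullet> g i))" by (simp add: inner_sum_left)
  also have "\<dots> = (\<Sum>j\<in>UNIV. if j = i then y $ i * (g i \<bullet> g i) else 0)"
    using orth by (intro sum.cong) auto
  finally show ?thesis by (simp add: dot_square_norm)
qed

lemma orthogonal_coordinate_le:
  fixes g :: "'d \<Rightarrow> real ^ 'd"
  assumes orth: "\<And>i j. i \<noteq> j \<Longrightarrow> g i \<bullet> g j = 0" and nz: "\<And>i. g i \<noteq> 0"
  shows "\<bar>y $ i\<bar> \<le> norm (combine g y) / norm (g i)"
proof -
  have "combine g y \<bullet> g i = y $ i * (norm (g i))\<^sup>2"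
    by (rule orthogonal_inner_combine) (use orth in auto)
  then have "\<bar>y $ i\<bar> * (norm (g i))\<^sup>2 = \<bar>combine g y \<bullet> g i\<bar>"
    by (simp only: abs_mult abs_power2 zero_le_power2 abs_of_nonneg)
  also have "\<dots> \<le> norm (combine g y) * norm (g i)" by (rule Cauchy_Schwarz_ineq2)
  finally have "\<bar>y $ i\<bar> * norm (g i) * norm (g i) \<le> norm (combine g y) * norm (g i)"
    by (simp only: power2_eq_square mult.assoc)
  then have "\<bar>y $ i\<bar> * norm (g i) \<le> norm (combine g y)"
    by (rule mult_right_le_imp_le) (use nz[of i] in simp)
  then show ?thesis using nz[of i] by (simp add: pos_le_divide_eq)
qed

lemma inj_combine:
  fixes g :: "'d \<Rightarrow> real ^ 'd"
  assumes orth: "\<And>i j. i \<noteq> j \<Longrightarrow> g i \<bullet> g j = 0" and nz: "\<And>i. g i \<noteq> 0"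
  shows "inj (combine g)"
proof (rule linear_injective_0[OF linear_combine, THEN iffD2], intro allI impI)
  fix y assume 0: "combine g y = 0"
  have "\<bar>y $ i\<bar> \<le> norm (combine g y) / norm (g i)" for i
    by (rule orthogonal_coordinate_le) (use orth nz in auto)
  then have "\<bar>y $ i\<bar> \<le> 0" for i by (simp only: 0 norm_zero div_0)
  then show "y = 0" by (simp add: vec_eq_iff)
qed

text \<open>Strict inequalities make the box open for orthogonal nonzero \<open>g\<close>, which is
  what turns the limsup set of the lower bound into a G-delta set. Lengths are relative to
  \<open>g\<close>, so one \<open>e\<close> serves for all orders.\<close>

definition ortho_box :: "real ^ 'd \<Rightarrow> ('d \<Rightarrow> real ^ 'd) \<Rightarrow> real \<Rightarrow> (real ^ 'd) set" where
  "ortho_box q g e = {q + combine g v | v. \<forall>i. \<bar>v $ i\<bar> < e}"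

lemma ortho_box_eq: "ortho_box q g e = (+) q ` combine g ` box (\<chi> i. - e) (\<chi> i. e)"
  by (auto simp: ortho_box_def mem_box_cart abs_less_iff minus_less_iff intro!: image_eqI)

lemma open_ortho_box:
  fixes g :: "'d \<Rightarrow> real ^ 'd"
  assumes orth: "\<And>i j. i \<noteq> j \<Longrightarrow> g i \<bullet> g j = 0" and nz: "\<And>i. g i \<noteq> 0"
  shows "open (ortho_box q g e)"
  unfolding ortho_box_eq
  by (intro open_translation open_surjective_linear_image linear_combine open_box
      linear_injective_imp_surjective inj_combine assms refl)

text \<open>Back substitution in a unit triangular system with entries at most 1: each unknown is
  bounded by \<open>e\<close> plus the bounds of those found before. These are different powers of 2
  times \<open>e\<close>, and \<open>1 + (2 ^ m - 1) = 2 ^ m\<close> closes the induction.\<close>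

lemma back_substitution_bound:
  fixes \<kappa> :: "'d::finite \<Rightarrow> nat" and c y :: "'d \<Rightarrow> real"
  assumes inj: "inj \<kappa>" and rng: "\<And>i. \<kappa> i \<le> D" and e: "0 \<le> e"
    and u: "\<And>i j. \<bar>u i j\<bar> \<le> 1" "\<And>i. u i i = 1" "\<And>i j. \<kappa> j < \<kappa> i \<Longrightarrow> u i j = 0"
    and eq: "\<And>i. y i = (\<Sum>j\<in>UNIV. u i j * c j)" and y: "\<And>i. \<bar>y i\<bar> \<le> e"
  shows "\<bar>c i\<bar> \<le> e * 2 ^ (D - \<kappa> i)"
proof (induction "D - \<kappa> i" arbitrary: i rule: less_induct)
  case less
  let ?J = "{j. \<kappa> i < \<kappa> j}"
  have "y i = c i + (\<Sum>j\<in>UNIV - {i}. u i j * c j)"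
    unfolding eq by (subst sum.remove[of _ i]) (auto simp: u)
  also have "(\<Sum>j\<in>UNIV - {i}. u i j * c j) = (\<Sum>j\<in>?J. u i j * c j)"
  proof (intro sum.mono_neutral_right ballI)
    fix j assume "j \<in> UNIV - {i} - ?J"
    then have "\<kappa> j < \<kappa> i" using inj by (auto simp: not_less order_le_less dest: injD)
    then show "u i j * c j = 0" by (simp add: u)
  qed auto
  finally have "\<bar>c i\<bar> \<le> \<bar>y i\<bar> + \<bar>\<Sum>j\<in>?J. u i j * c j\<bar>" by linarith
  also have "\<dots> \<le> e + (\<Sum>j\<in>?J. e * 2 ^ (D - \<kappa> j))"
  proof (intro add_mono y order.trans[OF sum_abs] sum_mono)
    fix j assume j: "j \<in> ?J"
    have "\<bar>u i j * c j\<bar> \<le> 1 * \<bar>c j\<bar>" unfolding abs_mult by (intro mult_right_mono u) auto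
    also have "\<dots> \<le> e * 2 ^ (D - \<kappa> j)" using less[of j] j rng[of j] by (simp add: diff_less_mono2)
    finally show "\<bar>u i j * c j\<bar> \<le> e * 2 ^ (D - \<kappa> j)" .
  qed
  also have "\<dots> = e * (1 + (\<Sum>j\<in>?J. 2 ^ (D - \<kappa> j)))" by (simp add: distrib_left sum_distrib_left)
  also have "(\<Sum>j\<in>?J. (2::real) ^ (D - \<kappa> j)) = (\<Sum>m\<in>(\<lambda>j. D - \<kappa> j) ` ?J. 2 ^ m)"
  proof (subst sum.reindex)
    show "inj_on (\<lambda>j. D - \<kappa> j) ?J"
    proof (rule inj_onI)
      fix j k assume "D - \<kappa> j = D - \<kappa> k"
      then have "\<kappa> j = \<kappa> k" using rng[of j] rng[of k] by linarith
      then show "j = k" using inj by (auto dest: injD)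
    qed
  qed simp
  also have "\<dots> \<le> (\<Sum>m<D - \<kappa> i. 2 ^ m)"
    using rng by (intro sum_mono2) (auto intro: diff_less_mono2 order_less_le_trans)
  also have "\<dots> = 2 ^ (D - \<kappa> i) - 1" by (simp add: geometric_sum)
  finally show ?case using e by (simp add: mult_left_mono)
qed

text \<open>Greediness makes the triangular change of coordinates and its inverse bounded, so the
  parallelepiped contains an orthogonal box of comparable size.\<close>

lemma ortho_box_in_parallelepiped:
  fixes a g :: "'d \<Rightarrow> real ^ 'd" and \<kappa> :: "'d \<Rightarrow> nat"
  assumes inj: "inj \<kappa>" and rng: "\<And>i. \<kappa> i \<le> CARD('d)"
    and dec: "\<And>i. a i = (\<Sum>j\<in>UNIV. u j i *\<^sub>R g j)"
    and u: "\<And>i j. \<bar>u i j\<bar> \<le> 1" "\<And>i. u i i = 1" "\<And>i j. \<kappa> j < \<kappa> i \<Longrightarrow> u i j = 0"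
  obtains q' where "ortho_box q' g (1 / 2 ^ (CARD('d) + 1)) \<subseteq>
    {q + (\<Sum>j\<in>UNIV. c j *\<^sub>R a j) | c. \<forall>j. 0 \<le> c j \<and> c j \<le> 1}"
proof
  let ?d = "CARD('d)" and ?e = "1 / 2 ^ (CARD('d) + 1) :: real"
  define U :: "real ^ 'd ^ 'd" where "U = (\<chi> i j. u i j)"
  have Uv: "(U *v c) $ i = (\<Sum>j\<in>UNIV. u i j * c $ j)" for c i
    by (simp add: U_def matrix_vector_mult_def)
  have bound: "\<bar>c $ i\<bar> \<le> e * 2 ^ (?d - \<kappa> i)" if "0 \<le> e" "\<And>i. \<bar>(U *v c) $ i\<bar> \<le> e" for c e i
    by (rule back_substitution_bound[OF inj rng that(1) u Uv that(2)])
  have "inj ((*v) U)"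
  proof (rule linear_injective_0[OF matrix_vector_mul_linear, THEN iffD2], intro allI impI)
    fix c assume "U *v c = 0"
    then show "c = 0" using bound[of 0 c] by (simp add: vec_eq_iff)
  qed
  then have surj: "surj ((*v) U)" by (rule linear_injective_imp_surjective[OF matrix_vector_mul_linear _ refl])
  have comb: "combine a c = combine g (U *v c)" for c
  proof -
    have "combine a c = (\<Sum>i\<in>UNIV. \<Sum>j\<in>UNIV. (c $ i * u j i) *\<^sub>R g j)"
      by (simp add: dec scaleR_sum_right)
    also have "\<dots> = (\<Sum>j\<in>UNIV. \<Sum>i\<in>UNIV. (c $ i * u j i) *\<^sub>R g j)" by (rule sum.swap)
    also have "\<dots> = combine g (U *v c)"
      by (simp add: Uv scaleR_sum_left mult.commute)
    finally show ?thesis .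
  qed
  \<comment> \<open>The box is centred at the midpoint, where all coefficients are 1/2. Solving for
    the coefficients costs at most \<open>2 ^ d\<close>, so the half-width
    \<open>1 / 2 ^ (d + 1)\<close> changes them by at most 1/2.\<close>
  show "ortho_box (q + combine a (\<chi> i. 1 / 2)) g ?e \<subseteq>
    {q + (\<Sum>j\<in>UNIV. c j *\<^sub>R a j) | c. \<forall>j. 0 \<le> c j \<and> c j \<le> 1}"
  proof
    fix x assume "x \<in> ortho_box (q + combine a (\<chi> i. 1 / 2)) g ?e"
    then obtain v where v: "x = q + combine a (\<chi> i. 1 / 2) + combine g v" "\<And>i. \<bar>v $ i\<bar> < ?e"
      by (auto simp: ortho_box_def)
    obtain c where c: "v = U *v c" using surj by (metis surjD)
    have "\<bar>c $ i\<bar> \<le> 1 / 2" for i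
    proof -
      have "\<bar>c $ i\<bar> \<le> ?e * 2 ^ (?d - \<kappa> i)" by (rule bound) (use v(2) c in \<open>auto intro: less_imp_le\<close>)
      also have "\<dots> \<le> ?e * 2 ^ ?d" by (intro mult_left_mono power_increasing) auto
      finally show ?thesis by simp
    qed
    then have "0 \<le> 1 / 2 + c $ i \<and> 1 / 2 + c $ i \<le> 1" for i by (smt (verit) field_sum_of_halves)
    moreover have "x = q + (\<Sum>j\<in>UNIV. (1 / 2 + c $ j) *\<^sub>R a j)"
      by (simp only: v(1) c comb[symmetric]) (simp add: scaleR_left_distrib sum.distrib add.assoc)
    ultimately show "x \<in> {q + (\<Sum>j\<in>UNIV. c j *\<^sub>R a j) | c. \<forall>j. 0 \<le> c j \<and> c j \<le> 1}"
      by (intro CollectI exI[of _ "\<lambda>j. 1 / 2 + c $ j"]) simp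
  qed
qed

text \<open>Volume is taken in coordinates along \<open>g\<close>, so all boxes have the same total
  mass whatever the lengths of \<open>g\<close>. A set of diameter at most \<open>d * r\<close>
  confines the \<open>i\<close>th coordinate to a range comparable to \<open>r / norm (g i)\<close>,
  and the box itself confines it to \<open>2 * e\<close>.\<close>

lemma emeasure_box_coordinates:
  fixes g :: "'d \<Rightarrow> real ^ 'd" and Q :: "(real ^ 'd) set"
  assumes orth: "\<And>i j. i \<noteq> j \<Longrightarrow> g i \<bullet> g j = 0" and nz: "\<And>i. g i \<noteq> 0"
    and r: "0 < r" and e: "2 * e \<le> real CARD('d)"
    and diam: "\<And>x y. x \<in> Q \<Longrightarrow> y \<in> Q \<Longrightarrow> dist x y \<le> real CARD('d) * r"
  shows "emeasure lborel (box (\<chi> i. - e) (\<chi> i. e) \<inter> {v. q + combine g v \<in> Q}) \<le>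
    ennreal ((2 * real CARD('d)) ^ CARD('d) * (\<Prod>i\<in>UNIV. min 1 (r / norm (g i))))"
proof (cases "box (\<chi> i. - e) (\<chi> i. e) \<inter> {v. q + combine g v \<in> Q} = {}")
  case False
  let ?d = "real CARD('d)"
  obtain v0 where v0: "v0 \<in> box (\<chi> i. - e) (\<chi> i. e)" "q + combine g v0 \<in> Q" using False by blast
  define h :: "real ^ 'd" where "h = (\<chi> i. ?d * min 1 (r / norm (g i)))"
  have hpos: "0 < h $ i" for i using r nz[of i] by (simp add: h_def)
  have "box (\<chi> i. - e) (\<chi> i. e) \<inter> {v. q + combine g v \<in> Q} \<subseteq> cbox (v0 - h) (v0 + h)"
  proof
    fix v assume "v \<in> box (\<chi> i. - e) (\<chi> i. e) \<inter> {v. q + combine g v \<in> Q}"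
    then have v: "v \<in> box (\<chi> i. - e) (\<chi> i. e)" "q + combine g v \<in> Q" by auto
    have "\<bar>(v - v0) $ i\<bar> \<le> h $ i" for i
    proof -
      have "- e < v $ i" "v $ i < e" "- e < v0 $ i" "v0 $ i < e"
        using v(1) v0(1) by (auto simp: mem_box_cart)
      then have "\<bar>(v - v0) $ i\<bar> \<le> ?d" using e by (simp add: abs_le_iff)
      moreover have "\<bar>(v - v0) $ i\<bar> \<le> ?d * (r / norm (g i))"
      proof -
        have "\<bar>(v - v0) $ i\<bar> \<le> norm (combine g (v - v0)) / norm (g i)"
          by (rule orthogonal_coordinate_le[OF orth nz])
        also have "norm (combine g (v - v0)) = dist (q + combine g v) (q + combine g v0)"
          by (simp only: linear_diff[OF linear_combine] dist_norm add_diff_cancel_left)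
        also have "\<dots> / norm (g i) \<le> ?d * r / norm (g i)"
          by (intro divide_right_mono diam v(2) v0(2)) simp
        finally show ?thesis by simp
      qed
      ultimately show ?thesis by (simp add: h_def min_def)
    qed
    then show "v \<in> cbox (v0 - h) (v0 + h)" by (auto simp: mem_box_cart abs_le_iff algebra_simps)
  qed
  then have "emeasure lborel (box (\<chi> i. - e) (\<chi> i. e) \<inter> {v. q + combine g v \<in> Q}) \<le>
      emeasure lborel (cbox (v0 - h) (v0 + h))" by (intro emeasure_mono) auto
  also have "\<dots> = ennreal (\<Prod>i\<in>UNIV. (v0 + h) $ i - (v0 - h) $ i)"
    using hpos by (intro emeasure_cbox_cart) (smt (verit) vector_add_component vector_minus_component)
  also have "(\<Prod>i\<in>UNIV. (v0 + h) $ i - (v0 - h) $ i) = (\<Prod>i\<in>(UNIV::'d set). 2 * ?d * min 1 (r / norm (g i)))"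
    by (intro prod.cong) (auto simp: h_def)
  also have "\<dots> = (2 * ?d) ^ CARD('d) * (\<Prod>i\<in>UNIV. min 1 (r / norm (g i)))"
    by (simp add: prod.distrib)
  finally show ?thesis .
qed simp

section \<open>Lower bound and large intersections\<close>

lemma funpow_beta_prod: "(beta_prod \<beta> ^^ n) x = (\<chi> i. (beta_map (\<beta> $ i) ^^ n) (x $ i))"
  by (induction n) (simp_all add: beta_prod_def vec_eq_iff)

lemma funpow_contraction: "(contraction \<beta> ^^ n) v = (\<chi> i. inverse (\<beta> $ i) ^ n * v $ i)"
  by (induction n) (simp_all add: contraction_def vec_eq_iff)

definition full_words :: "real ^ 'd \<Rightarrow> nat \<Rightarrow> (real ^ 'd) set" where
  "full_words \<beta> n = {w. \<forall>i. w $ i \<in> full_ends (\<beta> $ i) n}"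

lemma card_vec_set:
  fixes F :: "'d::finite \<Rightarrow> 'a set"
  assumes "\<And>i. finite (F i)"
  shows "finite {w :: 'a ^ 'd. \<forall>i. w $ i \<in> F i}" "card {w :: 'a ^ 'd. \<forall>i. w $ i \<in> F i} = (\<Prod>i\<in>UNIV. card (F i))"
proof -
  have e: "{w :: 'a ^ 'd. \<forall>i. w $ i \<in> F i} = vec_lambda ` PiE UNIV F"
  proof (intro set_eqI iffI)
    fix w :: "'a ^ 'd" assume "w \<in> {w. \<forall>i. w $ i \<in> F i}"
    then have "w = vec_lambda (vec_nth w)" "vec_nth w \<in> PiE UNIV F" by auto
    then show "w \<in> vec_lambda ` PiE UNIV F" by blast
  qed auto
  have inj: "inj_on vec_lambda (PiE UNIV F)" by (auto intro!: inj_onI simp: vec_lambda_inject)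
  show "finite {w :: 'a ^ 'd. \<forall>i. w $ i \<in> F i}" unfolding e using assms by (intro finite_imageI finite_PiE) auto
  show "card {w :: 'a ^ 'd. \<forall>i. w $ i \<in> F i} = (\<Prod>i\<in>UNIV. card (F i))"
    unfolding e using card_image[OF inj] by (simp add: card_PiE)
qed

text \<open>On a product of full cylinders the iterate undoes the contraction, so a translate of a
  subset of the contracted \<open>P n\<close> by a full word consists of points that hit
  \<open>P n\<close>.\<close>

lemma full_word_add:
  fixes \<beta> :: "real ^ 'd"
  assumes \<beta>: "\<And>i. 1 < \<beta> $ i" and w: "w \<in> full_words \<beta> n" and s: "\<And>i. 0 \<le> s $ i \<and> s $ i < inverse (\<beta> $ i) ^ n"
  shows "w + s \<in> half_open_unit_cube" "(beta_prod \<beta> ^^ n) (w + s) = (\<chi> i. \<beta> $ i ^ n * s $ i)"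
proof -
  have *: "0 \<le> (w + s) $ i \<and> (w + s) $ i < 1 \<and> (beta_map (\<beta> $ i) ^^ n) ((w + s) $ i) = \<beta> $ i ^ n * s $ i" for i
  proof -
    have "w $ i \<in> full_ends (\<beta> $ i) n" using w by (simp add: full_words_def)
    then have "0 \<le> w $ i" "\<And>y. w $ i \<le> y \<Longrightarrow> y < w $ i + 1 / \<beta> $ i ^ n \<Longrightarrow>
        y < 1 \<and> (beta_map (\<beta> $ i) ^^ n) y = \<beta> $ i ^ n * (y - w $ i)"
      by (auto simp: full_ends_def left_ends_def)
    from this(1) this(2)[of "(w + s) $ i"] s[of i] show ?thesis
      by (simp add: power_one_over inverse_eq_divide)
  qed
  then show "w + s \<in> half_open_unit_cube" by (simp add: half_open_unit_cube_def)
  show "(beta_prod \<beta> ^^ n) (w + s) = (\<chi> i. \<beta> $ i ^ n * s $ i)"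
    using * by (simp add: funpow_beta_prod vec_eq_iff)
qed

lemma card_words_near_cube:
  fixes \<beta> :: "real ^ 'd" and r :: "int \<times> (int ^ 'd)" and n :: nat
  assumes \<beta>: "\<And>i. 1 < \<beta> $ i"
  defines "N \<equiv> {w \<in> full_words \<beta> n. \<exists>s. (\<forall>i. 0 \<le> s $ i \<and> s $ i < inverse (\<beta> $ i) ^ n) \<and> w + s \<in> cube r}"
  shows "finite N \<and> real (card N) \<le> (\<Prod>i\<in>UNIV. 3 * max (side r) (inverse (\<beta> $ i) ^ n) * \<beta> $ i ^ n)"
proof -
  \<comment> \<open>A cylinder may start up to one of its lengths before the cube and still reach
    it, hence the shift of the lower bound.\<close>
  define lo where "lo i = of_int (snd r $ i) * side r - inverse (\<beta> $ i) ^ n" for i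
  define hi where "hi i = (of_int (snd r $ i) + 1) * side r" for i
  define F where "F i = full_ends (\<beta> $ i) n \<inter> {lo i..<hi i}" for i
  have b: "0 < inverse (\<beta> $ i) ^ n" for i using \<beta>[of i] by simp
  have F: "finite (F i) \<and> real (card (F i)) \<le> 3 * max (side r) (inverse (\<beta> $ i) ^ n) * \<beta> $ i ^ n" for i
  proof -
    have le: "lo i \<le> hi i" using b[of i] by (simp add: lo_def hi_def algebra_simps add_increasing)
    have *: "finite (F i)" "real (card (F i)) \<le> (hi i - lo i) * \<beta> $ i ^ n + 1"
      using full_ends_card_upper[OF \<beta> le, of i n] by (auto simp: F_def)
    have i1: "inverse (\<beta> $ i) ^ n * \<beta> $ i ^ n = 1" using \<beta>[of i] by (simp add: power_mult_distrib[symmetric])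
    let ?m = "max (side r) (inverse (\<beta> $ i) ^ n)"
    have "(hi i - lo i) * \<beta> $ i ^ n + 1 = side r * \<beta> $ i ^ n + 2 * (inverse (\<beta> $ i) ^ n * \<beta> $ i ^ n)"
      unfolding i1 lo_def hi_def using i1 by (simp add: algebra_simps)
    also have "\<dots> \<le> ?m * \<beta> $ i ^ n + 2 * (?m * \<beta> $ i ^ n)"
      using \<beta>[of i] by (intro add_mono mult_left_mono mult_right_mono) auto
    finally show ?thesis using * by (simp add: ac_simps)
  qed
  have sub: "N \<subseteq> {w. \<forall>i. w $ i \<in> F i}"
  proof
    fix w assume "w \<in> N"
    then obtain s where w: "w \<in> full_words \<beta> n" "\<And>i. 0 \<le> s $ i \<and> s $ i < inverse (\<beta> $ i) ^ n" "w + s \<in> cube r"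
      by (auto simp: N_def)
    have "lo i \<le> w $ i \<and> w $ i < hi i" for i
    proof -
      have "of_int (snd r $ i) * side r \<le> w $ i + s $ i" "w $ i + s $ i < hi i"
        using w(3) by (auto simp: dyadic_cube_def hi_def)
      then show ?thesis using w(2)[of i] by (simp add: lo_def)
    qed
    then show "w \<in> {w. \<forall>i. w $ i \<in> F i}" using w(1) by (simp add: F_def full_words_def)
  qed
  have fin: "finite {w :: real ^ 'd. \<forall>i. w $ i \<in> F i}" using F by (intro card_vec_set) auto
  have "card N \<le> card {w :: real ^ 'd. \<forall>i. w $ i \<in> F i}" using fin sub by (rule card_mono)
  also have "\<dots> = (\<Prod>i\<in>UNIV. card (F i))" using F by (intro card_vec_set) auto
  finally have "real (card N) \<le> (\<Prod>i\<in>UNIV. real (card (F i)))" by (simp add: of_nat_prod[symmetric] del: of_nat_prod)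
  also have "\<dots> \<le> (\<Prod>i\<in>UNIV. 3 * max (side r) (inverse (\<beta> $ i) ^ n) * \<beta> $ i ^ n)"
    using F by (intro prod_mono) auto
  finally show ?thesis using finite_subset[OF sub fin] by simp
qed

text \<open>Mass distribution: each piece carries the Lebesgue measure of its coordinate box.\<close>

lemma net_measure_cover_pieces:
  fixes \<beta> :: "real ^ 'd" and g :: "'d \<Rightarrow> real ^ 'd"
  assumes \<beta>: "\<And>i. 1 < \<beta> $ i"
    and orth: "\<And>i j. i \<noteq> j \<Longrightarrow> g i \<bullet> g j = 0" and nz: "\<And>i. g i \<noteq> 0"
    and e: "0 < e" "2 * e \<le> real CARD('d)"
    and S: "ortho_box q g e \<subseteq> {s. \<forall>i. 0 \<le> s $ i \<and> s $ i < inverse (\<beta> $ i) ^ n}"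
    and W: "finite W" "W \<subseteq> full_words \<beta> n"
    and cov: "\<And>w. w \<in> W \<Longrightarrow> (+) w ` ortho_box q g e \<subseteq> \<Union> (cube ` I)"
    and X: "0 \<le> X" and prof: "\<And>r. r \<in> I \<Longrightarrow>
      scale_profile (\<lambda>i. inverse (\<beta> $ i) ^ n) UNIV (\<lambda>i. norm (g i)) UNIV (side r) \<le> X * side r powr t"
  shows "ennreal (real (card W) * (\<Prod>i\<in>UNIV. inverse (\<beta> $ i) ^ n) * (2 * e) ^ CARD('d)) \<le>
    ennreal ((6 * real CARD('d)) ^ CARD('d) * X) * net_weight t I"
proof -
  let ?d = "real CARD('d)" and ?b = "\<lambda>i. inverse (\<beta> $ i) ^ n"
  let ?B = "box (\<chi> i. - e) (\<chi> i. e) :: (real ^ 'd) set"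
  let ?pr = "\<lambda>r. scale_profile ?b UNIV (\<lambda>i. norm (g i)) UNIV (side r)"
  let ?mn = "\<lambda>r. \<Prod>i\<in>(UNIV :: 'd set). min 1 (side r / norm (g i))"
  \<comment> \<open>The part of the piece at \<open>w\<close> inside \<open>cube r\<close>, in
    coordinates along \<open>g\<close>.\<close>
  define V where "V w r = {v. (w + q) + combine g v \<in> cube r}" for w r
  define f where "f w r = emeasure lborel (?B \<inter> V w r)" for w r
  have meas: "V w r \<in> sets borel" for w r
  proof -
    have "(\<lambda>v. (w + q) + combine g v) \<in> borel_measurable borel"
      by (intro borel_measurable_continuous_onI continuous_intros)
    from measurable_sets[OF this sets_dyadic_cube] show ?thesis
      by (simp add: V_def vimage_def)
  qed
  have box: "emeasure lborel ?B = ennreal ((2 * e) ^ CARD('d))"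
    using e by (subst emeasure_box_cart) auto
  have "ennreal ((2 * e) ^ CARD('d)) \<le> (\<integral>\<^sup>+r. f w r \<partial>count_space I)" if w: "w \<in> W" for w
    unfolding box[symmetric] f_def
  proof (rule emeasure_le_nn_integral_cover)
    show "?B \<subseteq> \<Union> (V w ` I)"
    proof
      fix v assume "v \<in> ?B"
      then have "q + combine g v \<in> ortho_box q g e" unfolding ortho_box_eq by blast
      then have "w + (q + combine g v) \<in> \<Union> (cube ` I)" using cov[OF w] by blast
      then show "v \<in> \<Union> (V w ` I)" by (auto simp: V_def add.assoc)
    qed
  qed (use meas in auto)
  then have "(\<Sum>w\<in>W. ennreal ((2 * e) ^ CARD('d))) \<le> (\<Sum>w\<in>W. \<integral>\<^sup>+r. f w r \<partial>count_space I)"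
    by (intro sum_mono)
  also have "\<dots> = (\<integral>\<^sup>+r. (\<Sum>w\<in>W. f w r) \<partial>count_space I)"
    by (intro nn_integral_sum[symmetric]) auto
  \<comment> \<open>Each cube is met by at most \<open>3 ^ d\<close> times a product of maxima,
    rescaled by the powers of \<beta>, many pieces, and takes from each at most
    \<open>(2 * d) ^ d\<close> times a product of minima. The two products make up the profile, the
    constants \<open>(6 * d) ^ d\<close>.\<close>
  also have "\<dots> \<le> (\<integral>\<^sup>+r. ennreal ((6 * ?d) ^ CARD('d) * (\<Prod>i\<in>UNIV. \<beta> $ i ^ n) * X) * ennreal (side r powr t) \<partial>count_space I)"
  proof (intro nn_integral_mono)
    fix r assume "r \<in> space (count_space I)"
    then have r: "r \<in> I" by simp
    define N where "N = {w \<in> full_words \<beta> n. \<exists>s. (\<forall>i. 0 \<le> s $ i \<and> s $ i < ?b i) \<and> w + s \<in> cube r}"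
    have N: "finite N" "real (card N) \<le> (\<Prod>i\<in>UNIV. 3 * max (side r) (?b i) * \<beta> $ i ^ n)"
      using card_words_near_cube[OF \<beta>, of n r] by (auto simp: N_def)
    have mn: "0 \<le> ?mn r" by (intro prod_nonneg) auto
    have "f w r = 0" if w: "w \<in> W - N" for w
    proof -
      have "?B \<inter> V w r = {}"
      proof (rule ccontr)
        assume "?B \<inter> V w r \<noteq> {}"
        then obtain v where v: "v \<in> ?B" "w + (q + combine g v) \<in> cube r" by (auto simp: V_def add.assoc)
        then have "q + combine g v \<in> ortho_box q g e" unfolding ortho_box_eq by blast
        then have "\<forall>i. 0 \<le> (q + combine g v) $ i \<and> (q + combine g v) $ i < ?b i" using S by blast
        then have "w \<in> N" using v(2) w W unfolding N_def by blast
        then show False using w by simp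
      qed
      then show ?thesis by (simp add: f_def)
    qed
    then have "(\<Sum>w\<in>W. f w r) = (\<Sum>w\<in>W \<inter> N. f w r)"
      using W by (intro sum.mono_neutral_right) auto
    also have "\<dots> \<le> (\<Sum>w\<in>W \<inter> N. ennreal ((2 * ?d) ^ CARD('d) * ?mn r))"
    proof (intro sum_mono)
      fix w
      show "f w r \<le> ennreal ((2 * ?d) ^ CARD('d) * ?mn r)"
        unfolding f_def V_def
        by (rule emeasure_box_coordinates)
          (use orth nz e in \<open>auto intro!: dist_closure_dyadic_cube closure_subset[THEN subsetD]\<close>)
    qed
    also have "\<dots> = ennreal (real (card (W \<inter> N)) * ((2 * ?d) ^ CARD('d) * ?mn r))"
      using mn by (simp add: ennreal_mult'' ennreal_of_nat_eq_real_of_nat mult_nonneg_nonneg)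
    also have "\<dots> \<le> ennreal ((6 * ?d) ^ CARD('d) * (\<Prod>i\<in>UNIV. \<beta> $ i ^ n) * X * side r powr t)"
    proof (intro ennreal_leI)
      have "real (card (W \<inter> N)) \<le> real (card N)" using N by (intro of_nat_mono card_mono) auto
      then have "real (card (W \<inter> N)) \<le> (\<Prod>i\<in>UNIV. 3 * max (side r) (?b i) * \<beta> $ i ^ n)" using N by simp
      then have "real (card (W \<inter> N)) * ((2 * ?d) ^ CARD('d) * ?mn r) \<le>
          (\<Prod>i\<in>UNIV. 3 * max (side r) (?b i) * \<beta> $ i ^ n) * ((2 * ?d) ^ CARD('d) * ?mn r)"
        using mn by (intro mult_right_mono) auto
      also have "\<dots> = (3 ^ CARD('d) * (2 * ?d) ^ CARD('d)) * (\<Prod>i\<in>UNIV. \<beta> $ i ^ n) * ?pr r"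
        by (simp add: prod.distrib scale_profile_def)
      also have "3 ^ CARD('d) * (2 * ?d) ^ CARD('d) = (6 * ?d) ^ CARD('d)"
        by (subst power_mult_distrib[symmetric]) simp
      also have "(6 * ?d) ^ CARD('d) * (\<Prod>i\<in>UNIV. \<beta> $ i ^ n) * ?pr r \<le>
          (6 * ?d) ^ CARD('d) * (\<Prod>i\<in>UNIV. \<beta> $ i ^ n) * (X * side r powr t)"
        using prof[OF r] by (intro mult_left_mono mult_nonneg_nonneg prod_nonneg) (auto simp: less_imp_le[OF order.strict_trans[OF zero_less_one \<beta>]])
      finally show "real (card (W \<inter> N)) * ((2 * ?d) ^ CARD('d) * ?mn r) \<le>
          (6 * ?d) ^ CARD('d) * (\<Prod>i\<in>UNIV. \<beta> $ i ^ n) * X * side r powr t" by (simp only: mult.assoc)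
    qed
    finally show "(\<Sum>w\<in>W. f w r) \<le> ennreal ((6 * ?d) ^ CARD('d) * (\<Prod>i\<in>UNIV. \<beta> $ i ^ n) * X) * ennreal (side r powr t)"
      by (simp add: ennreal_mult'')
  qed
  also have "\<dots> = ennreal ((6 * ?d) ^ CARD('d) * (\<Prod>i\<in>UNIV. \<beta> $ i ^ n) * X) * net_weight t I"
    by (simp add: nn_integral_cmult net_weight_eq_nn_integral)
  finally have *: "ennreal (real (card W) * (2 * e) ^ CARD('d)) \<le>
      ennreal ((6 * ?d) ^ CARD('d) * (\<Prod>i\<in>UNIV. \<beta> $ i ^ n) * X) * net_weight t I"
    using e by (simp add: ennreal_mult'' ennreal_of_nat_eq_real_of_nat)
  have bp: "0 \<le> (\<Prod>i\<in>UNIV. ?b i)" by (intro prod_nonneg) (auto simp: less_imp_le[OF order.strict_trans[OF zero_less_one \<beta>]])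
  have bp': "0 \<le> (\<Prod>i\<in>UNIV. \<beta> $ i ^ n)" by (intro prod_nonneg) (auto simp: less_imp_le[OF order.strict_trans[OF zero_less_one \<beta>]])
  have one: "(\<Prod>i\<in>UNIV. ?b i) * (\<Prod>i\<in>UNIV. \<beta> $ i ^ n) = 1"
  proof -
    have "?b i * \<beta> $ i ^ n = 1" for i using \<beta>[of i] by (simp add: power_mult_distrib[symmetric])
    then show ?thesis by (simp add: prod.distrib[symmetric])
  qed
  \<comment> \<open>Multiplying by the volume of a full cylinder removes the powers of
    \<beta>.\<close>
  have "ennreal (real (card W) * (\<Prod>i\<in>UNIV. ?b i) * (2 * e) ^ CARD('d)) =
      ennreal (\<Prod>i\<in>UNIV. ?b i) * ennreal (real (card W) * (2 * e) ^ CARD('d))"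
    using bp e by (simp add: ennreal_mult[symmetric] ac_simps)
  also have "\<dots> \<le> ennreal (\<Prod>i\<in>UNIV. ?b i) *
      (ennreal ((6 * ?d) ^ CARD('d) * (\<Prod>i\<in>UNIV. \<beta> $ i ^ n) * X) * net_weight t I)"
    using * by (intro mult_left_mono) auto
  also have "\<dots> = ennreal ((\<Prod>i\<in>UNIV. ?b i) * ((6 * ?d) ^ CARD('d) * (\<Prod>i\<in>UNIV. \<beta> $ i ^ n) * X)) * net_weight t I"
    using bp bp' X by (simp add: ennreal_mult[symmetric] mult.assoc[symmetric])
  also have "(\<Prod>i\<in>UNIV. ?b i) * ((6 * ?d) ^ CARD('d) * (\<Prod>i\<in>UNIV. \<beta> $ i ^ n) * X) =
      ((\<Prod>i\<in>UNIV. ?b i) * (\<Prod>i\<in>UNIV. \<beta> $ i ^ n)) * ((6 * ?d) ^ CARD('d) * X)" by (simp only: ac_simps)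
  finally show ?thesis unfolding one by simp
qed

section \<open>Orthogonal frames of the contracted parallelepipeds\<close>

abbreviation total_contraction :: "real ^ 'd \<Rightarrow> nat \<Rightarrow> real" where
  "total_contraction \<beta> n \<equiv> (\<Sum>i\<in>UNIV. inverse (\<beta> $ i) ^ n)"

text \<open>The half-width found in \<open>ortho_box_in_parallelepiped\<close>; the
  \<open>itself\<close> argument carries the dimension.\<close>

definition box_ratio :: "'d itself \<Rightarrow> real" where "box_ratio _ = 1 / 2 ^ (CARD('d) + 1)"

lemma box_ratio: "0 < box_ratio TYPE('d::finite)" "2 * box_ratio TYPE('d) \<le> real CARD('d)"
proof -
  show "0 < box_ratio TYPE('d)" by (simp add: box_ratio_def)
  have "2 * box_ratio TYPE('d) \<le> 1" by (simp add: box_ratio_def)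
  also have "1 \<le> real CARD('d)" by (simp add: Suc_leI)
  finally show "2 * box_ratio TYPE('d) \<le> real CARD('d)" .
qed

text \<open>What both bounds use about the parallelepiped of order \<open>n\<close>, with the
  vectors indexed by edges through \<kappa>. The bound \<open>norm_le\<close> makes all scales tend
  to 0 as \<open>n\<close> grows.\<close>

locale greedy_frame =
  fixes \<beta> :: "real ^ 'd" and n :: nat and P :: "(real ^ 'd) set" and \<gamma> :: "nat \<Rightarrow> real ^ 'd"
    and \<kappa> :: "'d \<Rightarrow> nat" and u :: "'d \<Rightarrow> 'd \<Rightarrow> real" and a :: "'d \<Rightarrow> real ^ 'd" and q :: "real ^ 'd"
  assumes \<beta>: "1 < \<beta> $ i"
    and bij: "bij_betw \<kappa> UNIV {1..CARD('d)}"
    and orth: "i \<noteq> j \<Longrightarrow> \<gamma> (\<kappa> i) \<bullet> \<gamma> (\<kappa> j) = 0"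
    and nz: "\<gamma> (\<kappa> i) \<noteq> 0"
    and norm_le: "norm (\<gamma> (\<kappa> i)) \<le> total_contraction \<beta> n"
    and dec: "a i = (\<Sum>j\<in>UNIV. u j i *\<^sub>R \<gamma> (\<kappa> j))"
    and u_le: "\<bar>u i j\<bar> \<le> 1" and u_diag: "u i i = 1" and u_tri: "\<kappa> j < \<kappa> i \<Longrightarrow> u i j = 0"
    and image: "(contraction \<beta> ^^ n) ` P = {q + (\<Sum>j\<in>UNIV. c j *\<^sub>R a j) | c. \<forall>j. 0 \<le> c j \<and> c j \<le> 1}"

lemma ex_greedy_frame:
  fixes \<beta> :: "real ^ 'd" and \<gamma> :: "nat \<Rightarrow> real ^ 'd" and \<alpha> :: "'d \<Rightarrow> real ^ 'd"
  assumes \<beta>: "\<And>i. 1 < \<beta> $ i" and par: "parallelepiped_with_edges \<alpha> P" and P: "P \<subseteq> half_open_unit_cube"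
    and gs: "greedy_gram_schmidt (\<lambda>j. (contraction \<beta> ^^ n) (\<alpha> j)) \<gamma>"
  shows "\<exists>\<kappa> u a q. greedy_frame \<beta> n P \<gamma> \<kappa> u a q"
proof -
  let ?f = "contraction \<beta> ^^ n"
  define a where "a = (\<lambda>j. ?f (\<alpha> j))"
  have f: "?f v = (\<chi> i. inverse (\<beta> $ i) ^ n * v $ i)" for v by (rule funpow_contraction)
  have lin: "linear ?f" by (intro linearI) (simp_all add: f vec_eq_iff algebra_simps)
  have injf: "inj ?f"
  proof (rule injI)
    fix v w assume "?f v = ?f w"
    then have "inverse (\<beta> $ i) ^ n * v $ i = inverse (\<beta> $ i) ^ n * w $ i" for i by (simp add: f vec_eq_iff)
    then have "v $ i = w $ i" for i using \<beta>[of i] by (metis inverse_nonzero_iff_nonzero less_irrefl mult_left_cancel order.strict_trans power_not_zero zero_less_one)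
    then show "v = w" by (simp add: vec_eq_iff)
  qed
  obtain p where p: "inj \<alpha>" "independent (range \<alpha>)"
    "P = {p + (\<Sum>j\<in>UNIV. c j *\<^sub>R \<alpha> j) | c. \<forall>j. 0 \<le> c j \<and> c j \<le> 1}"
    using par unfolding parallelepiped_with_edges_def by blast
  have inja: "inj a" unfolding a_def using p(1) injf by (auto simp: inj_def)
  have inda: "independent (range a)"
  proof -
    have "independent (?f ` range \<alpha>)"
      using lin p(2) injf by (intro linear_independent_injective_image) (auto intro: inj_on_subset)
    then show ?thesis by (simp add: a_def image_image)
  qed
  have "greedy_gram_schmidt a \<gamma>" using gs by (simp add: a_def)
  from greedy_gram_schmidt_decomp[OF this inja inda] obtain \<kappa> u where \<kappa>: "bij_betw \<kappa> UNIV {1..CARD('d)}"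
    "\<And>i j. i \<noteq> j \<Longrightarrow> \<gamma> (\<kappa> i) \<bullet> \<gamma> (\<kappa> j) = 0"
    "\<And>i. \<gamma> (\<kappa> i) \<noteq> 0"
    "\<And>i. norm (\<gamma> (\<kappa> i)) \<le> norm (a i)"
    "\<And>i. a i = (\<Sum>j\<in>UNIV. u j i *\<^sub>R \<gamma> (\<kappa> j))"
    "\<And>i j. \<bar>u i j\<bar> \<le> 1" "\<And>i. u i i = 1" "\<And>i j. \<kappa> j < \<kappa> i \<Longrightarrow> u i j = 0"
    by blast
  have img: "?f ` P = {?f p + (\<Sum>j\<in>UNIV. c j *\<^sub>R a j) | c. \<forall>j. 0 \<le> c j \<and> c j \<le> 1}"
  proof -
    have "?f (p + (\<Sum>j\<in>UNIV. c j *\<^sub>R \<alpha> j)) = ?f p + (\<Sum>j\<in>UNIV. c j *\<^sub>R a j)" for c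
      by (simp add: a_def linear_add[OF lin] linear_sum[OF lin] linear_scale[OF lin])
    then show ?thesis unfolding p(3) setcompr_eq_image image_image by simp
  qed
  \<comment> \<open>A corner \<open>p\<close> and its neighbour \<open>p + \<alpha> j\<close> both
    lie in the unit cube, so the coordinates of an edge are at most 1 in modulus before
    contraction.\<close>
  have na: "norm (a j) \<le> total_contraction \<beta> n" for j
  proof -
    have "p + (\<Sum>l\<in>UNIV. (0::real) *\<^sub>R \<alpha> l) \<in> P"
      unfolding p(3) by (intro CollectI exI[of _ "\<lambda>l. 0"]) auto
    then have p1: "p \<in> half_open_unit_cube" using P by auto
    have "p + (\<Sum>l\<in>UNIV. (if l = j then 1 else 0) *\<^sub>R \<alpha> l) \<in> P"
      unfolding p(3) by (intro CollectI exI[of _ "\<lambda>l. if l = j then 1 else 0"]) auto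
    then have p2: "p + \<alpha> j \<in> half_open_unit_cube" using P by (auto simp: if_distrib[of "\<lambda>c. c *\<^sub>R _"] cong: if_cong)
    have "\<bar>a j $ i\<bar> \<le> inverse (\<beta> $ i) ^ n" for i
    proof -
      have "0 \<le> p $ i" "p $ i < 1" "0 \<le> p $ i + \<alpha> j $ i" "p $ i + \<alpha> j $ i < 1"
        using p1 p2 by (auto simp: half_open_unit_cube_def)
      then have "\<bar>\<alpha> j $ i\<bar> \<le> 1" by linarith
      moreover have "0 \<le> inverse (\<beta> $ i) ^ n" using \<beta>[of i] by simp
      ultimately have "inverse (\<beta> $ i) ^ n * \<bar>\<alpha> j $ i\<bar> \<le> inverse (\<beta> $ i) ^ n * 1" by (intro mult_left_mono)
      then show ?thesis using \<open>0 \<le> inverse (\<beta> $ i) ^ n\<close> by (simp add: a_def f abs_mult)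
    qed
    then have "(\<Sum>i\<in>UNIV. \<bar>a j $ i\<bar>) \<le> total_contraction \<beta> n" by (intro sum_mono)
    then show ?thesis using norm_le_l1_cart[of "a j"] by linarith
  qed
  have "greedy_frame \<beta> n P \<gamma> \<kappa> u a (?f p)"
    using \<beta> \<kappa>(1-3,5-8) order.trans[OF \<kappa>(4) na] img by unfold_locales
  then show ?thesis by blast
qed

context greedy_frame
begin

lemma scale_bounds:
  assumes s: "s \<in> scales \<beta> n \<gamma>"
  shows "0 < s" "s \<le> total_contraction \<beta> n"
proof -
  have b: "0 < inverse (\<beta> $ i) ^ n" for i using \<beta>[of i] by simp
  have le: "inverse (\<beta> $ i) ^ n \<le> total_contraction \<beta> n" for i
    using member_le_sum[of i UNIV "\<lambda>i. inverse (\<beta> $ i) ^ n"] b by (simp add: less_imp_le)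
  have ex: "\<exists>i. k = \<kappa> i" if "k \<in> {1..CARD('d)}" for k
    using bij that by (metis bij_betw_imp_surj_on imageE)
  consider i where "s = inverse (\<beta> $ i) ^ n" | i where "s = norm (\<gamma> (\<kappa> i))"
    using s ex unfolding scales_def by blast
  then have "0 < s \<and> s \<le> total_contraction \<beta> n"
    using b le nz norm_le by cases simp_all
  then show "0 < s" "s \<le> total_contraction \<beta> n" by blast+
qed

lemma norm_gamma_pos: "k \<in> {1..CARD('d)} \<Longrightarrow> 0 < norm (\<gamma> k)"
  by (rule scale_bounds(1)) (simp add: scales_def)

lemma scales_eq: "scales \<beta> n \<gamma> = range (\<lambda>i. inverse (\<beta> $ i) ^ n) \<union> range (\<lambda>i. norm (\<gamma> (\<kappa> i)))"
proof -
  have "(\<lambda>k. norm (\<gamma> k)) ` {1..CARD('d)} = (\<lambda>k. norm (\<gamma> k)) ` range \<kappa>"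
    using bij_betw_imp_surj_on[OF bij] by simp
  then show ?thesis unfolding scales_def by (simp only: image_image)
qed

lemma profile_eq:
  "scale_profile (\<lambda>i. inverse (\<beta> $ i) ^ n) UNIV (\<lambda>i. norm (\<gamma> (\<kappa> i))) UNIV r = profile \<beta> n \<gamma> r"
  unfolding scale_profile_def
  using prod.reindex_bij_betw[OF bij, of "\<lambda>k. min 1 (r / norm (\<gamma> k))"] by simp

lemma ex_ortho_box:
  "\<exists>q'. ortho_box q' (\<lambda>i. \<gamma> (\<kappa> i)) (box_ratio TYPE('d)) \<subseteq> (contraction \<beta> ^^ n) ` P"
proof -
  have "inj \<kappa>" "\<And>i. \<kappa> i \<le> CARD('d)" using bij by (auto simp: bij_betw_def)
  from ortho_box_in_parallelepiped[OF this dec u_le u_diag u_tri]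
  show ?thesis unfolding image box_ratio_def by blast
qed

end

lemma total_contraction_tendsto_0:
  fixes \<beta> :: "real ^ 'd"
  assumes \<beta>: "\<And>i. 1 < \<beta> $ i"
  shows "(\<lambda>n. total_contraction \<beta> n) \<longlonglongrightarrow> 0"
proof -
  have "(\<lambda>n. inverse (\<beta> $ i) ^ n) \<longlonglongrightarrow> 0" for i
    using \<beta>[of i] by (intro LIMSEQ_power_zero) (auto simp: inverse_less_1_iff)
  then have "(\<lambda>n. total_contraction \<beta> n) \<longlonglongrightarrow> (\<Sum>i\<in>(UNIV::'d set). 0)" by (intro tendsto_sum)
  then show ?thesis by simp
qed

lemma dyadic_cube_in_unit_cube:
  assumes "dyadic_cube m k \<subseteq> unit_cube"
  shows "0 \<le> of_int (k $ i) * dyadic_side m" "(of_int (k $ i) + 1) * dyadic_side m \<le> 1"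
proof -
  let ?lo = "\<lambda>j. of_int (k $ j) * dyadic_side m" and ?hi = "(of_int (k $ i) + 1) * dyadic_side m"
  have "(\<chi> j. ?lo j) \<in> dyadic_cube m k" by (simp add: dyadic_cube_def algebra_simps)
  then show "0 \<le> ?lo i" using assms by (auto simp: unit_cube_def)
  show "?hi \<le> 1"
  proof (rule ccontr)
    assume c: "\<not> ?hi \<le> 1"
    \<comment> \<open>A point of the half-open cube whose \<open>i\<close>th coordinate lies beyond
      1 though below the excluded upper end.\<close>
    define x where "x = (\<chi> j. if j = i then max (?lo i) ((1 + ?hi) / 2) else ?lo j)"
    have "x \<in> dyadic_cube m k" using c by (auto simp: x_def dyadic_cube_def algebra_simps)
    then have "x $ i \<le> 1" using assms by (auto simp: unit_cube_def)
    then show False using c by (simp add: x_def)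
  qed
qed

lemma ennreal_le_mult_divideI:
  assumes "ennreal A \<le> ennreal B * x" "0 < B" "0 \<le> A"
  shows "ennreal (A / B) \<le> x"
proof -
  have "ennreal (A / B) = ennreal (1 / B) * ennreal A" using assms by (simp add: ennreal_mult[symmetric])
  also have "\<dots> \<le> ennreal (1 / B) * (ennreal B * x)" using assms by (intro mult_left_mono) auto
  also have "\<dots> = x" using assms by (simp add: mult.assoc[symmetric] ennreal_mult[symmetric])
  finally show ?thesis .
qed

text \<open>A product of one-dimensional counts. The constant is the same for all cubes
  \<open>D\<close>; the order from which the estimate holds depends on \<open>D\<close>.\<close>

lemma card_words_in_cube:
  fixes \<beta> :: "real ^ 'd"
  assumes \<beta>: "\<And>i. 1 < \<beta> $ i"
  obtains c where "0 < c" "\<And>D. cube D \<subseteq> unit_cube \<Longrightarrow> eventually (\<lambda>n. \<exists>W. finite W \<and> W \<subseteq> full_words \<beta> n \<and>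
      (\<forall>w\<in>W. \<forall>s. (\<forall>i. 0 \<le> s $ i \<and> s $ i < inverse (\<beta> $ i) ^ n) \<longrightarrow> w + s \<in> interior (cube D)) \<and>
      c * side D ^ CARD('d) \<le> real (card W) * (\<Prod>i\<in>UNIV. inverse (\<beta> $ i) ^ n)) sequentially"
proof -
  have "\<forall>i. \<exists>e>0. \<forall>a c. 0 \<le> a \<longrightarrow> a < c \<longrightarrow> c \<le> 1 \<longrightarrow>
      eventually (\<lambda>n. e * (c - a) * \<beta> $ i ^ n \<le>
        real (card {l \<in> full_ends (\<beta> $ i) n. a < l \<and> l + 1 / \<beta> $ i ^ n < c})) sequentially"
    by (intro allI full_ends_card_lower \<beta>)
  from choice[OF this] obtain e where e: "\<And>i. 0 < e i" "\<And>i a c. 0 \<le> a \<Longrightarrow> a < c \<Longrightarrow> c \<le> 1 \<Longrightarrow>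
      eventually (\<lambda>n. e i * (c - a) * \<beta> $ i ^ n \<le>
        real (card {l \<in> full_ends (\<beta> $ i) n. a < l \<and> l + 1 / \<beta> $ i ^ n < c})) sequentially"
    by auto
  show thesis
  proof (rule that[of "\<Prod>i\<in>UNIV. e i"])
    show "0 < (\<Prod>i\<in>UNIV. e i)" using e(1) by (intro prod_pos) auto
    fix D :: "int \<times> (int ^ 'd)" assume D: "cube D \<subseteq> unit_cube"
    let ?lo = "\<lambda>i. of_int (snd D $ i) * side D" and ?hi = "\<lambda>i. (of_int (snd D $ i) + 1) * side D"
    have lohi: "0 \<le> ?lo i" "?hi i \<le> 1" "?lo i < ?hi i" "?hi i - ?lo i = side D" for i
      using dyadic_cube_in_unit_cube[OF D] by (simp_all add: algebra_simps)
    have "eventually (\<lambda>n. \<forall>i. e i * (?hi i - ?lo i) * \<beta> $ i ^ n \<le>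
        real (card {l \<in> full_ends (\<beta> $ i) n. ?lo i < l \<and> l + 1 / \<beta> $ i ^ n < ?hi i})) sequentially"
      using e(2)[OF lohi(1,3,2)] by (simp add: eventually_all_finite)
    then show "eventually (\<lambda>n. \<exists>W. finite W \<and> W \<subseteq> full_words \<beta> n \<and>
      (\<forall>w\<in>W. \<forall>s. (\<forall>i. 0 \<le> s $ i \<and> s $ i < inverse (\<beta> $ i) ^ n) \<longrightarrow> w + s \<in> interior (cube D)) \<and>
      (\<Prod>i\<in>UNIV. e i) * side D ^ CARD('d) \<le> real (card W) * (\<Prod>i\<in>UNIV. inverse (\<beta> $ i) ^ n)) sequentially"
    proof eventually_elim
      case (elim n)
      define F where "F i = {l \<in> full_ends (\<beta> $ i) n. ?lo i < l \<and> l + 1 / \<beta> $ i ^ n < ?hi i}" for i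
      define W where "W = {w :: real ^ 'd. \<forall>i. w $ i \<in> F i}"
      have finF: "finite (F i)" for i
      proof (rule finite_subset)
        show "F i \<subseteq> left_ends (\<beta> $ i) n" using full_ends_subset by (auto simp: F_def)
      qed (rule left_ends_card_upper(1)[OF \<beta>])
      have b: "inverse (\<beta> $ i) ^ n = 1 / \<beta> $ i ^ n" "0 < \<beta> $ i ^ n" for i
        using \<beta>[of i] by (simp_all add: inverse_eq_divide power_one_over)
      have "(\<Prod>i\<in>UNIV. e i) * side D ^ CARD('d) = (\<Prod>i\<in>(UNIV::'d set). e i * side D)"
        by (simp add: prod.distrib)
      also have "\<dots> \<le> (\<Prod>i\<in>UNIV. real (card (F i)) * inverse (\<beta> $ i) ^ n)"
      proof (intro prod_mono conjI)
        fix i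
        show "0 \<le> e i * side D" using e(1)[of i] by simp
        have "e i * side D * \<beta> $ i ^ n \<le> real (card (F i))"
          using elim[rule_format, of i] lohi(4)[of i] by (simp add: F_def)
        then show "e i * side D \<le> real (card (F i)) * inverse (\<beta> $ i) ^ n"
          using b[of i] by (simp add: pos_le_divide_eq)
      qed
      also have "\<dots> = real (card W) * (\<Prod>i\<in>UNIV. inverse (\<beta> $ i) ^ n)"
        unfolding W_def using card_vec_set(2)[of F] finF by (simp add: prod.distrib)
      finally have cardW: "(\<Prod>i\<in>UNIV. e i) * side D ^ CARD('d) \<le> real (card W) * (\<Prod>i\<in>UNIV. inverse (\<beta> $ i) ^ n)" .
      have "w + s \<in> interior (cube D)" if w: "w \<in> W" and s: "\<forall>i. 0 \<le> s $ i \<and> s $ i < inverse (\<beta> $ i) ^ n" for w s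
      proof -
        have "?lo i < (w + s) $ i \<and> (w + s) $ i < ?hi i" for i
        proof -
          have "?lo i < w $ i" "w $ i + 1 / \<beta> $ i ^ n < ?hi i" using w by (auto simp: W_def F_def)
          then show ?thesis using s[rule_format, of i] b(1)[of i] by simp
        qed
        then show ?thesis by (simp add: interior_dyadic_cube)
      qed
      moreover have "finite W" unfolding W_def using finF by (rule card_vec_set)
      moreover have "W \<subseteq> full_words \<beta> n" by (auto simp: W_def F_def full_words_def)
      ultimately show ?case using cardW by blast
    qed
  qed
qed

text \<open>Filling takes two rounds: \<open>part\<close> reaches a fixed proportion of the content
  of any cube from the pieces of a single order, and \<open>full\<close> applies this to all
  subcubes of a fine level to remove the constant.\<close>

lemma large_intersection_subset_W:
  fixes \<beta> :: "real ^ 'd"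
  assumes \<beta>: "\<And>i. \<beta> $ i > 1"
    and par: "\<And>n. n \<ge> 1 \<Longrightarrow> parallelepiped_with_edges (\<alpha> n) (P n)"
    and P: "\<And>n. n \<ge> 1 \<Longrightarrow> P n \<subseteq> half_open_unit_cube"
    and gs: "\<And>n. n \<ge> 1 \<Longrightarrow> greedy_gram_schmidt (\<lambda>j. (contraction \<beta> ^^ n) (\<alpha> n j)) (\<gamma> n)"
  shows "\<exists>F\<in>large_intersection_class (s_star \<beta> \<gamma>). F \<subseteq> W_set \<beta> P"
proof -
  let ?d = "real CARD('d)" and ?e = "box_ratio TYPE('d)" and ?\<eta> = "total_contraction \<beta>"
  let ?b = "\<lambda>n i. inverse (\<beta> $ i) ^ n"
  have "\<forall>n. \<exists>\<kappa> u a q. 1 \<le> n \<longrightarrow> greedy_frame \<beta> n (P n) (\<gamma> n) \<kappa> u a q"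
    using ex_greedy_frame[OF \<beta> par P gs] by blast
  then obtain \<kappa> u a q0 where fr: "\<And>n. 1 \<le> n \<Longrightarrow> greedy_frame \<beta> n (P n) (\<gamma> n) (\<kappa> n) (u n) (a n) (q0 n)"
    by metis
  have "\<forall>n. \<exists>q. 1 \<le> n \<longrightarrow> ortho_box q (\<lambda>i. \<gamma> n (\<kappa> n i)) ?e \<subseteq> (contraction \<beta> ^^ n) ` P n"
    using greedy_frame.ex_ortho_box[OF fr] by blast
  then obtain q where ob: "\<And>n. 1 \<le> n \<Longrightarrow> ortho_box (q n) (\<lambda>i. \<gamma> n (\<kappa> n i)) ?e \<subseteq> (contraction \<beta> ^^ n) ` P n"
    by metis
  note orth = greedy_frame.orth[OF fr] and nz = greedy_frame.nz[OF fr]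
  define S where "S n = ortho_box (q n) (\<lambda>i. \<gamma> n (\<kappa> n i)) ?e" for n
  \<comment> \<open>Orders start at 1 because nothing is assumed about \<open>P 0\<close>.\<close>
  define V where "V k = (\<Union>n\<in>{max 1 k..}. \<Union>w\<in>full_words \<beta> n. (+) w ` S n)" for k
  have S_sub: "\<exists>y\<in>P n. s = (contraction \<beta> ^^ n) y" if "1 \<le> n" "s \<in> S n" for n s
    using ob[OF that(1)] that(2) by (auto simp: S_def)
  have S_rng: "0 \<le> s $ i \<and> s $ i < ?b n i" if n: "1 \<le> n" "s \<in> S n" for n s i
  proof -
    obtain y where y: "y \<in> P n" "s = (contraction \<beta> ^^ n) y" using S_sub[OF n] by blast
    then have "0 \<le> y $ i" "y $ i < 1" using P[OF n(1)] by (auto simp: half_open_unit_cube_def)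
    moreover have "0 < ?b n i" using \<beta>[of i] by simp
    ultimately show ?thesis using mult_strict_left_mono[of "y $ i" 1 "?b n i"] y(2) by (simp add: funpow_contraction)
  qed
  have openV: "open (V k)" for k
    unfolding V_def S_def
    by (intro open_UN ballI open_translation open_ortho_box) (use orth nz in auto)
  have hit: "x \<in> half_open_unit_cube \<and> (beta_prod \<beta> ^^ n) x \<in> P n"
    if n: "1 \<le> n" and w: "w \<in> full_words \<beta> n" and x: "x \<in> (+) w ` S n" for n w x
  proof -
    obtain s where s: "s \<in> S n" "x = w + s" using x by blast
    obtain y where y: "y \<in> P n" "s = (contraction \<beta> ^^ n) y" using S_sub[OF n s(1)] by blast
    have "\<beta> $ i ^ n * (inverse (\<beta> $ i) ^ n * y $ i) = y $ i" for i
      using \<beta>[of i] by (simp add: mult.assoc[symmetric] power_mult_distrib[symmetric])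
    then have "(\<chi> i. \<beta> $ i ^ n * s $ i) = y" by (simp add: y(2) funpow_contraction vec_eq_iff)
    then show ?thesis
      using full_word_add[OF \<beta> w, of s] S_rng[OF n s(1)] s(2) y(1) by simp
  qed
  have F_sub: "(\<Inter>k. V k) \<subseteq> W_set \<beta> P"
  proof
    fix x assume x: "x \<in> (\<Inter>k. V k)"
    have ex: "\<exists>n\<ge>k. 1 \<le> n \<and> x \<in> half_open_unit_cube \<and> (beta_prod \<beta> ^^ n) x \<in> P n" for k
    proof -
      have "x \<in> V k" using x by blast
      then obtain n w where "max 1 k \<le> n" "w \<in> full_words \<beta> n" "x \<in> (+) w ` S n" unfolding V_def by auto
      then show ?thesis using hit[of n w x] by auto
    qed
    then show "x \<in> W_set \<beta> P" unfolding W_set_def INFM_nat_le using ex by blast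
  qed
  obtain c0 where c0: "0 < c0" "\<And>D. cube D \<subseteq> unit_cube \<Longrightarrow> eventually (\<lambda>n. \<exists>W. finite W \<and> W \<subseteq> full_words \<beta> n \<and>
      (\<forall>w\<in>W. \<forall>s. (\<forall>i. 0 \<le> s $ i \<and> s $ i < ?b n i) \<longrightarrow> w + s \<in> interior (cube D)) \<and>
      c0 * side D ^ CARD('d) \<le> real (card W) * (\<Prod>i\<in>UNIV. ?b n i)) sequentially"
    using card_words_in_cube[OF \<beta>] by blast
  have dpos: "0 < ?d" by simp
  \<comment> \<open>The ratio of the total mass to the constant in
    \<open>net_measure_cover_pieces\<close>, capped at 1 for the case that one member of a cover
    contains the whole cube.\<close>
  define c where "c = min 1 (c0 * (2 * ?e) ^ CARD('d) / (6 * ?d) ^ CARD('d))"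
  have c: "0 < c" "c \<le> 1" using c0(1) box_ratio(1)[where 'd = 'd] by (auto simp: c_def)
  have full: "ennreal (side p powr t) \<le> dyadic_content t (V k \<inter> interior (cube p))"
    if t: "0 < t" "ereal t < s_star \<beta> \<gamma>" and p: "cube p \<subseteq> unit_cube" for t k p
  proof -
    obtain t' where t': "ereal t < ereal t'" "ereal t' < s_star \<beta> \<gamma>"
      using ereal_dense2[OF t(2)] by blast
    have freq: "\<exists>\<^sub>F n in sequentially. t' < s_num \<beta> n (\<gamma> n)"
    proof (rule ccontr)
      assume "\<not> ?thesis"
      then have "eventually (\<lambda>n. ereal (s_num \<beta> n (\<gamma> n)) \<le> ereal t') sequentially"
        by (simp add: not_frequently not_less)
      then have "s_star \<beta> \<gamma> \<le> ereal t'" unfolding s_star_def by (rule Limsup_bounded)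
      then show False using t'(2) by simp
    qed
    have small: "eventually (\<lambda>n. ?\<eta> n < \<epsilon>) sequentially" if "0 < \<epsilon>" for \<epsilon>
      using order_tendstoD(2)[OF total_contraction_tendsto_0[OF \<beta>] that] .
    have sc: "0 < s \<and> s \<le> ?\<eta> n" if "1 \<le> n" "s \<in> scales \<beta> n (\<gamma> n)" for n s
      using greedy_frame.scale_bounds[OF fr[OF that(1)] that(2)] by blast
    \<comment> \<open>\<open>s_num\<close> exceeds \<open>t'\<close> infinitely often and is at most
      the dimension once all scales are below 1.\<close>
    have t'd: "t' \<le> ?d"
    proof -
      have "\<exists>\<^sub>F n in sequentially. (?\<eta> n < 1 \<and> 1 \<le> n) \<and> t' < s_num \<beta> n (\<gamma> n)"
        by (intro frequently_eventually_conj[OF freq] eventually_conj small eventually_ge_at_top zero_less_one)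
      then obtain n where n: "t' < s_num \<beta> n (\<gamma> n)" "?\<eta> n < 1" "1 \<le> n" using frequently_ex by blast
      have "s_num \<beta> n (\<gamma> n) \<le> ?d" using sc[OF n(3)] n(2) by (intro s_num_le_CARD) force
      then show ?thesis using n(1) by simp
    qed
    have part: "ennreal (c * side D powr t) \<le> dyadic_content t (V k \<inter> interior (cube D))"
      if D: "cube D \<subseteq> unit_cube" for D :: "int \<times> (int ^ 'd)"
    proof (rule dyadic_content_geI)
      fix I assume I: "V k \<inter> interior (cube D) \<subseteq> \<Union> (cube ` I)"
      show "ennreal (c * side D powr t) \<le> net_weight t I"
      proof (cases "\<exists>r\<in>I. cube D \<subseteq> cube r")
        case True
        then obtain r where r: "r \<in> I" "cube D \<subseteq> cube r" by blast
        have "c * side D powr t \<le> 1 * side r powr t"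
          using cube_subset_imp_side_le[OF r(2)] t c by (intro mult_mono powr_mono2) auto
        then have "ennreal (c * side D powr t) \<le> ennreal (side r powr t)" by (simp add: ennreal_leI)
        also have "\<dots> \<le> net_weight t I" by (rule net_weight_ge[OF r(1)])
        finally show ?thesis .
      next
        case False
        \<comment> \<open>Scales below this \<epsilon> satisfy the smallness condition of
          \<open>scale_profile_le\<close> with \<open>R = side D\<close>; the cap at 1 keeps them in
          the range where logarithms to their base behave.\<close>
        define \<epsilon> where "\<epsilon> = min 1 ((side D powr (?d - t)) powr (1 / (t' - t)))"
        have \<epsilon>: "0 < \<epsilon>" "\<epsilon> \<le> 1" by (auto simp: \<epsilon>_def)
        have \<epsilon>2: "\<epsilon> powr (t' - t) \<le> side D powr (?d - t)"
        proof -
          have "\<epsilon> powr (t' - t) \<le> ((side D powr (?d - t)) powr (1 / (t' - t))) powr (t' - t)"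
            using \<epsilon> t' by (intro powr_mono2) (auto simp: \<epsilon>_def)
          also have "\<dots> = side D powr (?d - t)" using t' by (simp add: powr_powr)
          finally show ?thesis .
        qed
        have "eventually (\<lambda>n. (?\<eta> n < \<epsilon> \<and> max 1 k \<le> n) \<and> (\<exists>W. finite W \<and> W \<subseteq> full_words \<beta> n \<and>
            (\<forall>w\<in>W. \<forall>s. (\<forall>i. 0 \<le> s $ i \<and> s $ i < ?b n i) \<longrightarrow> w + s \<in> interior (cube D)) \<and>
            c0 * side D ^ CARD('d) \<le> real (card W) * (\<Prod>i\<in>UNIV. ?b n i))) sequentially"
          by (intro eventually_conj small \<epsilon> eventually_ge_at_top c0 D)
        from frequently_ex[OF frequently_eventually_conj[OF freq this]]
        obtain n W where n: "t' < s_num \<beta> n (\<gamma> n)" "?\<eta> n < \<epsilon>" "1 \<le> n" "k \<le> n"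
          and W: "finite W" "W \<subseteq> full_words \<beta> n"
            "\<And>w s. w \<in> W \<Longrightarrow> (\<forall>i. 0 \<le> s $ i \<and> s $ i < ?b n i) \<Longrightarrow> w + s \<in> interior (cube D)"
            "c0 * side D ^ CARD('d) \<le> real (card W) * (\<Prod>i\<in>UNIV. ?b n i)" by auto
        \<comment> \<open>A member of \<open>I\<close> meeting the interior of \<open>D\<close> is
          nested with \<open>D\<close>. As none contains \<open>D\<close>, all of them lie in
          \<open>D\<close>, so the pieces are covered by \<open>?J\<close> and the profile is used
          for sides up to \<open>side D\<close>.\<close>
        let ?g = "\<lambda>i. \<gamma> n (\<kappa> n i)" and ?J = "{r \<in> I. cube r \<subseteq> cube D}"
        let ?X = "side D powr (?d - t)"
        have eqs: "scales \<beta> n (\<gamma> n) = ?b n ` UNIV \<union> (\<lambda>i. norm (?g i)) ` UNIV"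
          by (rule greedy_frame.scales_eq[OF fr[OF n(3)]])
        have prof: "scale_profile (?b n) UNIV (\<lambda>i. norm (?g i)) UNIV (side r) \<le> ?X * side r powr t"
          if r: "r \<in> ?J" for r
        proof -
          have "scale_profile (?b n) UNIV (\<lambda>i. norm (?g i)) UNIV (side r) \<le>
              side r powr t * side D powr (real (card (UNIV :: 'd set)) - t)"
          proof (rule scale_profile_le)
            show "t < t'" using t' by simp
            show "t' \<le> real (card (UNIV :: 'd set))" using t'd by simp
            show "\<epsilon> powr (t' - t) \<le> side D powr (real (card (UNIV :: 'd set)) - t)" using \<epsilon>2 by simp
            show "side r \<le> side D" using r by (intro cube_subset_imp_side_le) auto
            fix s assume s: "s \<in> ?b n ` UNIV \<union> (\<lambda>i. norm (?g i)) ` UNIV"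
            then have sc': "s \<in> scales \<beta> n (\<gamma> n)" unfolding eqs .
            then have s01: "0 < s" "s \<le> ?\<eta> n" using sc[OF n(3)] by auto
            then show "0 < s" "s \<le> \<epsilon>" using n(2) by auto
            have "scale_profile (?b n) UNIV (\<lambda>i. norm (?g i)) UNIV s = s powr scale_value \<beta> n (\<gamma> n) s"
              using s01 n(2) \<epsilon> unfolding greedy_frame.profile_eq[OF fr[OF n(3)]]
              by (intro profile_eq_powr_scale_value \<beta> greedy_frame.norm_gamma_pos[OF fr[OF n(3)]]) auto
            also have "\<dots> \<le> s powr t'"
              using s_num_le[OF sc'] n(1,2) s01 \<epsilon> by (intro powr_mono') auto
            finally show "scale_profile (?b n) UNIV (\<lambda>i. norm (?g i)) UNIV s \<le> s powr t'" .
          qed auto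
          then show ?thesis by (simp add: mult.commute)
        qed
        have cov: "(+) w ` S n \<subseteq> \<Union> (cube ` ?J)" if w: "w \<in> W" for w
        proof
          fix x assume x: "x \<in> (+) w ` S n"
          have "w \<in> full_words \<beta> n" "n \<in> {max 1 k..}" using w W(2) n(3,4) by auto
          then have xV: "x \<in> V k" using x unfolding V_def by blast
          have xD: "x \<in> interior (cube D)" using x W(3)[OF w] S_rng[OF n(3)] by auto
          then obtain r where r: "r \<in> I" "x \<in> cube r" using I xV by blast
          have "x \<in> cube D" using xD interior_subset by blast
          then have "cube r \<subseteq> cube D" using cube_nested' r False by blast
          then show "x \<in> \<Union> (cube ` ?J)" using r by blast
        qed
        have "ennreal (c0 * side D ^ CARD('d) * (2 * ?e) ^ CARD('d)) \<le>
            ennreal (real (card W) * (\<Prod>i\<in>UNIV. ?b n i) * (2 * ?e) ^ CARD('d))"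
          using W(4) box_ratio(1)[where 'd = 'd] by (intro ennreal_leI mult_right_mono) auto
        also have "\<dots> \<le> ennreal ((6 * ?d) ^ CARD('d) * ?X) * net_weight t ?J"
        proof (rule net_measure_cover_pieces)
          show "ortho_box (q n) ?g ?e \<subseteq> {s. \<forall>i. 0 \<le> s $ i \<and> s $ i < ?b n i}"
            using S_rng[OF n(3)] by (auto simp: S_def)
          show "(+) w ` ortho_box (q n) ?g ?e \<subseteq> \<Union> (cube ` ?J)" if "w \<in> W" for w
            using cov[OF that] by (simp add: S_def)
        qed (use \<beta> orth[OF n(3)] nz[OF n(3)] box_ratio[where 'd = 'd] W prof in auto)
        finally have "ennreal (c0 * side D ^ CARD('d) * (2 * ?e) ^ CARD('d) / ((6 * ?d) ^ CARD('d) * ?X)) \<le>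
            net_weight t ?J"
          using c0(1) box_ratio(1)[where 'd = 'd] by (intro ennreal_le_mult_divideI) auto
        moreover have "c * side D powr t \<le> c0 * side D ^ CARD('d) * (2 * ?e) ^ CARD('d) / ((6 * ?d) ^ CARD('d) * ?X)"
        proof -
          have "c * side D powr t \<le> (c0 * (2 * ?e) ^ CARD('d) / (6 * ?d) ^ CARD('d)) * side D powr t"
            by (intro mult_right_mono) (auto simp: c_def)
          also have "\<dots> = c0 * side D ^ CARD('d) * (2 * ?e) ^ CARD('d) / ((6 * ?d) ^ CARD('d) * ?X)"
          proof -
            have "side D powr t = side D ^ CARD('d) / ?X" by (simp add: powr_realpow[symmetric] powr_diff)
            then show ?thesis by simp
          qed
          finally show ?thesis .
        qed
        ultimately have "ennreal (c * side D powr t) \<le> net_weight t ?J"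
          using ennreal_leI order.trans by blast
        also have "\<dots> \<le> net_weight t I" by (intro emeasure_mono) auto
        finally show ?thesis .
      qed
    qed
    have td: "0 < ?d - t" using t' t'd by simp
    \<comment> \<open>The number of levels to descend before the constant \<open>c\<close> is
      compensated; it is finite because \<open>t\<close> is strictly below the dimension.\<close>
    obtain j where j: "(1 / 2) ^ j < c powr (1 / (?d - t))"
      using real_arch_pow_inv[of "c powr (1 / (?d - t))" "1 / 2"] c by auto
    define m where "m = fst p + int j"
    have sm: "dyadic_side m = side p * (1 / 2) ^ j"
      using dyadic_side_add[of "fst p" j] by (simp add: m_def power_one_over)
    have "dyadic_side m powr (?d - t) = ((1 / 2) ^ j) powr (?d - t) * side p powr (?d - t)"
      unfolding sm by (simp add: powr_mult)
    also have "\<dots> \<le> (c powr (1 / (?d - t))) powr (?d - t) * side p powr (?d - t)"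
      using j td by (intro mult_right_mono powr_mono2) auto
    also have "\<dots> = c * side p powr (?d - t)" using td c by (simp add: powr_powr)
    finally have m: "dyadic_side m powr (?d - t) \<le> c * side p powr (?d - t)" .
    \<comment> \<open>The interior of \<open>cube p\<close> is kept inside the set: a subcube has
      its interior there, so \<open>part\<close> still applies to the subcube.\<close>
    have "ennreal (side p powr t) \<le> dyadic_content t (V k \<inter> interior (cube p) \<inter> cube p)"
    proof (rule dyadic_content_of_small_cubes[OF t(1) _ _ _ m])
      show "t \<le> ?d" "0 \<le> c" "fst p \<le> m" using td c by (auto simp: m_def)
      fix l :: "int ^ 'd" assume l: "dyadic_cube m l \<subseteq> cube p"
      then have "ennreal (c * dyadic_side m powr t) \<le> dyadic_content t (V k \<inter> interior (dyadic_cube m l))"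
        using part[of "(m, l)"] p by auto
      also have "\<dots> \<le> dyadic_content t (V k \<inter> interior (cube p) \<inter> dyadic_cube m l)"
        using interior_mono[OF l] interior_subset by (intro dyadic_content_mono) blast
      finally show "ennreal (c * dyadic_side m powr t) \<le> dyadic_content t (V k \<inter> interior (cube p) \<inter> dyadic_cube m l)" .
    qed
    also have "\<dots> \<le> dyadic_content t (V k \<inter> interior (cube p))"
      by (intro dyadic_content_mono) auto
    finally show ?thesis .
  qed
  have "(\<Inter>k. V k) \<in> large_intersection_class (s_star \<beta> \<gamma>)"
    unfolding large_intersection_class_def
  proof (intro CollectI conjI allI impI)
    show "(\<Inter>k. V k) \<subseteq> unit_cube"
      using F_sub by (auto simp: W_set_def half_open_unit_cube_def unit_cube_def intro: less_imp_le)
    show "gdelta (\<Inter>k. V k)" using openV by (rule gdelta.intros)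
    fix t m l assume t: "0 < t" "ereal t < s_star \<beta> \<gamma>" and D: "dyadic_cube m l \<subseteq> (unit_cube :: (real ^ 'd) set)"
    let ?q = "(m, l)"
    have "dyadic_content t (cube ?q) \<le> net_weight t {?q}"
      by (intro dyadic_content_le) auto
    also have "\<dots> = ennreal (side ?q powr t)" by (rule net_weight_singleton)
    also have "\<dots> \<le> dyadic_content t ((\<Inter>k. V k) \<inter> cube ?q)"
      using D by (intro dyadic_content_Inter_open openV full t) auto
    finally have "dyadic_content t (dyadic_cube m l) \<le> dyadic_content t ((\<Inter>k. V k) \<inter> dyadic_cube m l)"
      by simp
    then show "dyadic_content t ((\<Inter>k. V k) \<inter> dyadic_cube m l) = dyadic_content t (dyadic_cube m l)"
      using dyadic_content_mono[OF Int_lower2] by (rule antisym[rotated])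
  qed
  then show ?thesis using F_sub by blast
qed

section \<open>Hausdorff measures and dimension\<close>

text \<open>The Borel-Cantelli argument: all families from order \<open>N\<close> on still cover
  \<open>A\<close>, with total gauge a tail of a convergent series.\<close>

lemma hausdorff_measure_eq_0I:
  fixes A :: "'a::metric_space set"
  assumes t: "0 < t"
    and A: "\<And>x. x \<in> A \<Longrightarrow> \<exists>\<^sub>\<infinity>n. x \<in> \<Union> (\<C> n)"
    and fin: "\<And>n. finite (\<C> n)"
    and diam: "\<And>n S. S \<in> \<C> n \<Longrightarrow> bounded S \<and> diameter S \<le> r n"
    and r: "r \<longlonglongrightarrow> 0" "\<And>n. 0 \<le> r n"
    and sum: "summable (\<lambda>n. real (card (\<C> n)) * r n powr t)"
  shows "hausdorff_measure t A = 0"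
proof -
  have "hausdorff_pre_measure t \<delta> A \<le> 0" if \<delta>: "0 < \<delta>" for \<delta>
  proof (rule ennreal_le_epsilon)
    fix \<epsilon> :: real assume \<epsilon>: "0 < \<epsilon>"
    obtain N1 where N1: "\<And>n. N1 \<le> n \<Longrightarrow> r n < \<delta>"
      using order_tendstoD(2)[OF r(1) \<delta>] by (auto simp: eventually_sequentially)
    obtain N2 where N2: "\<And>n. N2 \<le> n \<Longrightarrow> norm (\<Sum>i. real (card (\<C> (i + n))) * r (i + n) powr t) < \<epsilon>"
      using suminf_exist_split[OF \<epsilon> sum] by blast
    define N where "N = max N1 N2"
    have "\<exists>h. \<forall>n. bij_betw (h n) {0..<card (\<C> n)} (\<C> n)"
      using ex_bij_betw_nat_finite[OF fin] by (intro choice allI)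
    then obtain h where h: "\<And>n. bij_betw (h n) {0..<card (\<C> n)} (\<C> n)" by blast
    \<comment> \<open>Finite families are padded with empty sets, whose gauge is 0, to give one
      sequence indexed by pairs.\<close>
    define f where "f = (\<lambda>(n, j). if N \<le> n \<and> j < card (\<C> n) then h n j else {})"
    have fC: "f (n, j) \<in> \<C> n" if "N \<le> n" "j < card (\<C> n)" for n j
      using that bij_betwE[OF h[of n]] by (auto simp: f_def)
    define U where "U = (\<lambda>k. f (prod_decode k))"
    have "A \<subseteq> (\<Union>k. U k)"
    proof
      fix x assume "x \<in> A"
      then obtain n where n: "N \<le> n" "x \<in> \<Union> (\<C> n)" using A unfolding INFM_nat_le by blast
      then obtain S where S: "S \<in> \<C> n" "x \<in> S" by blast
      then obtain j where "j < card (\<C> n)" "h n j = S"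
        using bij_betw_imp_surj_on[OF h[of n]] by (metis atLeastLessThan_iff imageE)
      then have "x \<in> U (prod_encode (n, j))" using n S by (simp add: U_def f_def)
      then show "x \<in> (\<Union>k. U k)" by blast
    qed
    moreover have "bounded (U k) \<and> diameter (U k) \<le> \<delta>" for k
    proof (cases "prod_decode k")
      case (Pair n j)
      show ?thesis
      proof (cases "N \<le> n \<and> j < card (\<C> n)")
        case True
        then show ?thesis using diam[OF fC[of n j]] N1[of n] Pair by (auto simp: U_def N_def)
      next
        case False
        then show ?thesis using Pair \<delta> by (auto simp: U_def f_def)
      qed
    qed
    ultimately have "hausdorff_pre_measure t \<delta> A \<le> (\<Sum>k. diam_gauge t (U k))"
      unfolding hausdorff_pre_measure_def by (intro Inf_lower) blast
    also have "\<dots> = (\<Sum>n. \<Sum>j. diam_gauge t (f (n, j)))"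
      unfolding U_def by (rule suminf_ennreal_2dimen) simp
    also have "\<dots> \<le> (\<Sum>n. ennreal (if N \<le> n then real (card (\<C> n)) * r n powr t else 0))"
    proof (intro suminf_le summableI allI)
      fix n
      have "(\<Sum>j. diam_gauge t (f (n, j))) = (\<Sum>j<card (\<C> n). diam_gauge t (f (n, j)))"
        by (intro suminf_finite) (auto simp: f_def diam_gauge_def)
      also have "\<dots> \<le> (\<Sum>j<card (\<C> n). ennreal (if N \<le> n then r n powr t else 0))"
      proof (intro sum_mono)
        fix j assume j: "j \<in> {..<card (\<C> n)}"
        show "diam_gauge t (f (n, j)) \<le> ennreal (if N \<le> n then r n powr t else 0)"
        proof (cases "N \<le> n")
          case True
          then have "bounded (f (n, j)) \<and> diameter (f (n, j)) \<le> r n" using j by (intro diam fC) auto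
          then have "diameter (f (n, j)) powr t \<le> r n powr t"
            using t by (intro powr_mono2) (auto simp: diameter_ge_0)
          then show ?thesis using True t by (auto simp: diam_gauge_def ennreal_leI)
        qed (auto simp: f_def diam_gauge_def)
      qed
      also have "\<dots> = ennreal (if N \<le> n then real (card (\<C> n)) * r n powr t else 0)"
        by (simp add: ennreal_of_nat_eq_real_of_nat ennreal_mult)
      finally show "(\<Sum>j. diam_gauge t (f (n, j))) \<le>
        ennreal (if N \<le> n then real (card (\<C> n)) * r n powr t else 0)" .
    qed
    also have "\<dots> \<le> ennreal \<epsilon>"
    proof -
      let ?g = "\<lambda>n. if N \<le> n then real (card (\<C> n)) * r n powr t else 0"
      have sg: "summable ?g"
        by (rule summable_comparison_test'[OF sum, of 0]) auto
      have "suminf ?g = (\<Sum>i. ?g (i + N)) + (\<Sum>i<N. ?g i)" by (rule suminf_split_initial_segment[OF sg])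
      also have "(\<Sum>i<N. ?g i) = 0" by (intro sum.neutral) auto
      finally have "suminf ?g = (\<Sum>i. real (card (\<C> (i + N))) * r (i + N) powr t)" by simp
      then have "suminf ?g \<le> \<epsilon>" using N2[of N] by (simp add: N_def)
      moreover have "(\<Sum>n. ennreal (?g n)) = ennreal (suminf ?g)"
        by (intro suminf_ennreal2 sg) auto
      ultimately show ?thesis by (simp add: ennreal_leI)
    qed
    finally show "hausdorff_pre_measure t \<delta> A \<le> 0 + ennreal \<epsilon>" by simp
  qed
  then have "hausdorff_measure t A \<le> 0" unfolding hausdorff_measure_def by (intro SUP_least) auto
  then show ?thesis by simp
qed

lemma hausdorff_dim_leI:
  assumes s: "0 \<le> s" and z: "\<And>t. 0 < t \<Longrightarrow> s < ereal t \<Longrightarrow> hausdorff_measure t A = 0"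
  shows "hausdorff_dim A \<le> s"
proof (rule ccontr)
  assume "\<not> ?thesis"
  then have "s < hausdorff_dim A" by simp
  then obtain t where t: "s < ereal t" "ereal t < hausdorff_dim A" using ereal_dense2 by blast
  then have "0 < t" using s by (metis ereal_less(2) order.strict_trans1)
  then have "hausdorff_dim A \<le> ereal t"
    unfolding hausdorff_dim_def using z[OF _ t(1)] by (intro Inf_lower) auto
  then show False using t by simp
qed

section \<open>From Hausdorff null sets to vanishing net content\<close>

lemma dyadic_content_countable_subadditive:
  assumes A: "A \<subseteq> (\<Union>i::nat. U i)"
    and U: "\<And>i. \<exists>I. U i \<subseteq> \<Union> (cube ` I) \<and> net_weight t I \<le> b i"
  shows "dyadic_content t A \<le> (\<Sum>i. b i)"
proof -
  have "\<forall>i. \<exists>I. U i \<subseteq> \<Union> (cube ` I) \<and> net_weight t I \<le> b i" using U by (rule allI)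
  from choice[OF this] obtain I where
    "\<forall>i. U i \<subseteq> \<Union> (cube ` I i) \<and> net_weight t (I i) \<le> b i" ..
  then have I: "\<And>i. U i \<subseteq> \<Union> (cube ` I i)" "\<And>i. net_weight t (I i) \<le> b i" by auto
  have "A \<subseteq> \<Union> (cube ` (\<Union>i. I i))"
  proof
    fix x assume "x \<in> A"
    then obtain i where "x \<in> U i" using A by blast
    then have "x \<in> \<Union> (cube ` I i)" using I(1) by (rule subsetD[rotated])
    then show "x \<in> \<Union> (cube ` (\<Union>i. I i))" by blast
  qed
  then have "dyadic_content t A \<le> net_weight t (\<Union>i. I i)" by (rule dyadic_content_le)
  also have "\<dots> \<le> (\<Sum>i. net_weight t (I i))"
    by (intro emeasure_subadditive_countably) auto
  also have "\<dots> \<le> (\<Sum>i. b i)" using I(2) by (intro suminf_le summableI) auto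
  finally show ?thesis .
qed

text \<open>Choose the level with side between \<rho> and \<open>2 * \<rho>\<close>: the set then
  lies in the cube of one of its points together with the neighbours of that cube,
  \<open>3 ^ d\<close> cubes in all.\<close>

lemma cubes_covering_small_set:
  fixes U :: "(real ^ 'd) set"
  assumes \<rho>: "0 < \<rho>" "\<rho> \<le> 1" and diam: "\<And>x y. x \<in> U \<Longrightarrow> y \<in> U \<Longrightarrow> dist x y \<le> \<rho>" and t: "0 < t"
  shows "\<exists>I. U \<subseteq> \<Union> (cube ` I) \<and> net_weight t I \<le> ennreal (3 ^ CARD('d) * (2 * \<rho>) powr t)"
proof (cases "U = {}")
  case True
  then show ?thesis by (intro exI[of _ "{}"]) auto
next
  case False
  then obtain x0 where x0: "x0 \<in> U" by blast
  define j where "j = (LEAST j. (1 / 2) ^ Suc j < \<rho>)"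
  have "\<exists>j. (1 / 2 :: real) ^ Suc j < \<rho>"
  proof -
    obtain j where "(1 / 2) ^ j < \<rho>" using real_arch_pow_inv[OF \<rho>(1), of "1 / 2"] by auto
    then show ?thesis by (intro exI[of _ j]) (simp, smt (verit) zero_le_power half_gt_zero)
  qed
  then have j1: "(1 / 2) ^ Suc j < \<rho>" unfolding j_def by (rule LeastI_ex)
  have j2: "\<rho> \<le> (1 / 2) ^ j"
  proof (cases j)
    case (Suc i)
    then show ?thesis using not_less_Least[of i "\<lambda>j. (1 / 2) ^ Suc j < \<rho>"] by (simp add: j_def)
  qed (use \<rho> in auto)
  define m where "m = int j"
  have side: "dyadic_side m = (1 / 2) ^ j" by (simp add: m_def dyadic_side_def power_int_minus power_one_over inverse_eq_divide)
  define F where "F i = {\<lfloor>x0 $ i / dyadic_side m\<rfloor> - 1..\<lfloor>x0 $ i / dyadic_side m\<rfloor> + 1}" for i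
  define I where "I = Pair m ` {k :: int ^ 'd. \<forall>i. k $ i \<in> F i}"
  have fin: "finite I" unfolding I_def by (intro finite_imageI card_vec_set) (simp add: F_def)
  have "card I \<le> card {k :: int ^ 'd. \<forall>i. k $ i \<in> F i}"
    unfolding I_def by (intro card_image_le card_vec_set) (simp add: F_def)
  also have "\<dots> = 3 ^ CARD('d)" by (subst card_vec_set) (simp_all add: F_def)
  finally have card: "card I \<le> 3 ^ CARD('d)" .
  have "U \<subseteq> \<Union> (cube ` I)"
  proof
    fix x assume x: "x \<in> U"
    have "cube_index m x $ i \<in> F i" for i
    proof -
      have "\<bar>x $ i - x0 $ i\<bar> \<le> norm (x - x0)" using component_le_norm_cart[of "x - x0" i] by simp
      also have "\<dots> \<le> dyadic_side m" using diam[OF x x0] j2 by (simp add: dist_norm side)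
      finally have "\<bar>x $ i - x0 $ i\<bar> / dyadic_side m \<le> 1" by (simp add: divide_le_eq)
      then have "\<bar>x $ i / dyadic_side m - x0 $ i / dyadic_side m\<bar> \<le> 1"
        by (simp add: abs_divide flip: diff_divide_distrib)
      then show ?thesis by (simp add: F_def cube_index_def) linarith
    qed
    then have "(m, cube_index m x) \<in> I" by (auto simp: I_def)
    then show "x \<in> \<Union> (cube ` I)" using in_cube_index[of x m] by force
  qed
  moreover have "net_weight t I \<le> ennreal (3 ^ CARD('d) * (2 * \<rho>) powr t)"
  proof -
    have "net_weight t I = (\<Sum>q\<in>I. ennreal (dyadic_side m powr t))"
      unfolding net_weight_finite[OF fin] by (intro sum.cong) (auto simp: I_def)
    also have "\<dots> = ennreal (real (card I) * dyadic_side m powr t)"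
      by (simp add: ennreal_of_nat_eq_real_of_nat ennreal_mult)
    also have "\<dots> \<le> ennreal (3 ^ CARD('d) * (2 * \<rho>) powr t)"
    proof (intro ennreal_leI mult_mono powr_mono2)
      show "real (card I) \<le> 3 ^ CARD('d)" using card by (metis of_nat_le_iff of_nat_numeral of_nat_power)
      show "dyadic_side m \<le> 2 * \<rho>" using j1 by (simp add: side)
    qed (use t in auto)
    finally show ?thesis .
  qed
  ultimately show ?thesis by blast
qed

text \<open>Sets of a Hausdorff cover are replaced by boundedly many dyadic cubes of comparable
  side. On diameters at most 1 the gauge of exponent \<open>u\<close> dominates that of the larger
  exponent \<open>t\<close>, including points, whose gauge is 1 for \<open>u = 0\<close>.\<close>

lemma dyadic_content_eq_0:
  fixes A :: "(real ^ 'd) set"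
  assumes "hausdorff_measure u A = 0" "0 \<le> u" "u < t"
  shows "dyadic_content t A = 0"
proof -
  let ?K = "3 ^ CARD('d) * 2 powr t :: real"
  have eps: "dyadic_content t A \<le> 0 + ennreal \<epsilon>" if \<epsilon>: "0 < \<epsilon>" for \<epsilon>
  proof -
    define e where "e = min 1 (\<epsilon> / (2 * ?K))"
    have e: "0 < e" "e \<le> 1" using \<epsilon> by (auto simp: e_def)
    have "hausdorff_pre_measure u 1 A \<le> hausdorff_measure u A"
      unfolding hausdorff_measure_def by (intro SUP_upper) auto
    then have "hausdorff_pre_measure u 1 A < ennreal e" using assms(1) e by simp
    then obtain U where U: "A \<subseteq> (\<Union>i. U i)" "\<And>i. bounded (U i) \<and> diameter (U i) \<le> 1"
      "(\<Sum>i. diam_gauge u (U i)) < ennreal e"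
      unfolding hausdorff_pre_measure_def Inf_less_iff by auto
    \<comment> \<open>Dyadic cubes have positive side, so sets of diameter 0 are treated as having
      size \<open>\<eta> i\<close>. The powers \<open>\<eta> i powr t\<close> sum to
      \<open>e\<close>, as much as is granted to the cover itself; hence the 2 in
      \<open>e\<close>.\<close>
    define \<eta> where "\<eta> i = (e * (1 / 2) ^ Suc i) powr (1 / t)" for i :: nat
    have t: "0 < t" using assms by simp
    have \<eta>: "0 < \<eta> i" "\<eta> i \<le> 1" "\<eta> i powr t = e * (1 / 2) ^ Suc i" for i
    proof -
      show "0 < \<eta> i" using e by (simp add: \<eta>_def)
      have "e * (1 / 2) ^ Suc i \<le> 1 * 1" using e by (intro mult_mono power_le_one) auto
      then show "\<eta> i \<le> 1" unfolding \<eta>_def using e t by (intro powr_le1) auto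
      show "\<eta> i powr t = e * (1 / 2) ^ Suc i" using e t by (simp add: \<eta>_def powr_powr)
    qed
    define \<rho> where "\<rho> i = max (diameter (U i)) (\<eta> i)" for i
    have \<rho>: "0 < \<rho> i" "\<rho> i \<le> 1" for i using \<eta>[of i] U(2)[of i] by (auto simp: \<rho>_def)
    have "dyadic_content t A \<le> (\<Sum>i. ennreal (3 ^ CARD('d) * (2 * \<rho> i) powr t))"
    proof (rule dyadic_content_countable_subadditive[OF U(1)], rule cubes_covering_small_set)
      fix i x y assume "x \<in> U i" "y \<in> U i"
      then show "dist x y \<le> \<rho> i" using diameter_bounded_bound[of "U i" x y] U(2)[of i] by (simp add: \<rho>_def)
    qed (use \<rho> t in auto)
    also have "\<dots> \<le> (\<Sum>i. ennreal ?K * (diam_gauge u (U i) + ennreal (e * (1 / 2) ^ Suc i)))"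
    proof (intro suminf_le summableI)
      fix i
      have d0: "0 \<le> diameter (U i)" "diameter (U i) \<le> 1" using U(2) by (auto simp: diameter_ge_0)
      have "ennreal (diameter (U i) powr t) \<le> diam_gauge u (U i)"
      proof (cases "U i = {}")
        case False
        have "diameter (U i) powr t \<le> diameter (U i) powr u"
          using d0 assms by (intro powr_mono') auto
        moreover have "diameter (U i) powr t \<le> 1" using d0 t by (intro powr_le1) auto
        ultimately show ?thesis using False by (auto simp: diam_gauge_def ennreal_leI)
      qed (simp add: diam_gauge_def)
      moreover have "\<rho> i powr t \<le> diameter (U i) powr t + e * (1 / 2) ^ Suc i"
        unfolding \<eta>(3)[of i, symmetric] by (auto simp: \<rho>_def max_def)
      then have "ennreal (\<rho> i powr t) \<le> ennreal (diameter (U i) powr t) + ennreal (e * (1 / 2) ^ Suc i)"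
        using e by (subst ennreal_plus[symmetric]) (auto intro!: ennreal_leI simp del: power_Suc ennreal_plus)
      ultimately have "ennreal (\<rho> i powr t) \<le> diam_gauge u (U i) + ennreal (e * (1 / 2) ^ Suc i)"
        by (meson add_right_mono order.trans)
      then have "ennreal ?K * ennreal (\<rho> i powr t) \<le> ennreal ?K * (diam_gauge u (U i) + ennreal (e * (1 / 2) ^ Suc i))"
        by (intro mult_left_mono) auto
      moreover have "ennreal (3 ^ CARD('d) * (2 * \<rho> i) powr t) = ennreal ?K * ennreal (\<rho> i powr t)"
        using \<rho>[of i] by (simp add: ennreal_mult[symmetric] powr_mult mult.assoc)
      ultimately show "ennreal (3 ^ CARD('d) * (2 * \<rho> i) powr t) \<le>
          ennreal ?K * (diam_gauge u (U i) + ennreal (e * (1 / 2) ^ Suc i))" by simp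
    qed
    also have "\<dots> = ennreal ?K * ((\<Sum>i. diam_gauge u (U i)) + (\<Sum>i. ennreal (e * (1 / 2) ^ Suc i)))"
      by (simp add: suminf_add[OF summableI summableI, symmetric] del: power_Suc)
    also have "(\<Sum>i. ennreal (e * (1 / 2) ^ Suc i)) = ennreal e"
    proof -
      have "(\<lambda>i. e * (1 / 2) ^ Suc i) sums (e * 1)" by (intro sums_mult power_half_series)
      then show ?thesis using e by (subst suminf_ennreal2) (auto simp: sums_iff simp del: power_Suc)
    qed
    also have "ennreal ?K * ((\<Sum>i. diam_gauge u (U i)) + ennreal e) \<le> ennreal ?K * (ennreal e + ennreal e)"
      using U(3) by (intro mult_left_mono add_mono) auto
    also have "\<dots> = ennreal (?K * (2 * e))" using e by (simp add: ennreal_mult[symmetric] ennreal_plus[symmetric] del: ennreal_plus)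
    also have "\<dots> \<le> ennreal \<epsilon>"
    proof (rule ennreal_leI)
      have "?K * (2 * e) \<le> ?K * (2 * (\<epsilon> / (2 * ?K)))" by (intro mult_left_mono) (auto simp: e_def)
      also have "\<dots> = \<epsilon>" by simp
      finally show "?K * (2 * e) \<le> \<epsilon>" .
    qed
    finally show ?thesis by simp
  qed
  have "dyadic_content t A \<le> 0" by (rule ennreal_le_epsilon) (rule eps)
  then show ?thesis by simp
qed

text \<open>If all sides are below 1, lowering the exponent from the dimension to \<open>t\<close>
  increases the weight, which already exceeds the volume.\<close>

lemma dyadic_content_unit_cube_ge:
  assumes "0 < t" "t \<le> real CARD('d)"
  shows "1 \<le> dyadic_content t (dyadic_cube 0 (0 :: int ^ 'd))"
proof (rule dyadic_content_geI)
  fix I :: "(int \<times> (int ^ 'd)) set" assume I: "dyadic_cube 0 0 \<subseteq> \<Union> (cube ` I)"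
  show "1 \<le> net_weight t I"
  proof (cases "\<exists>r\<in>I. 1 \<le> side r")
    case True
    then obtain r where r: "r \<in> I" "1 \<le> side r" by blast
    then have "ennreal 1 \<le> ennreal (side r powr t)" using assms by (intro ennreal_leI ge_one_powr_ge_zero) auto
    also have "\<dots> \<le> net_weight t I" by (rule net_weight_ge[OF r(1)])
    finally show ?thesis by simp
  next
    case False
    have "1 = ennreal (side (0, 0 :: int ^ 'd) powr real CARD('d))" by (simp add: dyadic_side_def)
    also have "\<dots> \<le> net_weight (real CARD('d)) I"
      using I by (intro emeasure_cover_le_net_measure) auto
    also have "\<dots> \<le> net_weight t I"
      unfolding net_weight_eq_nn_integral
      using False assms by (intro nn_integral_mono ennreal_leI powr_mono') (auto simp: not_le less_imp_le)
    finally show ?thesis .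
  qed
qed

text \<open>For \<open>t\<close> between \<open>u\<close> and \<open>s\<close>, the part of
  \<open>F\<close> in the half-open unit cube would have content both 0 and at least 1.\<close>

lemma hausdorff_dim_large_intersection:
  fixes F :: "(real ^ 'd) set"
  assumes F: "F \<in> large_intersection_class s" and s: "s \<le> ereal (real CARD('d))" and FA: "F \<subseteq> A"
  shows "s \<le> hausdorff_dim A"
  unfolding hausdorff_dim_def
proof (rule Inf_greatest, clarify)
  fix u assume u: "0 \<le> u" "hausdorff_measure u A = 0"
  show "s \<le> ereal u"
  proof (rule ccontr)
    assume "\<not> s \<le> ereal u"
    then have "ereal u < s" by simp
    then obtain t where t: "ereal u < ereal t" "ereal t < s" using ereal_dense2 by blast
    then have tu: "u < t" "0 < t" using u by auto
    have "ereal t \<le> ereal (real CARD('d))" using t s by (meson less_imp_le order.trans)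
    then have td: "t \<le> real CARD('d)" by simp
    have "dyadic_cube 0 0 \<subseteq> (unit_cube :: (real ^ 'd) set)"
      by (auto simp: dyadic_cube_def unit_cube_def dyadic_side_def intro: less_imp_le)
    then have "dyadic_content t (F \<inter> dyadic_cube 0 0) = dyadic_content t (dyadic_cube 0 (0 :: int ^ 'd))"
      using F t tu unfolding large_intersection_class_def by blast
    moreover have "dyadic_content t (F \<inter> dyadic_cube 0 0) \<le> dyadic_content t A"
      using FA by (intro dyadic_content_mono) auto
    ultimately show False
      using dyadic_content_unit_cube_ge[OF tu(2) td] dyadic_content_eq_0[OF u(2,1) tu(1)] by simp
  qed
qed

section \<open>Upper bound\<close>

definition hit_set :: "real ^ 'd \<Rightarrow> nat \<Rightarrow> (real ^ 'd) set \<Rightarrow> (real ^ 'd) set" where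
  "hit_set \<beta> n P = {x \<in> half_open_unit_cube. (beta_prod \<beta> ^^ n) x \<in> P}"

lemma dist_sum_combine_le:
  fixes g :: "'d \<Rightarrow> real ^ 'd"
  assumes "\<And>i. \<bar>z $ i - z' $ i\<bar> \<le> \<tau>" "\<And>i. \<bar>v $ i - v' $ i\<bar> * norm (g i) \<le> \<tau>"
  shows "dist (e + z + (q + combine g v)) (e + z' + (q + combine g v')) \<le> 2 * real CARD('d) * \<tau>"
proof -
  have "(e + z + (q + combine g v)) - (e + z' + (q + combine g v')) = (z - z') + combine g (v - v')"
    by (simp only: linear_diff[OF linear_combine]) simp
  then have "dist (e + z + (q + combine g v)) (e + z' + (q + combine g v')) = norm ((z - z') + combine g (v - v'))"
    by (simp only: dist_norm)
  also have "\<dots> \<le> norm (z - z') + norm (combine g (v - v'))" by (rule norm_triangle_ineq)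
  also have "norm (z - z') \<le> real CARD('d) * \<tau>"
  proof -
    have "norm (z - z') \<le> (\<Sum>i\<in>UNIV. \<bar>(z - z') $ i\<bar>)" by (rule norm_le_l1_cart)
    also have "\<dots> \<le> (\<Sum>i\<in>(UNIV :: 'd set). \<tau>)" using assms(1) by (intro sum_mono) simp
    finally show ?thesis by simp
  qed
  also have "norm (combine g (v - v')) \<le> real CARD('d) * \<tau>"
  proof -
    have "norm (combine g (v - v')) \<le> (\<Sum>i\<in>UNIV. norm ((v - v') $ i *\<^sub>R g i))" by (rule norm_sum)
    also have "\<dots> \<le> (\<Sum>i\<in>(UNIV :: 'd set). \<tau>)" using assms(2) by (intro sum_mono) simp
    finally show ?thesis by simp
  qed
  finally show ?thesis by (simp add: ac_simps)
qed

context greedy_frame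
begin

text \<open>The counterpart of \<open>ex_ortho_box\<close>: since \<open>u\<close> has entries at
  most 1, the contracted parallelepiped lies in an orthogonal box of size at most the dimension
  times that of the \<gamma>'s.\<close>

lemma image_coordinates:
  assumes "y \<in> P"
  obtains v where "(contraction \<beta> ^^ n) y = q + combine (\<lambda>i. \<gamma> (\<kappa> i)) v" "\<And>i. \<bar>v $ i\<bar> \<le> real CARD('d)"
proof -
  obtain c where c: "(contraction \<beta> ^^ n) y = q + (\<Sum>j\<in>UNIV. c j *\<^sub>R a j)" "\<And>j. 0 \<le> c j \<and> c j \<le> 1"
    using image assms by blast
  define v where "v = (\<chi> j. \<Sum>i\<in>UNIV. c i * u j i)"
  have "(\<Sum>i\<in>UNIV. c i *\<^sub>R a i) = (\<Sum>i\<in>UNIV. \<Sum>j\<in>UNIV. (c i * u j i) *\<^sub>R \<gamma> (\<kappa> j))"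
    by (simp add: dec scaleR_sum_right)
  also have "\<dots> = (\<Sum>j\<in>UNIV. \<Sum>i\<in>UNIV. (c i * u j i) *\<^sub>R \<gamma> (\<kappa> j))" by (rule sum.swap)
  also have "\<dots> = combine (\<lambda>i. \<gamma> (\<kappa> i)) v" by (simp add: v_def scaleR_sum_left)
  finally have 1: "(contraction \<beta> ^^ n) y = q + combine (\<lambda>i. \<gamma> (\<kappa> i)) v" using c(1) by simp
  have 2: "\<bar>v $ i\<bar> \<le> real CARD('d)" for i
  proof -
    have "\<bar>v $ i\<bar> \<le> (\<Sum>j\<in>UNIV. \<bar>c j * u i j\<bar>)" by (simp add: v_def sum_abs)
    also have "\<dots> \<le> (\<Sum>j\<in>(UNIV :: 'd set). 1)"
    proof (intro sum_mono)
      fix j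
      have "\<bar>c j * u i j\<bar> \<le> 1 * 1" unfolding abs_mult using c(2)[of j] u_le[of i j] by (intro mult_mono) auto
      then show "\<bar>c j * u i j\<bar> \<le> 1" by simp
    qed
    finally show ?thesis by simp
  qed
  show thesis by (rule that[OF 1 2])
qed

text \<open>Where a cylinder is shorter than \<open>\<tau>\<close>, its left end point is rounded to a multiple of \<open>\<tau>\<close>.\<close>

lemma hit_set_cover:
  assumes \<tau>: "0 < \<tau>" "\<tau> < 1"
  shows "\<exists>\<C>. finite \<C> \<and> hit_set \<beta> n P \<subseteq> \<Union> \<C> \<and>
    (\<forall>S\<in>\<C>. \<forall>x\<in>S. \<forall>y\<in>S. dist x y \<le> 2 * real CARD('d) * \<tau>) \<and>
    real (card \<C>) * profile \<beta> n \<gamma> \<tau> \<le> (3 * (2 * real CARD('d) + 3)) ^ CARD('d) * real (n + 1) ^ CARD('d)"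
proof -
  let ?d = "real CARD('d)" and ?g = "\<lambda>i. \<gamma> (\<kappa> i)" and ?b = "\<lambda>i. inverse (\<beta> $ i) ^ n"
  \<comment> \<open>In each coordinate the cheaper of two sets of base points, about
    \<open>1 / max \<tau> (?b i)\<close> of them up to a factor linear in \<open>n\<close>. This
    matches the first product of the profile, as the cells numbered by \<open>N\<close> match the
    second.\<close>
  define G where "G i = (if ?b i \<le> \<tau> then (\<lambda>j. of_int j * \<tau>) ` {0..\<lfloor>1 / \<tau>\<rfloor>} else left_ends (\<beta> $ i) n)" for i
  define N where "N i = \<lceil>?d * norm (?g i) / \<tau>\<rceil>" for i
  define Es where "Es = {e. \<forall>i. e $ i \<in> G i}"
  define Ms where "Ms = {m :: int ^ 'd. \<forall>i. m $ i \<in> {- N i..N i}}"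
  define cell where "cell = (\<lambda>(e, m :: int ^ 'd). {e + z + (q + combine ?g v) | z v.
    (\<forall>i. 0 \<le> z $ i \<and> z $ i \<le> \<tau>) \<and>
    (\<forall>i. of_int (m $ i) * (\<tau> / norm (?g i)) \<le> v $ i \<and> v $ i \<le> (of_int (m $ i) + 1) * (\<tau> / norm (?g i)))})"
  have gp: "0 < norm (?g i)" for i using nz[of i] by simp
  have bp: "0 < ?b i" "?b i * \<beta> $ i ^ n = 1" for i
    using \<beta>[of i] by (simp_all add: power_mult_distrib[symmetric])
  have finG: "finite (G i)" for i using left_ends_card_upper(1)[OF \<beta>] by (simp add: G_def)
  have N0: "0 \<le> N i" for i
  proof -
    have "0 \<le> ?d * norm (?g i) / \<tau>" using \<tau> by simp
    then show ?thesis unfolding N_def by linarith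
  qed
  have cardG: "real (card (G i)) * max \<tau> (?b i) \<le> 3 * real (n + 1)" for i
  proof (cases "?b i \<le> \<tau>")
    case True
    have "card (G i) \<le> card {0..\<lfloor>1 / \<tau>\<rfloor>}" unfolding G_def using True by (simp add: card_image_le del: card_atLeastAtMost_int)
    then have "card (G i) \<le> nat (\<lfloor>1 / \<tau>\<rfloor> + 1)" by simp
    moreover have "0 \<le> 1 / \<tau>" using \<tau> by simp
    ultimately have "real (card (G i)) \<le> 1 / \<tau> + 1" by linarith
    then have "real (card (G i)) * \<tau> \<le> (1 / \<tau> + 1) * \<tau>" using \<tau> by (intro mult_right_mono) auto
    also have "\<dots> \<le> 2" using \<tau> by (simp add: distrib_right)
    finally show ?thesis using True by (simp add: max_absorb1)
  next
    case False
    then have "real (card (G i)) * max \<tau> (?b i) \<le> 3 * real (n + 1) * \<beta> $ i ^ n * ?b i"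
      using left_ends_card_upper(2)[OF \<beta>, of i n] bp(1)[of i] by (simp add: G_def max_absorb2 mult_right_mono)
    also have "\<dots> = 3 * real (n + 1)" using bp(2)[of i] by (simp add: mult.assoc mult.commute)
    finally show ?thesis .
  qed
  have cardN: "real (card {- N i..N i}) * min 1 (\<tau> / norm (?g i)) \<le> 2 * ?d + 3" for i
  proof -
    let ?x = "norm (?g i) / \<tau>"
    have x: "0 < ?x" using gp \<tau> by simp
    have "of_int (N i) \<le> ?d * norm (?g i) / \<tau> + 1" unfolding N_def by linarith
    then have "of_int (N i) \<le> ?d * ?x + 1" by simp
    then have "real (card {- N i..N i}) \<le> 2 * (?d * ?x) + 3" using N0[of i] by simp
    then have "real (card {- N i..N i}) * min 1 (1 / ?x) \<le> (2 * (?d * ?x) + 3) * min 1 (1 / ?x)"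
      using x \<tau> by (intro mult_right_mono) auto
    also have "\<dots> = 2 * ?d * (?x * min 1 (1 / ?x)) + 3 * min 1 (1 / ?x)" by (simp add: algebra_simps)
    also have "\<dots> \<le> 2 * ?d * 1 + 3 * 1"
    proof (intro add_mono mult_left_mono)
      have "y * min 1 (1 / y) \<le> 1" if "0 < y" for y :: real using that by (simp add: min_def)
      then show "?x * min 1 (1 / ?x) \<le> 1" using x by blast
    qed auto
    finally show ?thesis by simp
  qed
  have fin: "finite (Es \<times> Ms)" unfolding Es_def Ms_def using finG by (intro finite_cartesian_product card_vec_set) auto
  define \<C> where "\<C> = cell ` (Es \<times> Ms)"
  have "card \<C> \<le> card (Es \<times> Ms)" unfolding \<C>_def by (rule card_image_le[OF fin])
  also have "\<dots> = (\<Prod>i\<in>UNIV. card (G i)) * (\<Prod>i\<in>UNIV. card {- N i..N i})"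
    unfolding card_cartesian_product Es_def Ms_def using finG by (subst (1 2) card_vec_set) auto
  finally have "real (card \<C>) \<le> real ((\<Prod>i\<in>UNIV. card (G i)) * (\<Prod>i\<in>UNIV. card {- N i..N i}))"
    by (rule of_nat_mono)
  then have "real (card \<C>) \<le> (\<Prod>i\<in>UNIV. real (card (G i))) * (\<Prod>i\<in>UNIV. real (card {- N i..N i}))"
    by (simp only: of_nat_mult of_nat_prod)
  then have "real (card \<C>) * profile \<beta> n \<gamma> \<tau> \<le>
      (\<Prod>i\<in>UNIV. real (card (G i))) * (\<Prod>i\<in>UNIV. real (card {- N i..N i})) * profile \<beta> n \<gamma> \<tau>"
    unfolding profile_eq[symmetric] using gp \<tau> by (intro mult_right_mono scale_profile_nonneg) auto
  also have "\<dots> = (\<Prod>i\<in>UNIV. real (card (G i)) * max \<tau> (?b i)) *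
      (\<Prod>i\<in>UNIV. real (card {- N i..N i}) * min 1 (\<tau> / norm (?g i)))"
    unfolding profile_eq[symmetric] by (simp only: scale_profile_def prod.distrib ac_simps)
  also have "\<dots> \<le> (\<Prod>i\<in>(UNIV :: 'd set). 3 * real (n + 1)) * (\<Prod>i\<in>(UNIV :: 'd set). 2 * ?d + 3)"
  proof (rule mult_mono)
    show "(\<Prod>i\<in>UNIV. real (card (G i)) * max \<tau> (?b i)) \<le> (\<Prod>i\<in>(UNIV :: 'd set). 3 * real (n + 1))"
      using \<tau> by (intro prod_mono conjI cardG mult_nonneg_nonneg) auto
    show "(\<Prod>i\<in>UNIV. real (card {- N i..N i}) * min 1 (\<tau> / norm (?g i))) \<le> (\<Prod>i\<in>(UNIV :: 'd set). 2 * ?d + 3)"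
      using \<tau> by (intro prod_mono conjI cardN mult_nonneg_nonneg) auto
    show "0 \<le> (\<Prod>i\<in>UNIV. real (card {- N i..N i}) * min 1 (\<tau> / norm (?g i)))"
      using \<tau> by (intro prod_nonneg mult_nonneg_nonneg) auto
  qed (intro prod_nonneg, simp)
  also have "\<dots> = (3 * (2 * ?d + 3)) ^ CARD('d) * real (n + 1) ^ CARD('d)"
    by (simp only: prod_constant power_mult_distrib ac_simps)
  finally have card: "real (card \<C>) * profile \<beta> n \<gamma> \<tau> \<le> (3 * (2 * ?d + 3)) ^ CARD('d) * real (n + 1) ^ CARD('d)" .
  have "dist x y \<le> 2 * ?d * \<tau>" if S: "S \<in> \<C>" and xy: "x \<in> S" "y \<in> S" for S x y
  proof -
    obtain e and m :: "int ^ 'd" where "S = cell (e, m)" using S by (auto simp: \<C>_def)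
    then obtain z v z' v' where x: "x = e + z + (q + combine ?g v)" "\<And>i. 0 \<le> z $ i \<and> z $ i \<le> \<tau>"
        "\<And>i. of_int (m $ i) * (\<tau> / norm (?g i)) \<le> v $ i \<and> v $ i \<le> (of_int (m $ i) + 1) * (\<tau> / norm (?g i))"
      and y: "y = e + z' + (q + combine ?g v')" "\<And>i. 0 \<le> z' $ i \<and> z' $ i \<le> \<tau>"
        "\<And>i. of_int (m $ i) * (\<tau> / norm (?g i)) \<le> v' $ i \<and> v' $ i \<le> (of_int (m $ i) + 1) * (\<tau> / norm (?g i))"
      using xy unfolding cell_def by auto
    show ?thesis unfolding x(1) y(1)
    proof (rule dist_sum_combine_le)
      fix i
      show "\<bar>z $ i - z' $ i\<bar> \<le> \<tau>" using x(2)[of i] y(2)[of i] by linarith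
      have "\<bar>v $ i - v' $ i\<bar> \<le> \<tau> / norm (?g i)"
        using x(3)[of i] y(3)[of i] by (simp only: distrib_right mult_1) linarith
      then show "\<bar>v $ i - v' $ i\<bar> * norm (?g i) \<le> \<tau>" using gp[of i] by (simp add: pos_le_divide_eq)
    qed
  qed
  moreover have "hit_set \<beta> n P \<subseteq> \<Union> \<C>"
  proof
    fix x assume "x \<in> hit_set \<beta> n P"
    then have x: "x \<in> half_open_unit_cube" "(beta_prod \<beta> ^^ n) x \<in> P" by (auto simp: hit_set_def)
    then have x01: "0 \<le> x $ i" "x $ i < 1" for i by (auto simp: half_open_unit_cube_def)
    obtain v where v: "(contraction \<beta> ^^ n) ((beta_prod \<beta> ^^ n) x) = q + combine ?g v" "\<And>i. \<bar>v $ i\<bar> \<le> ?d"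
      using image_coordinates[OF x(2)] by blast
    define w where "w = (\<chi> i. cyl_start (\<beta> $ i) n (x $ i))"
    \<comment> \<open>Contracting the image of \<open>x\<close> gives its offset from the left end
      point of its cylinder, full or not.\<close>
    have xw: "x = w + (q + combine ?g v)"
      unfolding v(1)[symmetric] w_def
      by (simp add: vec_eq_iff funpow_contraction funpow_beta_prod cyl_start_def field_simps power_inverse)
    have w: "w $ i \<in> left_ends (\<beta> $ i) n" "0 \<le> w $ i" "w $ i < 1" for i
      using cyl_start_in_left_ends[OF \<beta> x01] by (auto simp: w_def left_ends_def)
    define e where "e = (\<chi> i. if ?b i \<le> \<tau> then of_int \<lfloor>w $ i / \<tau>\<rfloor> * \<tau> else w $ i)"
    define m where "m = (\<chi> i. \<lfloor>v $ i / (\<tau> / norm (?g i))\<rfloor>)"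
    have "e $ i \<in> G i" for i
    proof (cases "?b i \<le> \<tau>")
      case True
      have "0 \<le> \<lfloor>w $ i / \<tau>\<rfloor>" "\<lfloor>w $ i / \<tau>\<rfloor> \<le> \<lfloor>1 / \<tau>\<rfloor>"
        using w(2,3)[of i] \<tau> by (auto intro!: floor_mono divide_right_mono)
      then show ?thesis using True by (auto simp: e_def G_def)
    qed (use w in \<open>simp add: e_def G_def\<close>)
    then have "e \<in> Es" by (simp add: Es_def)
    moreover have "m $ i \<in> {- N i..N i}" for i
    proof -
      have "\<bar>v $ i / (\<tau> / norm (?g i))\<bar> \<le> ?d * norm (?g i) / \<tau>"
        using v(2)[of i] gp[of i] \<tau> by (simp add: abs_mult divide_right_mono mult_right_mono)
      moreover have "- \<lceil>Y\<rceil> \<le> \<lfloor>X\<rfloor> \<and> \<lfloor>X\<rfloor> \<le> \<lceil>Y\<rceil>" if "\<bar>X\<bar> \<le> Y" for X Y :: real using that by linarith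
      ultimately show ?thesis unfolding N_def m_def vec_lambda_beta atLeastAtMost_iff by blast
    qed
    then have "m \<in> Ms" by (simp add: Ms_def)
    moreover have "x \<in> cell (e, m)"
    proof -
      have 1: "0 \<le> (w - e) $ i \<and> (w - e) $ i \<le> \<tau>" for i
      proof (cases "?b i \<le> \<tau>")
        case True
        have "of_int \<lfloor>w $ i / \<tau>\<rfloor> * \<tau> \<le> w $ i" using \<tau> by (simp add: pos_le_divide_eq[symmetric])
        moreover have "w $ i / \<tau> \<le> of_int \<lfloor>w $ i / \<tau>\<rfloor> + 1" by linarith
        then have "w $ i \<le> (of_int \<lfloor>w $ i / \<tau>\<rfloor> + 1) * \<tau>" using \<tau> by (simp only: pos_divide_le_eq)
        ultimately show ?thesis using True by (simp add: e_def distrib_right)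
      qed (use \<tau> in \<open>simp add: e_def\<close>)
      have 2: "of_int (m $ i) * (\<tau> / norm (?g i)) \<le> v $ i \<and> v $ i \<le> (of_int (m $ i) + 1) * (\<tau> / norm (?g i))" for i
      proof -
        let ?t = "\<tau> / norm (?g i)"
        have t: "0 < ?t" using gp[of i] \<tau> by simp
        have "of_int \<lfloor>v $ i / ?t\<rfloor> \<le> v $ i / ?t" "v $ i / ?t \<le> of_int \<lfloor>v $ i / ?t\<rfloor> + 1" by linarith+
        then show ?thesis using t unfolding m_def vec_lambda_beta by (simp only: pos_le_divide_eq pos_divide_le_eq)
      qed
      have "x = e + (w - e) + (q + combine ?g v)" using xw by simp
      then show ?thesis unfolding cell_def using 1 2 by blast
    qed
    ultimately show "x \<in> \<Union> \<C>" unfolding \<C>_def by blast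
  qed
  moreover have "finite \<C>" unfolding \<C>_def using fin by (rule finite_imageI)
  ultimately show ?thesis using card by blast
qed

end

text \<open>Write \<open>x = z ^ (2 * d)\<close>. One half of the exponent keeps
  \<open>((n + 1) * z ^ n) ^ d\<close> bounded, the other half is a convergent geometric
  series.\<close>

lemma summable_poly_times_geometric:
  fixes x :: real
  assumes "0 < x" "x < 1"
  shows "summable (\<lambda>n. real (n + 1) ^ d * x ^ n)"
proof (cases d)
  case 0
  then show ?thesis using assms by (simp add: summable_geometric)
next
  case (Suc k)
  define z where "z = x powr (1 / (2 * real d))"
  have "x powr (1 / (2 * real d)) < 1 powr (1 / (2 * real d))"
    using assms Suc by (intro powr_less_mono2) auto
  then have z: "0 < z" "z < 1" using assms by (auto simp: z_def)
  have zx: "x = z ^ (2 * d)"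
  proof -
    have "z ^ (2 * d) = z powr (2 * real d)" using z by (simp add: powr_realpow[symmetric])
    also have "\<dots> = x powr (1 / (2 * real d) * (2 * real d))" unfolding z_def by (rule powr_powr)
    also have "1 / (2 * real d) * (2 * real d) = 1" using Suc by simp
    finally show ?thesis using assms by simp
  qed
  have "(\<lambda>n. real n / (1 / z) ^ n) \<longlonglongrightarrow> 0" using z by (intro lim_n_over_pown) auto
  then have "(\<lambda>n. real n / (1 / z) ^ n + z ^ n) \<longlonglongrightarrow> 0 + 0"
    using z by (intro tendsto_add LIMSEQ_power_zero) auto
  then have "Bseq (\<lambda>n. real n / (1 / z) ^ n + z ^ n)" by (intro convergent_imp_Bseq convergentI)
  then obtain B where B: "\<And>n. norm (real n / (1 / z) ^ n + z ^ n) \<le> B" using BseqE by blast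
  have bd: "real (n + 1) * z ^ n \<le> B" for n
    using B[of n] z by (simp add: power_one_over field_simps abs_of_nonneg)
  have le: "real (n + 1) ^ d * x ^ n \<le> B ^ d * (z ^ d) ^ n" for n
  proof -
    have "x ^ n = (z ^ n) ^ d * (z ^ d) ^ n"
      unfolding zx by (simp add: power_mult[symmetric] power_add[symmetric] algebra_simps mult_2_right)
    then have "real (n + 1) ^ d * x ^ n = (real (n + 1) * z ^ n) ^ d * (z ^ d) ^ n"
      by (simp add: power_mult_distrib mult.assoc)
    also have "\<dots> \<le> B ^ d * (z ^ d) ^ n"
      using bd[of n] z by (intro mult_right_mono power_mono) auto
    finally show ?thesis .
  qed
  have "z ^ d < 1" using z Suc by (simp add: power_less_one_iff del: power_Suc)
  then have "summable (\<lambda>n. B ^ d * (z ^ d) ^ n)"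
    using z by (intro summable_mult summable_geometric) auto
  then show ?thesis
    by (rule summable_comparison_test'[where N = 0]) (use le assms in auto)
qed

lemma s_star_bounds:
  fixes \<beta> :: "real ^ 'd"
  assumes \<beta>: "\<And>i. \<beta> $ i > 1"
    and fr: "\<And>n. 1 \<le> n \<Longrightarrow> \<exists>\<kappa> u a q. greedy_frame \<beta> n (P n) (\<gamma> n) \<kappa> u a q"
  shows "0 \<le> s_star \<beta> \<gamma>" "s_star \<beta> \<gamma> \<le> ereal (real CARD('d))"
proof -
  have "eventually (\<lambda>n. total_contraction \<beta> n < 1) sequentially"
    using order_tendstoD(2)[OF total_contraction_tendsto_0[OF \<beta>] zero_less_one] .
  then have ev: "eventually (\<lambda>n. \<forall>s\<in>scales \<beta> n (\<gamma> n). 0 < s \<and> s < 1) sequentially"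
    using eventually_ge_at_top[of 1]
  proof eventually_elim
    case (elim n)
    then obtain \<kappa> u a q where "greedy_frame \<beta> n (P n) (\<gamma> n) \<kappa> u a q" using fr by blast
    then show ?case using elim(1) greedy_frame.scale_bounds by fastforce
  qed
  have "eventually (\<lambda>n. 0 \<le> ereal (s_num \<beta> n (\<gamma> n))) sequentially"
    using ev by eventually_elim (use s_num_nonneg[OF \<beta>] in auto)
  then show "0 \<le> s_star \<beta> \<gamma>" unfolding s_star_def by (intro le_Limsup) auto
  have "eventually (\<lambda>n. ereal (s_num \<beta> n (\<gamma> n)) \<le> ereal (real CARD('d))) sequentially"
    using ev
  proof eventually_elim
    case (elim n)
    then have "s_num \<beta> n (\<gamma> n) \<le> real CARD('d)" by (intro s_num_le_CARD) blast
    then show ?case by simp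
  qed
  then show "s_star \<beta> \<gamma> \<le> ereal (real CARD('d))" unfolding s_star_def by (rule Limsup_bounded)
qed

lemma total_contraction_le:
  fixes \<beta> :: "real ^ 'd"
  assumes \<beta>: "\<And>i. \<beta> $ i > 1"
  obtains \<rho> where "0 < \<rho>" "\<rho> < 1" "\<And>n. total_contraction \<beta> n \<le> real CARD('d) * \<rho> ^ n"
proof -
  define \<rho> where "\<rho> = Max (range (\<lambda>i. inverse (\<beta> $ i)))"
  have "\<rho> \<in> range (\<lambda>i. inverse (\<beta> $ i))" unfolding \<rho>_def by (intro Max_in) auto
  then obtain i where "\<rho> = inverse (\<beta> $ i)" by blast
  then have \<rho>: "0 < \<rho>" "\<rho> < 1" using \<beta>[of i] by (auto simp: inverse_less_1_iff)
  have le: "inverse (\<beta> $ i) \<le> \<rho>" for i unfolding \<rho>_def by (intro Max_ge) auto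
  have "total_contraction \<beta> n \<le> (\<Sum>i\<in>(UNIV :: 'd set). \<rho> ^ n)" for n
    using le \<beta> by (intro sum_mono power_mono) (auto intro: less_imp_le order.strict_trans[OF zero_less_one])
  then show thesis using that[OF \<rho>] by simp
qed

text \<open>At the scale \<tau> attaining \<open>s_num\<close>, the profile is at least
  \<open>\<tau> powr t'\<close>, so the cover has at most a polynomial in \<open>n\<close> times
  \<open>\<tau> powr - t'\<close> sets. With gauge of exponent \<open>t\<close> there remains
  \<open>\<tau> powr (t - t')\<close>, which decays geometrically.\<close>

lemma hausdorff_dim_W_le:
  fixes \<beta> :: "real ^ 'd"
  assumes \<beta>: "\<And>i. \<beta> $ i > 1"
    and fr: "\<And>n. 1 \<le> n \<Longrightarrow> \<exists>\<kappa> u a q. greedy_frame \<beta> n (P n) (\<gamma> n) \<kappa> u a q"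
  shows "hausdorff_dim (W_set \<beta> P) \<le> s_star \<beta> \<gamma>"
proof (rule hausdorff_dim_leI)
  show "0 \<le> s_star \<beta> \<gamma>" by (rule s_star_bounds[OF \<beta> fr])
  fix t assume t: "0 < t" "s_star \<beta> \<gamma> < ereal t"
  let ?d = "real CARD('d)"
  define C where "C = (3 * (2 * ?d + 3)) ^ CARD('d)"
  obtain t' where t': "s_star \<beta> \<gamma> < ereal t'" "ereal t' < ereal t" using ereal_dense2[OF t(2)] by blast
  obtain \<rho> where \<rho>: "0 < \<rho>" "\<rho> < 1" "\<And>n. total_contraction \<beta> n \<le> ?d * \<rho> ^ n"
    by (rule total_contraction_le[OF \<beta>]) (rule that)
  have "eventually (\<lambda>n. ereal (s_num \<beta> n (\<gamma> n)) < ereal t') sequentially"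
    using t'(1) unfolding s_star_def by (rule Limsup_lessD)
  moreover have "eventually (\<lambda>n. total_contraction \<beta> n < 1) sequentially"
    using order_tendstoD(2)[OF total_contraction_tendsto_0[OF \<beta>] zero_less_one] .
  ultimately have "eventually (\<lambda>n. s_num \<beta> n (\<gamma> n) < t' \<and> total_contraction \<beta> n < 1 \<and> 1 \<le> n) sequentially"
    using eventually_ge_at_top[of 1] by eventually_elim simp
  then obtain N where N: "\<And>n. N \<le> n \<Longrightarrow> s_num \<beta> n (\<gamma> n) < t'" "\<And>n. N \<le> n \<Longrightarrow> total_contraction \<beta> n < 1"
    "\<And>n. N \<le> n \<Longrightarrow> 1 \<le> n"
    by (auto simp: eventually_sequentially)
  define good where "good n \<C> \<tau> \<longleftrightarrow> 0 < \<tau> \<and> \<tau> \<le> ?d * \<rho> ^ n \<and> finite \<C> \<and> hit_set \<beta> n (P n) \<subseteq> \<Union> \<C> \<and>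
    (\<forall>S\<in>\<C>. \<forall>x\<in>S. \<forall>y\<in>S. dist x y \<le> 2 * ?d * \<tau>) \<and>
    real (card \<C>) \<le> C * real (n + 1) ^ CARD('d) * \<tau> powr - t'" for n \<C> \<tau>
  have "\<exists>\<C> \<tau>. good n \<C> \<tau>" if n: "N \<le> n" for n
  proof -
    obtain \<kappa> u a q where "greedy_frame \<beta> n (P n) (\<gamma> n) \<kappa> u a q" using fr[OF N(3)[OF n]] by blast
    then interpret greedy_frame \<beta> n "P n" "\<gamma> n" \<kappa> u a q .
    obtain \<tau> where \<tau>: "\<tau> \<in> scales \<beta> n (\<gamma> n)" "s_num \<beta> n (\<gamma> n) = scale_value \<beta> n (\<gamma> n) \<tau>"
      by (rule s_num_attained)
    have \<tau>01: "0 < \<tau>" "\<tau> < 1" "\<tau> \<le> ?d * \<rho> ^ n"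
      using scale_bounds[OF \<tau>(1)] N(2)[OF n] \<rho>(3)[of n] by auto
    obtain \<C> where \<C>: "finite \<C>" "hit_set \<beta> n (P n) \<subseteq> \<Union> \<C>"
      "\<forall>S\<in>\<C>. \<forall>x\<in>S. \<forall>y\<in>S. dist x y \<le> 2 * ?d * \<tau>"
      "real (card \<C>) * profile \<beta> n (\<gamma> n) \<tau> \<le> C * real (n + 1) ^ CARD('d)"
      using hit_set_cover[OF \<tau>01(1,2)] unfolding C_def by blast
    have "\<tau> powr t' \<le> \<tau> powr scale_value \<beta> n (\<gamma> n) \<tau>"
      using N(1)[OF n] \<tau>01 \<tau>(2) by (intro powr_mono') auto
    also have "\<dots> = profile \<beta> n (\<gamma> n) \<tau>"
      using \<tau>01 by (intro profile_eq_powr_scale_value[symmetric] \<beta> norm_gamma_pos) auto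
    finally have "real (card \<C>) * \<tau> powr t' \<le> real (card \<C>) * profile \<beta> n (\<gamma> n) \<tau>"
      by (intro mult_left_mono) auto
    then have "real (card \<C>) * \<tau> powr t' \<le> C * real (n + 1) ^ CARD('d)" using \<C>(4) by linarith
    then have "real (card \<C>) \<le> C * real (n + 1) ^ CARD('d) * \<tau> powr - t'"
      using \<tau>01 by (simp add: powr_minus_divide pos_le_divide_eq)
    then have "good n \<C> \<tau>" unfolding good_def using \<tau>01 \<C>(1-3) by blast
    then show ?thesis by blast
  qed
  then have "\<forall>n. \<exists>z. N \<le> n \<longrightarrow> good n (fst z) (snd z)" by (metis fst_conv snd_conv)
  from choice[OF this] obtain z where z: "\<And>n. N \<le> n \<Longrightarrow> good n (fst (z n)) (snd (z n))" by blast
  \<comment> \<open>Orders below \<open>N\<close>, where \<open>s_num\<close> or the scales may be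
    too large, contribute empty families; a limsup set does not notice them.\<close>
  define \<C> where "\<C> n = (if N \<le> n then fst (z n) else {})" for n
  define r where "r n = (if N \<le> n then 2 * ?d * snd (z n) else 0)" for n
  define K where "K = (2 * ?d) powr t * (C * ?d powr (t - t'))"
  have C0: "0 \<le> C" by (simp add: C_def)
  have tt: "0 < t - t'" using t'(2) by simp
  have g: "0 < snd (z n)" "snd (z n) \<le> ?d * \<rho> ^ n" "finite (\<C> n)" "hit_set \<beta> n (P n) \<subseteq> \<Union> (\<C> n)"
    "\<And>S x y. S \<in> \<C> n \<Longrightarrow> x \<in> S \<Longrightarrow> y \<in> S \<Longrightarrow> dist x y \<le> r n"
    "real (card (\<C> n)) \<le> C * real (n + 1) ^ CARD('d) * snd (z n) powr - t'" if "N \<le> n" for n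
    using z[OF that] that unfolding good_def \<C>_def r_def by auto
  have r0: "0 \<le> r n" for n using g(1)[of n] by (auto simp: r_def intro: less_imp_le)
  show "hausdorff_measure t (W_set \<beta> P) = 0"
  proof (rule hausdorff_measure_eq_0I[OF t(1)])
    show "finite (\<C> n)" for n using g(3)[of n] by (cases "N \<le> n") (auto simp: \<C>_def)
    show "0 \<le> r n" for n by (rule r0)
    show "r \<longlonglongrightarrow> 0"
    proof (rule Lim_null_comparison)
      have "norm (r n) \<le> 2 * ?d * (?d * \<rho> ^ n)" for n
      proof (cases "N \<le> n")
        case True
        then have "r n \<le> 2 * ?d * (?d * \<rho> ^ n)" unfolding r_def using g(2)[OF True]
          by (simp only: if_True) (intro mult_left_mono, auto)
        then show ?thesis using r0[of n] by simp
      qed (use \<rho> in \<open>simp add: r_def\<close>)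
      then show "eventually (\<lambda>n. norm (r n) \<le> 2 * ?d * (?d * \<rho> ^ n)) sequentially" by simp
      have "(\<lambda>n. 2 * ?d * (?d * \<rho> ^ n)) \<longlonglongrightarrow> 2 * ?d * (?d * 0)"
        using \<rho> by (intro tendsto_intros LIMSEQ_power_zero) auto
      then show "(\<lambda>n. 2 * ?d * (?d * \<rho> ^ n)) \<longlonglongrightarrow> 0" by simp
    qed
    show "bounded S \<and> diameter S \<le> r n" if S: "S \<in> \<C> n" for n S
    proof -
      have "N \<le> n" using S by (auto simp: \<C>_def split: if_splits)
      then have d: "dist x y \<le> r n" if "x \<in> S" "y \<in> S" for x y using g(5) S that by blast
      then have "bounded S" unfolding bounded_def by blast
      moreover have "diameter S \<le> r n" using d r0 by (intro diameter_le) (auto simp: dist_norm)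
      ultimately show ?thesis by blast
    qed
    show "\<exists>\<^sub>\<infinity>n. x \<in> \<Union> (\<C> n)" if x: "x \<in> W_set \<beta> P" for x
      unfolding INFM_nat_le
    proof
      fix k
      obtain n where n: "max k N \<le> n" "(beta_prod \<beta> ^^ n) x \<in> P n"
        using x unfolding W_set_def INFM_nat_le by blast
      then have "x \<in> hit_set \<beta> n (P n)" using x by (simp add: hit_set_def W_set_def)
      then show "\<exists>n\<ge>k. x \<in> \<Union> (\<C> n)" using g(4)[of n] n(1) by (intro exI[of _ n]) auto
    qed
    have le: "real (card (\<C> n)) * r n powr t \<le> K * (real (n + 1) ^ CARD('d) * (\<rho> powr (t - t')) ^ n)" for n
    proof (cases "N \<le> n")
      case True
      let ?\<tau> = "snd (z n)"
      have "real (card (\<C> n)) * r n powr t \<le>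
          (C * real (n + 1) ^ CARD('d) * ?\<tau> powr - t') * ((2 * ?d) powr t * ?\<tau> powr t)"
        using g(6)[OF True] g(1)[OF True] True by (simp add: r_def powr_mult mult_right_mono)
      also have "\<dots> = (2 * ?d) powr t * C * real (n + 1) ^ CARD('d) * (?\<tau> powr - t' * ?\<tau> powr t)"
        by (simp only: ac_simps)
      also have "?\<tau> powr - t' * ?\<tau> powr t = ?\<tau> powr (t - t')" by (simp add: powr_add[symmetric])
      also have "(2 * ?d) powr t * C * real (n + 1) ^ CARD('d) * ?\<tau> powr (t - t') \<le>
          (2 * ?d) powr t * C * real (n + 1) ^ CARD('d) * (?d * \<rho> ^ n) powr (t - t')"
        using g(1,2)[OF True] tt C0 by (intro mult_left_mono powr_mono2) auto
      also have "(?d * \<rho> ^ n) powr (t - t') = ?d powr (t - t') * (\<rho> powr (t - t')) ^ n"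
        using \<rho> by (simp add: powr_mult powr_realpow[symmetric] powr_powr mult.commute)
      finally show ?thesis by (simp add: K_def ac_simps)
    next
      case False
      then show ?thesis using C0 by (simp add: \<C>_def K_def)
    qed
    have "\<rho> powr (t - t') < 1 powr (t - t')" using \<rho> tt by (intro powr_less_mono2) auto
    then have "summable (\<lambda>n. K * (real (n + 1) ^ CARD('d) * (\<rho> powr (t - t')) ^ n))"
      using \<rho> by (intro summable_mult summable_poly_times_geometric) auto
    then show "summable (\<lambda>n. real (card (\<C> n)) * r n powr t)"
      by (rule summable_comparison_test'[where N = 0]) (use le in auto)
  qed
qed

theorem theorem1p1:
  fixes \<beta> :: "real ^ 'd"
    and P :: "nat \<Rightarrow> (real ^ 'd) set"
    and \<alpha> :: "nat \<Rightarrow> 'd \<Rightarrow> real ^ 'd"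
    and \<gamma> :: "nat \<Rightarrow> nat \<Rightarrow> real ^ 'd"
  assumes "\<And>i. \<beta> $ i > 1"
    and "\<And>n. n \<ge> 1 \<Longrightarrow> parallelepiped_with_edges (\<alpha> n) (P n)"
    and "\<And>n. n \<ge> 1 \<Longrightarrow> P n \<subseteq> half_open_unit_cube"
    and "\<And>n. n \<ge> 1 \<Longrightarrow> greedy_gram_schmidt (\<lambda>j. (contraction \<beta> ^^ n) (\<alpha> n j)) (\<gamma> n)"
  shows "hausdorff_dim (W_set \<beta> P) = s_star \<beta> \<gamma> \<and>
    (gdelta (W_set \<beta> P) \<longrightarrow> W_set \<beta> P \<in> large_intersection_class (s_star \<beta> \<gamma>)) \<and>
    (\<exists>F \<in> large_intersection_class (s_star \<beta> \<gamma>). F \<subseteq> W_set \<beta> P)"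
proof -
  let ?W = "W_set \<beta> P" and ?s = "s_star \<beta> \<gamma>"
  have fr: "\<exists>\<kappa> u a q. greedy_frame \<beta> n (P n) (\<gamma> n) \<kappa> u a q" if "1 \<le> n" for n
    by (rule ex_greedy_frame[OF assms(1) assms(2)[OF that] assms(3)[OF that] assms(4)[OF that]])
  obtain F where F: "F \<in> large_intersection_class ?s" "F \<subseteq> ?W"
    using large_intersection_subset_W[OF assms] by blast
  have "hausdorff_dim ?W \<le> ?s" by (rule hausdorff_dim_W_le[OF assms(1) fr])
  moreover have "?s \<le> hausdorff_dim ?W"
    using F by (intro hausdorff_dim_large_intersection s_star_bounds(2)[OF assms(1) fr])
  \<comment> \<open>The content condition passes from \<open>F\<close> to the larger set. Being a
    G-delta does not, and closed \<open>P n\<close> can destroy it, so it appears as a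
    condition.\<close>
  moreover have "?W \<in> large_intersection_class ?s" if "gdelta ?W"
    unfolding large_intersection_class_def
  proof (intro CollectI conjI allI impI)
    show "?W \<subseteq> unit_cube"
      by (auto simp: W_set_def half_open_unit_cube_def unit_cube_def intro: less_imp_le)
    show "gdelta ?W" by fact
    fix t m k assume "0 < t" "ereal t < ?s" "dyadic_cube m k \<subseteq> (unit_cube :: (real ^ 'd) set)"
    then have "dyadic_content t (dyadic_cube m k) = dyadic_content t (F \<inter> dyadic_cube m k)"
      using F(1) unfolding large_intersection_class_def by auto
    also have "\<dots> \<le> dyadic_content t (?W \<inter> dyadic_cube m k)"
      using F(2) by (intro dyadic_content_mono) auto
    finally show "dyadic_content t (?W \<inter> dyadic_cube m k) = dyadic_content t (dyadic_cube m k)"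
      using dyadic_content_mono[OF Int_lower2] by (rule antisym[rotated])
  qed
  ultimately show ?thesis using F by (auto intro: antisym)
qed

end
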